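(* Let $N$ be a positive integer and let $j_1,\dots,j_N\in\frac12\mathbb{Z}_{\ge 0}$ be spins. Let $I<J<K\le N$ be indices with $I>1$ and $J>I+1$. Let $|\vec a\rangle$ and $|\vec a'\rangle$ be two vectors of the gauge invariant standard recoupling basis of $\bigotimes_{n=1}^N \mathcal{H}_{j_n}$ (total angular momentum $0$), with intermediate spins $a_1=j_1,a_2,\dots,a_{N-1},a_N=0$ and $a'_1=j_1,a'_2,\dots,a'_{N-1},a'_N=0$ respectively. Let $\hat q_{IJK}=\big[(J_I+J_J)^2,(J_J+J_K)^2\big]$. Then $$ \begin{aligned} \langle\vec a|\hat q_{IJK}|\vec a'\rangle =\;&\tfrac14(-1)^{j_K+j_I+a_{I-1}+a_K}\,(-1)^{a_I-a'_I}\,(-1)^{\sum_{n=I+1}^{J-1}j_n}\,(-1)^{-\sum_{p=J+1}^{K-1}j_p}\\ &\times X(j_I,j_J)^{\frac12}X(j_J,j_K)^{\frac12}\sqrt{(2a_I+1)(2a'_I+1)}\sqrt{(2a_J+1)(2a'_J+1)}\\ &\times\begin{Bmatrix}a_{I-1}&j_I&a_I\\1&a'_I&j_I\end{Bmatrix} \left[\prod_{n=I+1}^{J-1}\sqrt{(2a'_n+1)(2a_n+1)}\,(-1)^{a'_{n-1}+a_{n-1}+1}\begin{Bmatrix}j_n&a'_{n-1}&a'_n\\1&a_n&a_{n-1}\end{Bmatrix}\right]\\ &\times\left[\prod_{n=J+1}^{K-1}\sqrt{(2a'_n+1)(2a_n+1)}\,(-1)^{a'_{n-1}+a_{n-1}+1}\begin{Bmatrix}j_n&a'_{n-1}&a'_n\\1&a_n&a_{n-1}\end{Bmatrix}\right]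 \begin{Bmatrix}a_K&j_K&a_{K-1}\\1&a'_{K-1}&j_K\end{Bmatrix}\\ &\times\left[(-1)^{a'_J+a'_{J-1}}\begin{Bmatrix}a_J&j_J&a'_{J-1}\\1&a_{J-1}&j_J\end{Bmatrix}\begin{Bmatrix}a'_{J-1}&j_J&a'_J\\1&a_J&j_J\end{Bmatrix} -(-1)^{a_J+a_{J-1}}\begin{Bmatrix}a'_J&j_J&a'_{J-1}\\1&a_{J-1}&j_J\end{Bmatrix}\begin{Bmatrix}a_{J-1}&j_J&a'_J\\1&a_J&j_J\end{Bmatrix}\right]\\ &\times\prod_{n=2}^{I-1}\delta_{a_na'_n}\prod_{n=K}^{N}\delta_{a_na'_n}, \end{aligned} $$ where $X(b,c)=2b(2b+1)(2b+2)\,2c(2c+1)(2c+2)$.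
   Context: For a spin $j\in\frac12\mathbb{Z}_{\ge0}$, $\mathcal{H}_j$ is the $(2j+1)$-dimensional irreducible representation space of $SU(2)$ with its standard orthonormal basis $|j\,m\rangle$, $m=-j,\dots,j$ (standard Condon–Shortley phase conventions). On $\bigotimes_{n=1}^N\mathcal{H}_{j_n}$, $J_n=(J_n^1,J_n^2,J_n^3)$ denotes the self-adjoint angular momentum operators acting on the $n$-th factor, $[J_n^i,J_m^j]=i\,\delta_{nm}\,\epsilon^{ijk}J_n^k$, and for a vector operator $V$ one writes $V^2=\sum_{i=1}^3 (V^i)^2$. Standard recoupling basis: the spins are coupled successively in the order $1,2,\dots,N$. Put $a_1=j_1$; for $n\ge 2$, given a state with intermediate spin $a_{n-1}$ and magnetic number $m'$ built from the first $n-1$ factors, the state with intermediate spin $a_n$ (where $|a_{n-1}-j_n|\le a_n\le a_{n-1}+j_n$ in integer steps) is $|\dots a_{n-1},a_n;m\rangle=\sum_{m'+m_n=m}\langle a_{n-1}\,m';j_n\,m_n|a_{n}\,m\rangle\;|\dots a_{n-1};m'\rangle\otimes|j_n\,m_n\rangle$ with the (real) Clebsch–Gordan coefficients. Thus $a_n(a_n+1)$ is the eigenvalue of $(J_1+\dots+J_n)^2$. The gauge invariant basis vectors $|\vec a\rangle$ are those with $a_N=0$ (total angular momentum $0$, magnetic number $0$); $\vec a=(a_2,\dots,a_{N-1})$ ranges over all values admissible in successive coupling. Braces denote the usual Wigner $6j$-symbols, understood to be $0$ when one of the four triads violates the triangle/integrality conditions. Individual exponents of $(-1)$ may be half-integers;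 in each term of the expanded formula the total exponent is an integer and $(-1)^{x}(-1)^{y}=(-1)^{x+y}$ is used to combine them. *)

theory Defs
  imports "HOL-Analysis.Analysis"
begin

section \<open>Spins and magnetic numbers\<close>

definition spin :: "real \<Rightarrow> bool" where
  "spin j \<longleftrightarrow> 2 * j \<in> \<nat>"

definition mags :: "real \<Rightarrow> real set" where
  "mags j = {m. - j \<le> m \<and> m \<le> j \<and> j - m \<in> \<int>}"

lemma finite_mags [simp]: "finite (mags j)"
proof -
  have "mags j \<subseteq> (\<lambda>i::int. j - of_int i) ` {0..\<lfloor>2 * j\<rfloor>}"
  proof
    fix m assume m: "m \<in> mags j"
    then obtain i :: int where i: "j - m = of_int i"
      by (auto simp: mags_def elim: Ints_cases)
    have "m = j - of_int i" using i by simp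
    moreover have "i \<in> {0..\<lfloor>2 * j\<rfloor>}"
      using m i by (auto simp: mags_def le_floor_iff)
    ultimately show "m \<in> (\<lambda>i::int. j - of_int i) ` {0..\<lfloor>2 * j\<rfloor>}" by blast
  qed
  then show ?thesis by (rule finite_subset) simp
qed

definition triad :: "real \<Rightarrow> real \<Rightarrow> real \<Rightarrow> bool" where
  "triad a b c \<longleftrightarrow> \<bar>a - b\<bar> \<le> c \<and> c \<le> a + b \<and> a + b + c \<in> \<int>"


section \<open>Clebsch-Gordan coefficients, 3j- and 6j-symbols\<close>

text \<open>Factorial of a nonnegative integer, and sign with integer exponent, for arguments
  given as real numbers. For spins, other arguments occur only in terms that vanish
  because the Clebsch-Gordan coefficient in them is \<open>0\<close>.\<close>

definition rfact :: "real \<Rightarrow> real" where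
  "rfact x = fact (nat \<lfloor>x\<rfloor>)"

definition sign_int :: "real \<Rightarrow> real" where
  "sign_int x = (- 1) powi \<lfloor>x\<rfloor>"

text \<open>\<open>cg j1 m1 j2 m2 j m\<close> is \<open>\<langle>j1 m1; j2 m2 | j m\<rangle>\<close> in the Condon-Shortley convention, by
  Racah's closed formula; \<open>k\<close> runs over all values for which no factorial has a
  negative argument.\<close>

definition cg :: "real \<Rightarrow> real \<Rightarrow> real \<Rightarrow> real \<Rightarrow> real \<Rightarrow> real \<Rightarrow> real" where
  "cg j1 m1 j2 m2 j m =
    (if triad j1 j2 j \<and> m1 \<in> mags j1 \<and> m2 \<in> mags j2 \<and> m \<in> mags j \<and> m1 + m2 = m
     then sqrt ((2 * j + 1) * rfact (j1 + j2 - j) * rfact (j1 - j2 + j) * rfact (- j1 + j2 + j)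
                / rfact (j1 + j2 + j + 1))
        * sqrt (rfact (j1 + m1) * rfact (j1 - m1) * rfact (j2 + m2) * rfact (j2 - m2)
                * rfact (j + m) * rfact (j - m))
        * (\<Sum>k | real k \<le> j1 + j2 - j \<and> real k \<le> j1 - m1 \<and> real k \<le> j2 + m2
                 \<and> 0 \<le> j - j2 + m1 + real k \<and> 0 \<le> j - j1 - m2 + real k.
            (- 1) ^ k /
            (fact k * rfact (j1 + j2 - j - real k) * rfact (j1 - m1 - real k)
             * rfact (j2 + m2 - real k) * rfact (j - j2 + m1 + real k)
             * rfact (j - j1 - m2 + real k)))
     else 0)"

definition threej :: "real \<Rightarrow> real \<Rightarrow> real \<Rightarrow> real \<Rightarrow> real \<Rightarrow> real \<Rightarrow> real" where
  "threej j1 j2 j3 m1 m2 m3 =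
    sign_int (j1 - j2 - m3) / sqrt (2 * j3 + 1) * cg j1 m1 j2 m2 j3 (- m3)"

text \<open>\<open>sixj j1 j2 j3 l1 l2 l3\<close> has upper row \<open>j1 j2 j3\<close> and lower row \<open>l1 l2 l3\<close>; this is
  the definition through 3j-symbols in DLMF 34.4.1. The four 3j-symbols carry the
  four triads, so a violated triad makes every summand vanish.\<close>

definition sixj :: "real \<Rightarrow> real \<Rightarrow> real \<Rightarrow> real \<Rightarrow> real \<Rightarrow> real \<Rightarrow> real" where
  "sixj j1 j2 j3 l1 l2 l3 =
    (\<Sum>m1\<in>mags j1. \<Sum>m2\<in>mags j2. \<Sum>m3\<in>mags j3. \<Sum>n1\<in>mags l1. \<Sum>n2\<in>mags l2. \<Sum>n3\<in>mags l3.
      sign_int (l1 + n1 + l2 + n2 + l3 + n3)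
      * threej j1 j2 j3 m1 m2 m3
      * threej j1 l2 l3 m1 n2 (- n3)
      * threej l1 j2 l3 (- n1) m2 n3
      * threej l1 l2 j3 n1 (- n2) m3)"


section \<open>The tensor product of spin representations\<close>

text \<open>A vector of \<open>\<H>\<^sub>j\<^sub>1 \<otimes> \<dots> \<otimes> \<H>\<^sub>j\<^sub>N\<close> is represented by its coefficients with respect to the
  product basis, which is indexed by the configurations \<open>s\<close> with \<open>s n \<in> mags (j n)\<close>.
  Values of a \<open>state\<close> away from \<open>configs N j\<close> carry no meaning.\<close>

type_synonym state = "(nat \<Rightarrow> real) \<Rightarrow> complex"

definition configs :: "nat \<Rightarrow> (nat \<Rightarrow> real) \<Rightarrow> (nat \<Rightarrow> real) set" where
  "configs N j = (\<Pi>\<^sub>E n\<in>{1..N}. mags (j n))"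

definition braket :: "nat \<Rightarrow> (nat \<Rightarrow> real) \<Rightarrow> state \<Rightarrow> state \<Rightarrow> complex" where
  "braket N j \<phi> \<psi> = (\<Sum>s\<in>configs N j. cnj (\<phi> s) * \<psi> s)"

text \<open>Matrix elements \<open>\<langle>j m| J\<^sup>i |j m'\<rangle>\<close> for a single spin, with \<open>J\<^sup>1 = (J\<^sub>+ + J\<^sub>-) / 2\<close> and
  \<open>J\<^sup>2 = (J\<^sub>+ - J\<^sub>-) / (2 \<i>)\<close>.\<close>

definition raise_elem :: "real \<Rightarrow> real \<Rightarrow> real \<Rightarrow> complex" where
  "raise_elem j m m' = (if m = m' + 1 then of_real (sqrt ((j - m') * (j + m' + 1))) else 0)"

definition lower_elem :: "real \<Rightarrow> real \<Rightarrow> real \<Rightarrow> complex" where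
  "lower_elem j m m' = (if m = m' - 1 then of_real (sqrt ((j + m') * (j - m' + 1))) else 0)"

definition spin_elem :: "nat \<Rightarrow> real \<Rightarrow> real \<Rightarrow> real \<Rightarrow> complex" where
  "spin_elem i j m m' =
    (if i = 1 then (raise_elem j m m' + lower_elem j m m') / 2
     else if i = 2 then (raise_elem j m m' - lower_elem j m m') / (2 * \<i>)
     else if i = 3 then (if m = m' then of_real m else 0)
     else 0)"

text \<open>\<open>ang j n i\<close> is the component \<open>J\<^sub>n\<^sup>i\<close>, acting on the \<open>n\<close>-th tensor factor.\<close>

definition ang :: "(nat \<Rightarrow> real) \<Rightarrow> nat \<Rightarrow> nat \<Rightarrow> state \<Rightarrow> state" where
  "ang j n i \<psi> = (\<lambda>s. \<Sum>m'\<in>mags (j n). spin_elem i (j n) (s n) m' * \<psi> (s(n := m')))"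

definition vec_add :: "(nat \<Rightarrow> state \<Rightarrow> state) \<Rightarrow> (nat \<Rightarrow> state \<Rightarrow> state) \<Rightarrow> nat \<Rightarrow> state \<Rightarrow> state" where
  "vec_add V W i \<psi> = (\<lambda>s. V i \<psi> s + W i \<psi> s)"

definition vec_sq :: "(nat \<Rightarrow> state \<Rightarrow> state) \<Rightarrow> state \<Rightarrow> state" where
  "vec_sq V \<psi> = (\<lambda>s. \<Sum>i\<in>{1..3}. V i (V i \<psi>) s)"

definition commutator :: "(state \<Rightarrow> state) \<Rightarrow> (state \<Rightarrow> state) \<Rightarrow> state \<Rightarrow> state" where
  "commutator A B \<psi> = (\<lambda>s. A (B \<psi>) s - B (A \<psi>) s)"

definition q_hat :: "(nat \<Rightarrow> real) \<Rightarrow> nat \<Rightarrow> nat \<Rightarrow> nat \<Rightarrow> state \<Rightarrow> state" where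
  "q_hat j I J K =
    commutator (vec_sq (vec_add (ang j I) (ang j J))) (vec_sq (vec_add (ang j J) (ang j K)))"


section \<open>The standard recoupling basis\<close>

text \<open>\<open>tensor_ket n \<psi> m\<close> is \<open>\<psi> \<otimes> |j\<^sub>n m\<rangle>\<close> for a vector \<open>\<psi>\<close> of the first \<open>n - 1\<close> factors, i.e. a
  \<open>\<psi>\<close> that depends on the first \<open>n - 1\<close> entries of a configuration only.\<close>

definition tensor_ket :: "nat \<Rightarrow> state \<Rightarrow> real \<Rightarrow> state" where
  "tensor_ket n \<psi> m = (\<lambda>s. \<psi> s * of_bool (s n = m))"

text \<open>\<open>coupled j a n m\<close> is \<open>|a\<^sub>2 \<dots> a\<^sub>n; m\<rangle>\<close>, a vector of the first \<open>n\<close> factors. The coupling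
  starts at \<open>n = 1\<close>; the value at \<open>n = 0\<close> is a dummy.\<close>

fun coupled :: "(nat \<Rightarrow> real) \<Rightarrow> (nat \<Rightarrow> real) \<Rightarrow> nat \<Rightarrow> real \<Rightarrow> state" where
  "coupled j a 0 m = (\<lambda>s. 0)"
| "coupled j a (Suc 0) m = (\<lambda>s. of_bool (s 1 = m))"
| "coupled j a (Suc (Suc n)) m =
    (\<lambda>s. \<Sum>(m', mn)\<in>{(m', mn). m' \<in> mags (a (Suc n)) \<and> mn \<in> mags (j (Suc (Suc n))) \<and> m' + mn = m}.
       of_real (cg (a (Suc n)) m' (j (Suc (Suc n))) mn (a (Suc (Suc n))) m)
       * tensor_ket (Suc (Suc n)) (coupled j a (Suc n) m') mn s)"

text \<open>Intermediate spins \<open>a\<^sub>1 = j\<^sub>1, a\<^sub>2, \<dots>, a\<^sub>N = 0\<close> of a gauge invariant basis vector.\<close>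

definition gauge_inv :: "nat \<Rightarrow> (nat \<Rightarrow> real) \<Rightarrow> (nat \<Rightarrow> real) \<Rightarrow> bool" where
  "gauge_inv N j a \<longleftrightarrow> a 1 = j 1 \<and> (\<forall>n\<in>{2..N}. triad (a (n - 1)) (j n) (a n)) \<and> a N = 0"

definition basis_vec :: "nat \<Rightarrow> (nat \<Rightarrow> real) \<Rightarrow> (nat \<Rightarrow> real) \<Rightarrow> state" where
  "basis_vec N j a = coupled j a N 0"


section \<open>Factors of the matrix element\<close>

text \<open>\<open>(-1)\<^sup>x\<close> with half-integral exponents: the principal power \<open>exp (\<i> * pi * x)\<close>, which
  satisfies \<open>(-1)\<^sup>x * (-1)\<^sup>y = (-1)\<^sup>x\<^sup>+\<^sup>y\<close> for all real \<open>x\<close>, \<open>y\<close>.\<close>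

definition phase :: "real \<Rightarrow> complex" where
  "phase x = (- 1) powr of_real x"

lemma phase_add: "phase (x + y) = phase x * phase y"
  by (simp add: phase_def powr_add)

lemma phase_int: "phase (of_int k) = (- 1) powi k"
  by (simp add: phase_def powr_of_int power_int_def flip: power_inverse)

definition X_fac :: "real \<Rightarrow> real \<Rightarrow> real" where
  "X_fac b c = 2 * b * (2 * b + 1) * (2 * b + 2) * (2 * c) * (2 * c + 1) * (2 * c + 2)"

end

(* The commutator of the squares is 4 [J_I . J_J, J_J . J_K], because the Casimir operators are
   scalars on each factor. By Schur's lemma the space of invariants of three spins is spanned by the
   3j-symbol, so contracting three 3j-symbols along a triangle gives a 6j-symbol times a 3j-symbol.
   Let the spherical components of J_I, J_J, J_K act on the coupling tree one factor after the other.
   At I the operator J_I gets a reduced matrix element; each factor strictly between I and J or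
   between J and K multiplies it by one 6j-symbol; at J the contraction J_I . J_J turns the intermediate
   state into one whose spins agree with one basis vector below J and with the other from J on, and the
   remaining J_J starts a new reduced matrix element; at K the contraction J_J . J_K leaves a scalar.
   Every one of these moves is an instance of the triangle identity, and orthonormality of the
   Clebsch-Gordan coefficients gives the Kronecker deltas outside the range from I to K - 1. *)

theory Submission
  imports Defs
begin

section \<open>Signs, magnetic numbers and Racah sums\<close>

text \<open>Only one closed formula is ever evaluated, Racah's sum inside \<open>cg\<close>;
  6j-symbols stay sums over 3j-symbols throughout. Substitutions of the summation index give the
  symmetries of the 3j-symbol, a telescoping three-term recursion its invariance under raising.
  Schur's lemma yields proportionality only, so the constants have other sources: the norm of the
  3j-symbol is a binomial convolution at \<open>m3 = - j3\<close>, where Racah's sum has a single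
  term, and the reduced matrix element of an angular momentum is confirmed on its spherical
  components. The obstacle is the phase. \<open>sign_int\<close> takes a floor, so it is
  multiplicative only if one argument is an integer (not for \<open>1/2\<close> and
  \<open>1/2\<close>), and sign identities need integrality from triads and magnetic numbers. Where
  a triad fails, a 6j-symbol vanishes, so such cases are split off. Only the last stage passes to
  the complex \<open>phase\<close>, which is multiplicative without conditions. The two operator
  orders in the commutator differ only at site \<open>J\<close>. The chain is therefore run once
  with an abstract matrix there, and each order contributes one scalar.\<close>

lemma sign_int_add: "x \<in> \<int> \<Longrightarrow> sign_int (x + y) = sign_int x * sign_int y"
  by (auto elim!: Ints_cases simp: sign_int_def power_int_add add.commute)

lemma sign_int_add': "y \<in> \<int> \<Longrightarrow> sign_int (x + y) = sign_int x * sign_int y"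
  by (metis add.commute mult.commute sign_int_add)

lemma sign_int_sq [simp]: "sign_int x * sign_int x = 1"
  by (simp add: sign_int_def power_int_minus_one_mult_self)

lemma sign_int_0 [simp]: "sign_int 0 = 1"
  by (simp add: sign_int_def)

lemma sign_int_nonzero [simp]: "sign_int x \<noteq> 0"
  by (simp add: sign_int_def)

lemma sign_int_of_nat: "sign_int (real k) = (- 1) ^ k"
  by (simp add: sign_int_def)

lemma sign_int_double: "k \<in> \<int> \<Longrightarrow> sign_int (2 * k) = 1"
  by (metis mult_2 sign_int_add sign_int_sq)

text \<open>The workhorse of the sign bookkeeping: two exponents are compared by exhibiting half
  their difference as an integer combination of triad sums and magnetic differences.\<close>

lemma sign_int_eqI: "k \<in> \<int> \<Longrightarrow> x = y + 2 * k \<Longrightarrow> sign_int x = sign_int y"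
  by (simp add: sign_int_add' sign_int_double)

lemma sign_int_uminus: "x \<in> \<int> \<Longrightarrow> sign_int (- x) = sign_int x"
  by (rule sign_int_eqI[of "- x"]) auto

lemma sign_int_diff: "y \<in> \<int> \<Longrightarrow> sign_int (x - y) = sign_int x * sign_int y"
  using sign_int_add'[of "- y" x] by (simp add: sign_int_uminus)

lemma sign_int_plus_1: "sign_int (x + 1) = - sign_int x"
  by (simp add: sign_int_def power_int_add)

lemma sign_int_minus_1: "sign_int (x - 1) = - sign_int x"
  using sign_int_plus_1[of "x - 1"] by simp

lemma sign_int_mult_left [simp]: "sign_int x * (sign_int x * y) = y"
  by (simp flip: mult.assoc)

section \<open>Spins, triads and ranges of magnetic numbers\<close>

lemma spin_double_Ints: "spin j \<Longrightarrow> 2 * j \<in> \<int>"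
  unfolding spin_def using Nats_subset_Ints by blast

lemma spin_nonneg: "spin j \<Longrightarrow> 0 \<le> j"
  by (auto simp: spin_def elim!: Nats_cases)

lemma spin_1 [simp]: "spin 1" and spin_0 [simp]: "spin 0"
  by (simp_all add: spin_def)

lemma triad_imp_spin: "triad a b c \<Longrightarrow> spin a \<Longrightarrow> spin b \<Longrightarrow> spin c"
proof -
  assume t: "triad a b c" and a: "spin a" and b: "spin b"
  have "2 * (a + b + c) \<in> \<int>"
    using t by (intro Ints_mult) (auto simp: triad_def)
  from Ints_diff[OF Ints_diff[OF this spin_double_Ints[OF a]] spin_double_Ints[OF b]]
  have "2 * c \<in> \<int>" by (simp add: algebra_simps)
  moreover have "0 \<le> 2 * c" using t by (auto simp: triad_def)
  ultimately show "spin c" unfolding spin_def by (simp add: Nats_altdef2)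
qed

lemma mags_minus: "spin j \<Longrightarrow> m \<in> mags j \<Longrightarrow> - m \<in> mags j"
proof -
  assume j: "spin j" and m: "m \<in> mags j"
  have "j - m \<in> \<int>" using m by (simp add: mags_def)
  from Ints_diff[OF spin_double_Ints[OF j] this] have "j - - m \<in> \<int>"
    by (simp add: algebra_simps)
  then show "- m \<in> mags j" using m by (auto simp: mags_def)
qed

lemma mags_minus_iff [simp]: "spin j \<Longrightarrow> - m \<in> mags j \<longleftrightarrow> m \<in> mags j"
  using mags_minus[of j m] mags_minus[of j "- m"] by auto

lemma mags_diff_Ints: "m \<in> mags j \<Longrightarrow> j - m \<in> \<int>"
  by (simp add: mags_def)

lemma mags_add_Ints: "spin j \<Longrightarrow> m \<in> mags j \<Longrightarrow> j + m \<in> \<int>"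
  using mags_minus[of j m] mags_diff_Ints[of "- m" j] by simp

lemma top_in_mags [simp]: "spin j \<Longrightarrow> j \<in> mags j"
  using spin_nonneg by (simp add: mags_def)

lemma bottom_in_mags [simp]: "spin j \<Longrightarrow> - j \<in> mags j"
  by simp

lemma mags_plus_1: "m \<in> mags j \<Longrightarrow> m < j \<Longrightarrow> m + 1 \<in> mags j"
proof -
  assume m: "m \<in> mags j" and l: "m < j"
  obtain i where i: "j - m = of_int i" using m by (auto simp: mags_def elim: Ints_cases)
  then have "i \<ge> 1" using l by linarith
  then have "m + 1 \<le> j" using i by linarith
  moreover have "j - (m + 1) = of_int (i - 1)" using i by simp
  then have "j - (m + 1) \<in> \<int>" by (metis Ints_of_int)
  ultimately show ?thesis using m by (auto simp: mags_def)
qed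

lemma mags_minus_1: "spin j \<Longrightarrow> m \<in> mags j \<Longrightarrow> - j < m \<Longrightarrow> m - 1 \<in> mags j"
  using mags_plus_1[of "- m" j] mags_minus_iff[of j "m - 1"] by simp

lemma mags_0 [simp]: "mags 0 = {0}"
  by (auto simp: mags_def)

lemma mags_1: "mags 1 = {-1, 0, 1}"
proof -
  have "m \<in> {-1, 0, 1}" if m: "m \<in> mags 1" for m
  proof -
    obtain i where i: "1 - m = of_int i" using mags_diff_Ints[OF m] by (elim Ints_cases)
    then have "0 \<le> i \<and> i \<le> 2" using m by (auto simp: mags_def)
    then have "i = 0 \<or> i = 1 \<or> i = 2" by linarith
    then show ?thesis using i by auto
  qed
  moreover have "{-1, 0, 1} \<subseteq> mags 1"
    by (auto simp: mags_def)
  ultimately show ?thesis by blast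
qed

lemma sum_mags_uminus: "spin j \<Longrightarrow> (\<Sum>m\<in>mags j. f (- m)) = (\<Sum>m\<in>mags j. f m)"
  by (rule sum.reindex_bij_witness[of _ uminus uminus]) auto

section \<open>The Racah sum, its symmetries and its three-term recursion\<close>

text \<open>The reciprocal factorial, extended by \<open>0\<close> to negative arguments, so that
  \<open>x * rinv x = rinv (x - 1)\<close> holds for every integer \<open>x\<close>.\<close>

definition rinv :: "real \<Rightarrow> real" where
  "rinv x = (if x < 0 then 0 else 1 / rfact x)"

lemma rfact_pos [simp]: "rfact x > 0"
  by (simp add: rfact_def)

lemma rfact_nonzero [simp]: "rfact x \<noteq> 0"
  by (simp add: rfact_def)

lemma rfact_0 [simp]: "rfact 0 = 1" and rfact_1 [simp]: "rfact 1 = 1"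
  and rfact_2 [simp]: "rfact 2 = 2"
  by (simp_all add: rfact_def fact_numeral)

lemma rfact_Suc: "x \<in> \<int> \<Longrightarrow> 0 \<le> x \<Longrightarrow> rfact (x + 1) = (x + 1) * rfact x"
proof -
  assume "x \<in> \<int>" "0 \<le> x"
  then obtain n where "x = real n" by (metis Ints_cases of_int_0_le_iff of_int_of_nat_eq zero_le_imp_eq_int)
  moreover have "nat \<lfloor>real n + 1\<rfloor> = Suc n" by linarith
  ultimately show ?thesis by (simp add: rfact_def)
qed

lemma rinv_rec: "x \<in> \<int> \<Longrightarrow> x * rinv x = rinv (x - 1)"
proof (cases "x \<ge> 1")
  case True
  assume "x \<in> \<int>"
  then have "rfact x = x * rfact (x - 1)" using rfact_Suc[of "x - 1"] True by simp
  then show ?thesis using True by (simp add: rinv_def)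
next
  case False
  assume "x \<in> \<int>"
  then have "x \<le> 0" using False by (auto elim!: Ints_cases)
  then show ?thesis by (auto simp: rinv_def)
qed

lemma rinv_nonneg: "x \<ge> 0 \<Longrightarrow> rinv x = 1 / rfact x"
  and rinv_neg: "x < 0 \<Longrightarrow> rinv x = 0"
  by (simp_all add: rinv_def)

definition racah_term where
  "racah_term A B C u v k = sign_int k * rinv k * rinv (A - k) * rinv (u - k) * rinv (B - u + k)
     * rinv (v - k) * rinv (C - v + k)"

text \<open>With \<open>A = j1 + j2 - j3\<close>, \<open>B = j1 - j2 + j3\<close>, \<open>C = - j1 + j2 + j3\<close>, \<open>u = j1 - m1\<close>,
  \<open>v = j2 + m2\<close> this is, up to factorials, the coefficient of \<open>\<Prod>i. x\<^sub>i ^ (j\<^sub>i + m\<^sub>i) * y\<^sub>i ^ (j\<^sub>i - m\<^sub>i)\<close>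
  in the invariant polynomial
  \<open>(x\<^sub>1 y\<^sub>2 - x\<^sub>2 y\<^sub>1) ^ A * (x\<^sub>3 y\<^sub>1 - x\<^sub>1 y\<^sub>3) ^ B * (x\<^sub>2 y\<^sub>3 - x\<^sub>3 y\<^sub>2) ^ C\<close>.\<close>

definition racah where
  "racah A B C u v = (\<Sum>k\<in>{0..\<lfloor>A\<rfloor>}. racah_term A B C u v (of_int k))"

lemma racah_term_zero: "k < 0 \<or> A < k \<or> u < k \<or> k < u - B \<or> v < k \<or> k < v - C
  \<Longrightarrow> racah_term A B C u v k = 0"
  by (auto simp: racah_term_def rinv_def)

text \<open>Every term outside Racah's range carries a vanishing \<open>rinv\<close>, so the range
  may be changed freely. This lets sums over different ranges be matched by a substitution.\<close>

lemma racah_superset: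
  assumes "finite S" "\<And>k. 0 \<le> k \<Longrightarrow> k \<le> \<lfloor>A\<rfloor> \<Longrightarrow> k \<notin> S \<Longrightarrow> racah_term A B C u v (of_int k) = 0"
  shows "racah A B C u v = (\<Sum>k\<in>S. racah_term A B C u v (of_int k))"
proof -
  have "racah A B C u v = (\<Sum>k\<in>{0..\<lfloor>A\<rfloor>} \<inter> S. racah_term A B C u v (of_int k))"
    unfolding racah_def using assms by (intro sum.mono_neutral_right) auto
  also have "\<dots> = (\<Sum>k\<in>S. racah_term A B C u v (of_int k))"
    using assms(1) by (intro sum.mono_neutral_left) (auto intro!: racah_term_zero simp: le_floor_iff)
  finally show ?thesis .
qed

text \<open>Substitution of \<open>A - k\<close> for \<open>k\<close>. In the parameters of a
  3j-symbol it exchanges the first two columns.\<close>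

lemma racah_reflect:
  assumes "A \<in> \<int>"
  shows "racah A C B (A + C - v) (A + B - u) = sign_int A * racah A B C u v"
    (is "?L = _")
proof -
  obtain a where a: "A = of_int a" using assms by (auto elim: Ints_cases)
  have "?L = (\<Sum>k\<in>{0..\<lfloor>A\<rfloor>}. sign_int A * racah_term A B C u v (of_int k))"
    unfolding racah_def
  proof (rule sum.reindex_bij_witness[of _ "\<lambda>k. a - k" "\<lambda>k. a - k"])
    fix k assume "k \<in> {0..\<lfloor>A\<rfloor>}"
    show "sign_int A * racah_term A B C u v (of_int (a - k))
       = racah_term A C B (A + C - v) (A + B - u) (of_int k)"
      using sign_int_diff[of "of_int k" A] by (simp add: racah_term_def a algebra_simps)
  qed (auto simp: a)
  then show ?thesis by (simp add: racah_def sum_distrib_left)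
qed

text \<open>Swapping the pairs \<open>B, u\<close> and \<open>C, v\<close> leaves every term
  unchanged; composed with the reflection this reverses all magnetic numbers of a 3j-symbol.\<close>

lemma racah_negate:
  assumes "A \<in> \<int>"
  shows "racah A B C (A + B - u) (A + C - v) = sign_int A * racah A B C u v"
proof -
  have "racah A B C x y = racah A C B y x" for x y
    by (simp add: racah_def racah_term_def mult_ac)
  then show ?thesis using racah_reflect[OF assms] by simp
qed

text \<open>Substitution of \<open>u - k\<close> for \<open>k\<close>, which exchanges the second
  and third columns of a 3j-symbol. The range from \<open>0\<close> to \<open>u\<close> serves both
  sums, since \<open>rinv (u - k)\<close> cuts them off above.\<close>

lemma racah_exchange:
  assumes "u \<in> \<int>"
  shows "racah B A C u (C + u - v) = sign_int u * racah A B C u v"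
    (is "?L = _")
proof -
  obtain i where i: "u = of_int i" using assms by (auto elim: Ints_cases)
  have 1: "?L = (\<Sum>k\<in>{0..i}. racah_term B A C u (C + u - v) (of_int k))"
    by (rule racah_superset) (auto intro!: racah_term_zero simp: i)
  have 2: "racah A B C u v = (\<Sum>k\<in>{0..i}. racah_term A B C u v (of_int k))"
    by (rule racah_superset) (auto intro!: racah_term_zero simp: i)
  have "?L = (\<Sum>k\<in>{0..i}. sign_int u * racah_term A B C u v (of_int k))"
    unfolding 1
  proof (rule sum.reindex_bij_witness[of _ "\<lambda>k. i - k" "\<lambda>k. i - k"])
    fix k assume "k \<in> {0..i}"
    show "sign_int u * racah_term A B C u v (of_int (i - k))
       = racah_term B A C u (C + u - v) (of_int k)"
      using sign_int_diff[of "of_int k" u] by (simp add: racah_term_def i algebra_simps)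
  qed auto
  then show ?thesis by (simp add: 2 sum_distrib_left)
qed

text \<open>With \<open>u = j1 - m1\<close> and \<open>v = j2 + m2\<close> this is the raising
  equation of the 3j-symbol after its square roots are cleared. It holds term by term up to a
  telescoping remainder.\<close>

lemma racah_recursion:
  assumes i: "A \<in> \<int>" "B \<in> \<int>" "C \<in> \<int>" "u \<in> \<int>" "v \<in> \<int>"
  shows "(u + 1) * racah A B C (u + 1) v + (A + C + 1 - v) * racah A B C u (v - 1)
    = (B - u + v) * racah A B C u v"
    (is "?lhs = _")
proof -
  obtain a where a: "A = of_int a" using i by (auto elim: Ints_cases)
  let ?S = "{0..a + 1}"
  \<comment> \<open>\<open>h\<close> is what remains of a shifted term once a multiple of the
    unshifted term is split off. It enters once as \<open>h k\<close> and once as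
    \<open>- h (k + 1)\<close>.\<close>
  define h where "h k = sign_int k * rinv (k - 1) * rinv (A - k) * rinv (u + 1 - k)
     * rinv (B - u - 1 + k) * rinv (v - k) * rinv (C - v + k)" for k
  have big: "racah A B C x y = (\<Sum>k\<in>?S. racah_term A B C x y (of_int k))" for x y
    by (rule racah_superset) (auto simp: a)
  have t1: "(u + 1) * racah_term A B C (u + 1) v k = (B - u + k) * racah_term A B C u v k + h k"
    if k: "k \<in> \<int>" for k
  proof -
    have r: "(u + 1 - k) * rinv (u + 1 - k) = rinv (u - k)"
      "(B - u + k) * rinv (B - u + k) = rinv (B - u - 1 + k)" "k * rinv k = rinv (k - 1)"
      using rinv_rec[of "u + 1 - k"] rinv_rec[of "B - u + k"] rinv_rec[of k] i k
      by (simp_all add: algebra_simps)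
    \<comment> \<open>The factor is split as \<open>u + 1 = (u + 1 - k) + k\<close>, and each part
      is absorbed by a reciprocal factorial.\<close>
    have "(u + 1) * racah_term A B C (u + 1) v k
      = sign_int k * rinv k * rinv (A - k) * ((u + 1 - k) * rinv (u + 1 - k)) * rinv (B - u - 1 + k)
        * rinv (v - k) * rinv (C - v + k)
      + sign_int k * (k * rinv k) * rinv (A - k) * rinv (u + 1 - k) * rinv (B - u - 1 + k)
        * rinv (v - k) * rinv (C - v + k)"
      by (simp add: racah_term_def algebra_simps)
    also have "\<dots> = (B - u + k) * racah_term A B C u v k + h k"
      unfolding r(1,3) h_def racah_term_def r(2)[symmetric] by (simp add: algebra_simps)
    finally show ?thesis .
  qed
  have t2: "(A + C + 1 - v) * racah_term A B C u (v - 1) k = (v - k) * racah_term A B C u v k - h (k + 1)"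
    if k: "k \<in> \<int>" for k
  proof -
    have r: "(C - v + 1 + k) * rinv (C - v + 1 + k) = rinv (C - v + k)"
      "(v - k) * rinv (v - k) = rinv (v - 1 - k)" "(A - k) * rinv (A - k) = rinv (A - 1 - k)"
      using rinv_rec[of "C - v + 1 + k"] rinv_rec[of "v - k"] rinv_rec[of "A - k"] i k
      by (simp_all add: algebra_simps)
    \<comment> \<open>Here the split is
      \<open>A + C + 1 - v = (C - v + 1 + k) + (A - k)\<close>.\<close>
    have "(A + C + 1 - v) * racah_term A B C u (v - 1) k
      = sign_int k * rinv k * rinv (A - k) * rinv (u - k) * rinv (B - u + k)
        * rinv (v - 1 - k) * ((C - v + 1 + k) * rinv (C - v + 1 + k))
      + sign_int k * rinv k * ((A - k) * rinv (A - k)) * rinv (u - k) * rinv (B - u + k)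
        * rinv (v - 1 - k) * rinv (C - v + 1 + k)"
      by (simp add: racah_term_def algebra_simps)
    also have "\<dots> = (v - k) * racah_term A B C u v k
      + sign_int k * rinv k * rinv (A - 1 - k) * rinv (u - k) * rinv (B - u + k)
        * rinv (v - 1 - k) * rinv (C - v + 1 + k)"
      unfolding r(1,3) racah_term_def by (simp flip: r(2))
    also have "\<dots> = (v - k) * racah_term A B C u v k - h (k + 1)"
      using sign_int_plus_1[of k] by (simp add: h_def algebra_simps)
    finally show ?thesis .
  qed
  \<comment> \<open>Nothing survives at the ends: \<open>rinv (k - 1)\<close> vanishes at
    \<open>k = 0\<close>, and \<open>rinv (A - k)\<close> vanishes above \<open>A\<close>.\<close>
  have tele: "(\<Sum>k\<in>?S. h (of_int k)) = (\<Sum>k\<in>?S. h (of_int k + 1))"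
  proof -
    have "(\<Sum>k\<in>?S. h (of_int k)) = (\<Sum>k\<in>{1..a + 1}. h (of_int k))"
      by (rule sum.mono_neutral_right) (auto simp: h_def rinv_def)
    also have "\<dots> = (\<Sum>k\<in>{0..a}. h (of_int k + 1))"
      by (rule sum.reindex_bij_witness[of _ "\<lambda>k. k + 1" "\<lambda>k. k - 1"]) auto
    also have "\<dots> = (\<Sum>k\<in>?S. h (of_int k + 1))"
      by (rule sum.mono_neutral_left) (auto simp: h_def rinv_def a)
    finally show ?thesis .
  qed
  have "?lhs = (\<Sum>k\<in>?S. (B - u + of_int k) * racah_term A B C u v (of_int k) + h (of_int k))
    + (\<Sum>k\<in>?S. (v - of_int k) * racah_term A B C u v (of_int k) - h (of_int k + 1))"
    unfolding big sum_distrib_left by (simp add: t1 t2)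
  also have "\<dots> = (\<Sum>k\<in>?S. (B - u + v) * racah_term A B C u v (of_int k))"
    unfolding sum.distrib sum_subtractf tele by (simp add: algebra_simps flip: sum.distrib)
  also have "\<dots> = (B - u + v) * racah A B C u v"
    unfolding big by (simp add: sum_distrib_left)
  finally show ?thesis .
qed

section \<open>Symmetries and invariance of 3j-symbols\<close>

lemma triad_swap12: "triad b a c \<longleftrightarrow> triad a b c"
  by (auto simp: triad_def algebra_simps abs_minus_commute)

lemma triad_swap23: "triad a c b \<longleftrightarrow> triad a b c"
  by (auto simp: triad_def algebra_simps)

lemma triad_Ints:
  assumes "triad a b c" "spin a" "spin b" "spin c"
  shows "a + b + c \<in> \<int>" "a + b - c \<in> \<int>" "a - b + c \<in> \<int>" "- a + b + c \<in> \<int>"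
    "0 \<le> a + b - c" "0 \<le> a - b + c" "0 \<le> - a + b + c"
proof -
  show s: "a + b + c \<in> \<int>" using assms(1) by (simp add: triad_def)
  show "a + b - c \<in> \<int>" "a - b + c \<in> \<int>" "- a + b + c \<in> \<int>"
    using Ints_diff[OF s spin_double_Ints[OF assms(2)]] Ints_diff[OF s spin_double_Ints[OF assms(3)]]
      Ints_diff[OF s spin_double_Ints[OF assms(4)]]
    by (simp_all add: algebra_simps)
  show "0 \<le> a + b - c" "0 \<le> a - b + c" "0 \<le> - a + b + c"
    using assms(1) by (auto simp: triad_def)
qed

text \<open>The norm of the monomial \<open>x^(j+m) y^(j-m)\<close> in the polynomial model of spin
  \<open>j\<close>.\<close>

definition mag_weight where
  "mag_weight j m = sqrt (rfact (j + m) * rfact (j - m))"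

lemma mag_weight_minus [simp]: "mag_weight j (- m) = mag_weight j m"
  by (simp add: mag_weight_def mult.commute)

lemma mag_weight_pos [simp]: "mag_weight j m > 0"
  by (simp add: mag_weight_def)

text \<open>The triangle coefficient of Racah's formula.\<close>

definition tri_weight where
  "tri_weight a b c = sqrt (rfact (a + b - c) * rfact (a - b + c) * rfact (- a + b + c) / rfact (a + b + c + 1))"

lemma tri_weight_pos [simp]: "tri_weight a b c > 0"
  by (simp add: tri_weight_def)

lemma tri_weight_swap12: "tri_weight b a c = tri_weight a b c"
  by (simp add: tri_weight_def algebra_simps)

lemma tri_weight_swap23: "tri_weight a c b = tri_weight a b c"
  by (simp add: tri_weight_def algebra_simps)

lemma threej_nonzeroD:
  assumes "threej j1 j2 j3 m1 m2 m3 \<noteq> 0" "spin j3"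
  shows "triad j1 j2 j3" "m1 \<in> mags j1" "m2 \<in> mags j2" "m3 \<in> mags j3" "m1 + m2 + m3 = 0"
  using assms by (auto simp: threej_def cg_def split: if_splits)

text \<open>Both kinds of weights are symmetric under permutation of the columns and reversal of the
  magnetic numbers, so every symmetry of the 3j-symbol reduces to one of \<open>racah\<close> and a
  comparison of signs.\<close>

lemma threej_racah:
  assumes t: "triad j1 j2 j3" and s: "spin j1" "spin j2" "spin j3"
    and m: "m1 \<in> mags j1" "m2 \<in> mags j2" "m3 \<in> mags j3" "m1 + m2 + m3 = 0"
  shows "threej j1 j2 j3 m1 m2 m3 = sign_int (j1 - j2 - m3) * tri_weight j1 j2 j3
    * (mag_weight j1 m1 * mag_weight j2 m2 * mag_weight j3 m3)
    * racah (j1 + j2 - j3) (j1 - j2 + j3) (- j1 + j2 + j3) (j1 - m1) (j2 + m2)"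
proof -
  let ?A = "j1 + j2 - j3" and ?B = "j1 - j2 + j3" and ?C = "- j1 + j2 + j3"
  let ?K = "{k. real k \<le> j1 + j2 - j3 \<and> real k \<le> j1 - m1 \<and> real k \<le> j2 + m2
                 \<and> 0 \<le> j3 - j2 + m1 + real k \<and> 0 \<le> j3 - j1 - m2 + real k}"
  have fin: "finite ?K"
    by (rule finite_subset[of _ "{..nat \<lfloor>?A\<rfloor>}"]) (auto simp: le_nat_floor)
  have "racah ?A ?B ?C (j1 - m1) (j2 + m2)
     = (\<Sum>k\<in>int ` ?K. racah_term ?A ?B ?C (j1 - m1) (j2 + m2) (of_int k))"
  proof (rule racah_superset)
    fix k assume k: "0 \<le> k" "k \<le> \<lfloor>?A\<rfloor>" "k \<notin> int ` ?K"
    have "nat k \<notin> ?K"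
    proof
      assume "nat k \<in> ?K"
      then have "int (nat k) \<in> int ` ?K" by (rule imageI)
      then show False using k(1,3) by simp
    qed
    then show "racah_term ?A ?B ?C (j1 - m1) (j2 + m2) (of_int k) = 0"
      using k(1,2) by (intro racah_term_zero) (auto simp: le_floor_iff)
  qed (use fin in simp)
  also have "\<dots> = (\<Sum>k\<in>?K. racah_term ?A ?B ?C (j1 - m1) (j2 + m2) (real k))"
    by (subst sum.reindex) auto
  also have "\<dots> = (\<Sum>k\<in>?K. (- 1) ^ k /
            (fact k * rfact (j1 + j2 - j3 - real k) * rfact (j1 - m1 - real k)
             * rfact (j2 + m2 - real k) * rfact (j3 - j2 + m1 + real k)
             * rfact (j3 - j1 - m2 + real k)))"
  proof (rule sum.cong[OF refl])
    fix k assume k: "k \<in> ?K"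
    have e: "?B - (j1 - m1) + real k = j3 - j2 + m1 + real k"
      "?C - (j2 + m2) + real k = j3 - j1 - m2 + real k" by simp_all
    have "rfact (real k) = fact k" by (simp add: rfact_def)
    then show "racah_term ?A ?B ?C (j1 - m1) (j2 + m2) (real k) = (- 1) ^ k /
            (fact k * rfact (j1 + j2 - j3 - real k) * rfact (j1 - m1 - real k)
             * rfact (j2 + m2 - real k) * rfact (j3 - j2 + m1 + real k)
             * rfact (j3 - j1 - m2 + real k))"
      unfolding racah_term_def e using k
      by (simp add: rinv_nonneg sign_int_of_nat mult_ac)
  qed
  finally have r: "racah ?A ?B ?C (j1 - m1) (j2 + m2) = \<dots>" .
  have c: "triad j1 j2 j3 \<and> m1 \<in> mags j1 \<and> m2 \<in> mags j2 \<and> - m3 \<in> mags j3 \<and> m1 + m2 = - m3"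
    using t m s by auto
  have j3: "2 * j3 + 1 > 0" using spin_nonneg[OF s(3)] by simp
  have "cg j1 m1 j2 m2 j3 (- m3) = sqrt (2 * j3 + 1) * tri_weight j1 j2 j3
    * (mag_weight j1 m1 * mag_weight j2 m2 * mag_weight j3 m3)
    * racah ?A ?B ?C (j1 - m1) (j2 + m2)"
    unfolding cg_def if_P[OF c] r tri_weight_def mag_weight_def
    by (simp add: real_sqrt_mult real_sqrt_divide mult_ac)
  then show ?thesis using j3 by (simp add: threej_def)
qed

lemma threej_cong_zero:
  assumes "spin j3" "\<not> (triad j1 j2 j3 \<and> m1 \<in> mags j1 \<and> m2 \<in> mags j2 \<and> m3 \<in> mags j3 \<and> m1 + m2 + m3 = 0)"
  shows "threej j1 j2 j3 m1 m2 m3 = 0"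
  using threej_nonzeroD[of j1 j2 j3 m1 m2 m3] assms by blast

lemma threej_swap12:
  assumes s: "spin j1" "spin j2" "spin j3"
  shows "threej j2 j1 j3 m2 m1 m3 = sign_int (j1 + j2 + j3) * threej j1 j2 j3 m1 m2 m3"
proof (cases "triad j1 j2 j3 \<and> m1 \<in> mags j1 \<and> m2 \<in> mags j2 \<and> m3 \<in> mags j3 \<and> m1 + m2 + m3 = 0")
  case True
  then have t: "triad j1 j2 j3" and m: "m1 \<in> mags j1" "m2 \<in> mags j2" "m3 \<in> mags j3" "m1 + m2 + m3 = 0"
    by auto
  note ti = triad_Ints[OF t s]
  let ?R = "racah (j1 + j2 - j3) (j1 - j2 + j3) (- j1 + j2 + j3) (j1 - m1) (j2 + m2)"
  have 1: "threej j2 j1 j3 m2 m1 m3 = sign_int (j2 - j1 - m3) * tri_weight j1 j2 j3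
    * (mag_weight j1 m1 * mag_weight j2 m2 * mag_weight j3 m3)
    * racah (j1 + j2 - j3) (- j1 + j2 + j3) (j1 - j2 + j3) (j2 - m2) (j1 + m1)"
    using threej_racah[of j2 j1 j3 m2 m1 m3] t s m
    by (simp add: triad_swap12 tri_weight_swap12 add.commute mult_ac)
  have 2: "racah (j1 + j2 - j3) (- j1 + j2 + j3) (j1 - j2 + j3) (j2 - m2) (j1 + m1)
    = sign_int (j1 + j2 - j3) * ?R"
    using racah_reflect[OF ti(2), of "- j1 + j2 + j3" "j1 - j2 + j3" "j2 + m2" "j1 - m1"]
    by (simp add: algebra_simps)
  have "sign_int (j2 - j1 - m3) * sign_int (j1 + j2 - j3) = sign_int (j2 - j1 - m3 + (j1 + j2 - j3))"
    by (rule sign_int_add'[OF ti(2), symmetric])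
  also have "\<dots> = sign_int (j1 + j2 + j3 + (j1 - j2 - m3))"
    by (rule sign_int_eqI[OF ti(3)[THEN Ints_minus]]) simp
  also have "\<dots> = sign_int (j1 + j2 + j3) * sign_int (j1 - j2 - m3)"
    by (rule sign_int_add[OF ti(1)])
  finally show ?thesis
    unfolding 1 2 threej_racah[OF t s m] by (simp add: mult_ac)
next
  case False
  then have f: "\<not> (triad j2 j1 j3 \<and> m2 \<in> mags j2 \<and> m1 \<in> mags j1 \<and> m3 \<in> mags j3 \<and> m2 + m1 + m3 = 0)"
    by (simp add: triad_swap12 add.commute)
  show ?thesis by (simp only: threej_cong_zero[OF s(3) False] threej_cong_zero[OF s(3) f])
qed

lemma threej_swap23:
  assumes s: "spin j1" "spin j2" "spin j3"
  shows "threej j1 j3 j2 m1 m3 m2 = sign_int (j1 + j2 + j3) * threej j1 j2 j3 m1 m2 m3"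
proof (cases "triad j1 j2 j3 \<and> m1 \<in> mags j1 \<and> m2 \<in> mags j2 \<and> m3 \<in> mags j3 \<and> m1 + m2 + m3 = 0")
  case True
  then have t: "triad j1 j2 j3" and m: "m1 \<in> mags j1" "m2 \<in> mags j2" "m3 \<in> mags j3" "m1 + m2 + m3 = 0"
    by auto
  note ti = triad_Ints[OF t s]
  let ?R = "racah (j1 + j2 - j3) (j1 - j2 + j3) (- j1 + j2 + j3) (j1 - m1) (j2 + m2)"
  have u: "j1 - m1 \<in> \<int>" using mags_diff_Ints[OF m(1)] .
  have e0: "j1 + j3 - j2 = j1 - j2 + j3" "j1 - j3 + j2 = j1 + j2 - j3" "- j1 + j3 + j2 = - j1 + j2 + j3"
    by simp_all
  have 1: "threej j1 j3 j2 m1 m3 m2 = sign_int (j1 - j3 - m2) * tri_weight j1 j2 j3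
    * (mag_weight j1 m1 * mag_weight j2 m2 * mag_weight j3 m3)
    * racah (j1 - j2 + j3) (j1 + j2 - j3) (- j1 + j2 + j3) (j1 - m1) (j3 + m3)"
    using threej_racah[of j1 j3 j2 m1 m3 m2] t s m
    unfolding e0 triad_swap23[of j1 j3 j2] tri_weight_swap23[of j1 j3 j2] by (simp add: add_ac mult_ac)
  have e: "j3 + m3 = (- j1 + j2 + j3) + (j1 - m1) - (j2 + m2)" using m(4) by simp
  have 2: "racah (j1 - j2 + j3) (j1 + j2 - j3) (- j1 + j2 + j3) (j1 - m1) (j3 + m3)
    = sign_int (j1 - m1) * ?R"
    unfolding e by (rule racah_exchange[OF u])
  have k: "m3 - j3 \<in> \<int>" using Ints_minus[OF mags_diff_Ints[OF m(3)]] by simp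
  have "sign_int (j1 - j3 - m2) * sign_int (j1 - m1) = sign_int (j1 - j3 - m2 + (j1 - m1))"
    by (rule sign_int_add'[OF u, symmetric])
  also have "\<dots> = sign_int (j1 + j2 + j3 + (j1 - j2 - m3))"
    by (rule sign_int_eqI[OF k]) (use m(4) in \<open>simp add: algebra_simps\<close>)
  also have "\<dots> = sign_int (j1 + j2 + j3) * sign_int (j1 - j2 - m3)"
    by (rule sign_int_add[OF ti(1)])
  finally show ?thesis
    unfolding 1 2 threej_racah[OF t s m] by (simp add: mult_ac)
next
  case False
  then have f: "\<not> (triad j1 j3 j2 \<and> m1 \<in> mags j1 \<and> m3 \<in> mags j3 \<and> m2 \<in> mags j2 \<and> m1 + m3 + m2 = 0)"
    by (simp add: triad_swap23 add.commute add.left_commute)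
  show ?thesis by (simp only: threej_cong_zero[OF s(3) False] threej_cong_zero[OF s(2) f])
qed

lemma threej_negate:
  assumes s: "spin j1" "spin j2" "spin j3"
  shows "threej j1 j2 j3 (- m1) (- m2) (- m3) = sign_int (j1 + j2 + j3) * threej j1 j2 j3 m1 m2 m3"
proof (cases "triad j1 j2 j3 \<and> m1 \<in> mags j1 \<and> m2 \<in> mags j2 \<and> m3 \<in> mags j3 \<and> m1 + m2 + m3 = 0")
  case True
  then have t: "triad j1 j2 j3" and m: "m1 \<in> mags j1" "m2 \<in> mags j2" "m3 \<in> mags j3" "m1 + m2 + m3 = 0"
    by auto
  note ti = triad_Ints[OF t s]
  let ?R = "racah (j1 + j2 - j3) (j1 - j2 + j3) (- j1 + j2 + j3) (j1 - m1) (j2 + m2)"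
  have 1: "threej j1 j2 j3 (- m1) (- m2) (- m3) = sign_int (j1 - j2 + m3) * tri_weight j1 j2 j3
    * (mag_weight j1 m1 * mag_weight j2 m2 * mag_weight j3 m3)
    * racah (j1 + j2 - j3) (j1 - j2 + j3) (- j1 + j2 + j3) (j1 + m1) (j2 - m2)"
    using threej_racah[of j1 j2 j3 "- m1" "- m2" "- m3"] t s m by simp
  have 2: "racah (j1 + j2 - j3) (j1 - j2 + j3) (- j1 + j2 + j3) (j1 + m1) (j2 - m2)
    = sign_int (j1 + j2 - j3) * ?R"
    using racah_negate[OF ti(2), of "j1 - j2 + j3" "- j1 + j2 + j3" "j1 - m1" "j2 + m2"]
    by (simp add: algebra_simps)
  have k: "m3 - j3 \<in> \<int>" using Ints_minus[OF mags_diff_Ints[OF m(3)]] by simp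
  have "sign_int (j1 - j2 + m3) * sign_int (j1 + j2 - j3) = sign_int (j1 - j2 + m3 + (j1 + j2 - j3))"
    by (rule sign_int_add'[OF ti(2), symmetric])
  also have "\<dots> = sign_int (j1 + j2 + j3 + (j1 - j2 - m3))"
    by (rule sign_int_eqI[OF k]) (use m(4) in \<open>simp add: algebra_simps\<close>)
  also have "\<dots> = sign_int (j1 + j2 + j3) * sign_int (j1 - j2 - m3)"
    by (rule sign_int_add[OF ti(1)])
  finally show ?thesis
    unfolding 1 2 threej_racah[OF t s m] by (simp add: mult_ac)
next
  case False
  then have f: "\<not> (triad j1 j2 j3 \<and> - m1 \<in> mags j1 \<and> - m2 \<in> mags j2 \<and> - m3 \<in> mags j3 \<and> - m1 + - m2 + - m3 = 0)"
    using s by auto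
  show ?thesis by (simp only: threej_cong_zero[OF s(3) False] threej_cong_zero[OF s(3) f])
qed

section \<open>Rotation invariant vectors of three spins and Schur's lemma\<close>

text \<open>For \<open>d = 1\<close> and \<open>d = -1\<close> this is the matrix element \<open>\<langle>j m| J\<^sub>\<plusminus> |j (m - d)\<rangle>\<close>.\<close>

definition ladder where
  "ladder d j m = sqrt ((j + d * m) * (j - d * m + 1))"

text \<open>The coefficient functions of the rotation invariant vectors of \<open>\<H>\<^sub>j\<^sub>1 \<otimes> \<H>\<^sub>j\<^sub>2 \<otimes> \<H>\<^sub>j\<^sub>3\<close>.\<close>

definition invariant3 :: "real \<Rightarrow> real \<Rightarrow> real \<Rightarrow> (real \<Rightarrow> real \<Rightarrow> real \<Rightarrow> real) \<Rightarrow> bool" where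
  "invariant3 j1 j2 j3 f \<longleftrightarrow>
    (\<forall>m1 m2 m3. f m1 m2 m3 \<noteq> 0 \<longrightarrow> m1 \<in> mags j1 \<and> m2 \<in> mags j2 \<and> m3 \<in> mags j3 \<and> m1 + m2 + m3 = 0) \<and>
    (\<forall>d\<in>{1, -1}. \<forall>m1 m2 m3. ladder d j1 m1 * f (m1 - d) m2 m3
       + ladder d j2 m2 * f m1 (m2 - d) m3 + ladder d j3 m3 * f m1 m2 (m3 - d) = 0)"

lemma invariant3I:
  assumes "\<And>m1 m2 m3. f m1 m2 m3 \<noteq> 0 \<Longrightarrow> m1 \<in> mags j1 \<and> m2 \<in> mags j2 \<and> m3 \<in> mags j3 \<and> m1 + m2 + m3 = 0"
    and "\<And>d m1 m2 m3. d = 1 \<or> d = - 1 \<Longrightarrow> ladder d j1 m1 * f (m1 - d) m2 m3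
       + ladder d j2 m2 * f m1 (m2 - d) m3 + ladder d j3 m3 * f m1 m2 (m3 - d) = 0"
  shows "invariant3 j1 j2 j3 f"
  using assms unfolding invariant3_def by simp

lemma invariant3_supp:
  "invariant3 j1 j2 j3 f \<Longrightarrow> f m1 m2 m3 \<noteq> 0 \<Longrightarrow> m1 \<in> mags j1 \<and> m2 \<in> mags j2 \<and> m3 \<in> mags j3 \<and> m1 + m2 + m3 = 0"
  unfolding invariant3_def by blast

lemma invariant3_ladder:
  "invariant3 j1 j2 j3 f \<Longrightarrow> d = 1 \<or> d = - 1 \<Longrightarrow> ladder d j1 m1 * f (m1 - d) m2 m3
       + ladder d j2 m2 * f m1 (m2 - d) m3 + ladder d j3 m3 * f m1 m2 (m3 - d) = 0"
  unfolding invariant3_def by blast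

text \<open>In the polynomial model the ladder operators act on monomials with integer coefficients;
  \<open>mag_weight\<close> is the change of normalization that removes the square root.\<close>

lemma ladder_mag_weight:
  assumes "j + m \<in> \<int>" "j - m \<in> \<int>" "1 \<le> j + m" "0 \<le> j - m"
  shows "ladder 1 j m * mag_weight j (m - 1) = (j - m + 1) * mag_weight j m"
proof -
  have 1: "rfact (j + m) = (j + m) * rfact (j + m - 1)"
    using rfact_Suc[of "j + m - 1"] assms by simp
  have 2: "rfact (j - m + 1) = (j - m + 1) * rfact (j - m)"
    using rfact_Suc[of "j - m"] assms by simp
  have "ladder 1 j m * mag_weight j (m - 1)
    = sqrt ((j + m) * (j - m + 1) * (rfact (j + m - 1) * rfact (j - m + 1)))"
    unfolding ladder_def mag_weight_def real_sqrt_mult[symmetric]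
    by (rule arg_cong[where f = sqrt]) (simp add: algebra_simps)
  also have "\<dots> = sqrt ((j - m + 1)^2 * (rfact (j + m) * rfact (j - m)))"
    unfolding 1 2 by (simp add: power2_eq_square mult_ac)
  also have "\<dots> = (j - m + 1) * mag_weight j m"
    using assms by (simp add: mag_weight_def real_sqrt_mult)
  finally show ?thesis .
qed

text \<open>The coefficient vanishes at \<open>m = j + 1\<close>, so raising never leaves the
  magnetic range.\<close>

lemma ladder_mags:
  assumes "spin j" "m - 1 \<in> mags j" "ladder 1 j m \<noteq> 0"
  shows "m \<in> mags j"
proof -
  have "m - 1 \<noteq> j" using assms(3) by (auto simp: ladder_def)
  then show ?thesis using mags_plus_1[of "m - 1" j] assms(2) by (auto simp: mags_def)
qed

lemma threej_raise:
  assumes s: "spin j1" "spin j2" "spin j3"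
  shows "ladder 1 j1 m1 * threej j1 j2 j3 (m1 - 1) m2 m3
       + ladder 1 j2 m2 * threej j1 j2 j3 m1 (m2 - 1) m3 + ladder 1 j3 m3 * threej j1 j2 j3 m1 m2 (m3 - 1) = 0"
proof (cases "triad j1 j2 j3 \<and> m1 \<in> mags j1 \<and> m2 \<in> mags j2 \<and> m3 \<in> mags j3 \<and> m1 + m2 + m3 = 1")
  case True
  then have t: "triad j1 j2 j3" and m: "m1 \<in> mags j1" "m2 \<in> mags j2" "m3 \<in> mags j3" "m1 + m2 + m3 = 1"
    by auto
  note ti = triad_Ints[OF t s]
  let ?A = "j1 + j2 - j3" and ?B = "j1 - j2 + j3" and ?C = "- j1 + j2 + j3"
  let ?u = "j1 - m1" and ?v = "j2 + m2"
  let ?c = "sign_int (j1 - j2 - m3) * tri_weight j1 j2 j3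
    * (mag_weight j1 m1 * mag_weight j2 m2 * mag_weight j3 m3)"
  have i: "j1 + m1 \<in> \<int>" "j1 - m1 \<in> \<int>" "j2 + m2 \<in> \<int>" "j2 - m2 \<in> \<int>" "j3 + m3 \<in> \<int>" "j3 - m3 \<in> \<int>"
    using m s by (auto intro: mags_add_Ints mags_diff_Ints)
  have r: "- j1 \<le> m1" "m1 \<le> j1" "- j2 \<le> m2" "m2 \<le> j2" "- j3 \<le> m3" "m3 \<le> j3"
    using m by (auto simp: mags_def)
  have int1: "1 \<le> x" if "x \<in> \<int>" "0 < x" for x :: real
    using that by (auto elim!: Ints_cases)
  have 1: "ladder 1 j1 m1 * threej j1 j2 j3 (m1 - 1) m2 m3 = ?c * ((?u + 1) * racah ?A ?B ?C (?u + 1) ?v)"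
  proof (cases "m1 = - j1")
    case True
    have "racah ?A ?B ?C (?u + 1) ?v = 0"
      unfolding racah_def by (intro sum.neutral ballI racah_term_zero) (auto simp: True le_floor_iff)
    then show ?thesis by (simp add: True ladder_def)
  next
    case False
    then have ge: "1 \<le> j1 + m1" using r by (intro int1 i) auto
    have mm: "m1 - 1 \<in> mags j1" using False r by (intro mags_minus_1 s m) auto
    have "ladder 1 j1 m1 * threej j1 j2 j3 (m1 - 1) m2 m3
      = (ladder 1 j1 m1 * mag_weight j1 (m1 - 1)) * (sign_int (j1 - j2 - m3) * tri_weight j1 j2 j3
        * (mag_weight j2 m2 * mag_weight j3 m3) * racah ?A ?B ?C (?u + 1) ?v)"
      using threej_racah[OF t s mm m(2,3)] m(4) by (simp add: algebra_simps)
    then show ?thesis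
      unfolding ladder_mag_weight[OF i(1,2) ge, simplified, OF r(2)] by (simp add: mult_ac)
  qed
  have 2: "ladder 1 j2 m2 * threej j1 j2 j3 m1 (m2 - 1) m3
    = ?c * ((?A + ?C + 1 - ?v) * racah ?A ?B ?C ?u (?v - 1))"
  proof (cases "m2 = - j2")
    case True
    have "racah ?A ?B ?C ?u (?v - 1) = 0"
      unfolding racah_def by (intro sum.neutral ballI racah_term_zero) (auto simp: True le_floor_iff)
    then show ?thesis by (simp add: True ladder_def)
  next
    case False
    then have ge: "1 \<le> j2 + m2" using r by (intro int1 i) auto
    have mm: "m2 - 1 \<in> mags j2" using False r by (intro mags_minus_1 s m) auto
    have "ladder 1 j2 m2 * threej j1 j2 j3 m1 (m2 - 1) m3
      = (ladder 1 j2 m2 * mag_weight j2 (m2 - 1)) * (sign_int (j1 - j2 - m3) * tri_weight j1 j2 j3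
        * (mag_weight j1 m1 * mag_weight j3 m3) * racah ?A ?B ?C ?u (?v - 1))"
      using threej_racah[OF t s m(1) mm m(3)] m(4) by (simp add: algebra_simps)
    then show ?thesis
      unfolding ladder_mag_weight[OF i(3,4) ge, simplified, OF r(4)] by (simp add: mult_ac)
  qed
  \<comment> \<open>The magnetic numbers add up to \<open>1\<close> here, one more than in each
    3j-symbol; this matches the third ladder coefficient with the right side of the
    recursion.\<close>
  have bv: "j3 - m3 + 1 = ?B - ?u + ?v" using m(4) by simp
  have 3: "ladder 1 j3 m3 * threej j1 j2 j3 m1 m2 (m3 - 1)
    = - ?c * ((?B - ?u + ?v) * racah ?A ?B ?C ?u ?v)"
  proof (cases "m3 = - j3")
    case True
    have "racah ?A ?B ?C ?u ?v = 0"
      unfolding racah_def using True m(4)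
      by (intro sum.neutral ballI racah_term_zero) (auto simp: le_floor_iff)
    then show ?thesis by (simp add: True ladder_def)
  next
    case False
    then have ge: "1 \<le> j3 + m3" using r by (intro int1 i) auto
    have mm: "m3 - 1 \<in> mags j3" using False r by (intro mags_minus_1 s m) auto
    \<comment> \<open>The sign in front of the 3j-symbol depends on \<open>m3\<close> alone, so only
      the third term changes sign. This puts it on the other side of the recursion.\<close>
    have sg: "sign_int (j1 - j2 - (m3 - 1)) = - sign_int (j1 - j2 - m3)"
      using sign_int_plus_1[of "j1 - j2 - m3"] by (simp add: algebra_simps)
    have "ladder 1 j3 m3 * threej j1 j2 j3 m1 m2 (m3 - 1)
      = (ladder 1 j3 m3 * mag_weight j3 (m3 - 1)) * (- sign_int (j1 - j2 - m3) * tri_weight j1 j2 j3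
        * (mag_weight j1 m1 * mag_weight j2 m2) * racah ?A ?B ?C ?u ?v)"
      using threej_racah[OF t s m(1,2) mm] m(4) unfolding sg by (simp add: mult_ac)
    then show ?thesis
      unfolding ladder_mag_weight[OF i(5,6) ge, simplified, OF r(6)] bv by (simp add: mult_ac)
  qed
  show ?thesis
    unfolding 1 2 3 racah_recursion[OF ti(2,3,4) i(2,3), symmetric] by (simp only: distrib_left) simp
next
  case False
  have "ladder 1 j1 m1 * threej j1 j2 j3 (m1 - 1) m2 m3 = 0"
    using False ladder_mags[OF s(1), of m1] threej_nonzeroD[of j1 j2 j3 "m1 - 1" m2 m3, OF _ s(3)]
    by (auto simp: algebra_simps)
  moreover have "ladder 1 j2 m2 * threej j1 j2 j3 m1 (m2 - 1) m3 = 0"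
    using False ladder_mags[OF s(2), of m2] threej_nonzeroD[of j1 j2 j3 m1 "m2 - 1" m3, OF _ s(3)]
    by (auto simp: algebra_simps)
  moreover have "ladder 1 j3 m3 * threej j1 j2 j3 m1 m2 (m3 - 1) = 0"
    using False ladder_mags[OF s(3), of m3] threej_nonzeroD[of j1 j2 j3 m1 m2 "m3 - 1", OF _ s(3)]
    by (auto simp: algebra_simps)
  ultimately show ?thesis by auto
qed

text \<open>Lowering follows from raising, because reversing all magnetic numbers multiplies the
  3j-symbol by a constant sign.\<close>

lemma threej_invariant3:
  assumes s: "spin j1" "spin j2" "spin j3"
  shows "invariant3 j1 j2 j3 (threej j1 j2 j3)"
proof -
  have neg: "ladder (- 1) j m = ladder 1 j (- m)" for j m
    by (simp add: ladder_def)
  have "ladder (- 1) j1 m1 * threej j1 j2 j3 (m1 - - 1) m2 m3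
       + ladder (- 1) j2 m2 * threej j1 j2 j3 m1 (m2 - - 1) m3
       + ladder (- 1) j3 m3 * threej j1 j2 j3 m1 m2 (m3 - - 1) = 0" (is "?x = 0") for m1 m2 m3
  proof -
    have e: "- m - 1 = - (m + 1)" for m :: real by simp
    have "sign_int (j1 + j2 + j3) * ?x = 0"
      using threej_raise[OF s, of "- m1" "- m2" "- m3"]
      unfolding e threej_negate[OF s] by (simp add: neg distrib_left mult.left_commute)
    then show ?thesis by simp
  qed
  then show ?thesis
    unfolding invariant3_def using threej_raise[OF s] threej_nonzeroD[OF _ s(3)] by auto
qed

lemma invariant3_diff_scaled:
  assumes f: "invariant3 j1 j2 j3 f" and g: "invariant3 j1 j2 j3 g"
  shows "invariant3 j1 j2 j3 (\<lambda>m1 m2 m3. f m1 m2 m3 - c * g m1 m2 m3)"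
proof (rule invariant3I)
  fix m1 m2 m3 assume "f m1 m2 m3 - c * g m1 m2 m3 \<noteq> 0"
  then have "f m1 m2 m3 \<noteq> 0 \<or> g m1 m2 m3 \<noteq> 0" by auto
  then show "m1 \<in> mags j1 \<and> m2 \<in> mags j2 \<and> m3 \<in> mags j3 \<and> m1 + m2 + m3 = 0"
    using invariant3_supp[OF f] invariant3_supp[OF g] by blast
next
  fix d m1 m2 m3 :: real assume d: "d = 1 \<or> d = - 1"
  have "ladder d j1 m1 * (f (m1 - d) m2 m3 - c * g (m1 - d) m2 m3)
       + ladder d j2 m2 * (f m1 (m2 - d) m3 - c * g m1 (m2 - d) m3)
       + ladder d j3 m3 * (f m1 m2 (m3 - d) - c * g m1 m2 (m3 - d))
      = (ladder d j1 m1 * f (m1 - d) m2 m3 + ladder d j2 m2 * f m1 (m2 - d) m3 + ladder d j3 m3 * f m1 m2 (m3 - d))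
      - c * (ladder d j1 m1 * g (m1 - d) m2 m3 + ladder d j2 m2 * g m1 (m2 - d) m3 + ladder d j3 m3 * g m1 m2 (m3 - d))"
    by (simp add: algebra_simps)
  then show "ladder d j1 m1 * (f (m1 - d) m2 m3 - c * g (m1 - d) m2 m3)
       + ladder d j2 m2 * (f m1 (m2 - d) m3 - c * g m1 (m2 - d) m3)
       + ladder d j3 m3 * (f m1 m2 (m3 - d) - c * g m1 m2 (m3 - d)) = 0"
    using invariant3_ladder[OF f d] invariant3_ladder[OF g d] by simp
qed

lemma invariant3_swap12:
  assumes f: "invariant3 j1 j2 j3 f"
  shows "invariant3 j2 j1 j3 (\<lambda>m2 m1 m3. f m1 m2 m3)"
proof (rule invariant3I)
  fix m2 m1 m3 assume "f m1 m2 m3 \<noteq> 0"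
  then show "m2 \<in> mags j2 \<and> m1 \<in> mags j1 \<and> m3 \<in> mags j3 \<and> m2 + m1 + m3 = 0"
    using invariant3_supp[OF f] by (simp add: add.commute[of m2])
next
  fix d m2 m1 m3 :: real assume "d = 1 \<or> d = - 1"
  then show "ladder d j2 m2 * f m1 (m2 - d) m3 + ladder d j1 m1 * f (m1 - d) m2 m3
      + ladder d j3 m3 * f m1 m2 (m3 - d) = 0"
    using invariant3_ladder[OF f] by (simp add: add.commute[of "ladder d j2 m2 * _"])
qed

lemma spin_mags_induct [consumes 2, case_names bottom step]:
  assumes "spin j" "m \<in> mags j" "P (- j)"
    and "\<And>m. m \<in> mags j \<Longrightarrow> m < j \<Longrightarrow> P m \<Longrightarrow> P (m + 1)"
  shows "P m"
proof -
  have "j + m \<in> \<int>" "0 \<le> j + m" using assms(1,2) mags_add_Ints by (auto simp: mags_def)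
  then obtain n where n: "j + m = real n"
    by (metis Ints_cases of_int_0_le_iff of_int_of_nat_eq zero_le_imp_eq_int)
  have "P (- j + real k) \<and> - j + real k \<in> mags j" if "k \<le> n" for k
    using that
  proof (induction k)
    case 0 then show ?case using assms by simp
  next
    case (Suc k)
    then have "P (- j + real k)" and k: "- j + real k \<in> mags j" by auto
    moreover have "- j + real k < j" using Suc.prems n assms(2) by (auto simp: mags_def)
    ultimately have "P (- j + real k + 1)" "- j + real k + 1 \<in> mags j"
      using assms(4) mags_plus_1 by blast+
    then show ?case by (simp add: algebra_simps)
  qed
  from this[of n] show ?thesis by (simp flip: n)
qed

text \<open>Schur's lemma: the raising equations at \<open>m\<^sub>3 = - j\<^sub>3\<close> are a two-term recursion in \<open>m\<^sub>1\<close>,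
  and the lowering equations then determine the values at higher \<open>m\<^sub>3\<close>.\<close>

lemma invariant3_eq_0:
  assumes s: "spin j1" "spin j2" "spin j3" and f: "invariant3 j1 j2 j3 f"
    and 0: "f j1 (j3 - j1) (- j3) = 0"
  shows "f m1 m2 m3 = 0"
proof -
  have low: "f m1 (j3 - m1) (- j3) = 0" for m1
  proof (cases "m1 \<in> mags j1")
    case True
    \<comment> \<open>The known value sits at the top \<open>m1 = j1\<close>, so the induction goes
      downward and is run on \<open>- m1\<close>.\<close>
    then have "- m1 \<in> mags j1" using s by simp
    with s(1) have "f (- (- m1)) (j3 - - (- m1)) (- j3) = 0"
    proof (induction rule: spin_mags_induct)
      case bottom then show ?case using 0 by simp
    next
      case (step m)
      have e: "- (m + 1) = - m - 1" "j3 - (- m - 1) = j3 + m + 1" by simp_all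
      have "ladder 1 j1 (- m) * f (- (m + 1)) (j3 - - (m + 1)) (- j3) = 0"
        using invariant3_ladder[OF f, of 1 "- m" "j3 + m + 1" "- j3"] step.IH
        by (simp add: ladder_def[of 1 j3] e)
      moreover have "ladder 1 j1 (- m) > 0"
        using step by (auto simp: ladder_def mags_def)
      ultimately show ?case by simp
    qed
    then show ?thesis by simp
  next
    case False
    then show ?thesis using invariant3_supp[OF f] by blast
  qed
  show ?thesis
  proof (cases "m3 \<in> mags j3")
    case True
    with s(3) have "\<forall>m1 m2. f m1 m2 m3 = 0"
    proof (induction rule: spin_mags_induct)
      case bottom
      show ?case
      proof (intro allI)
        fix m1 m2 show "f m1 m2 (- j3) = 0"
        proof (cases "m2 = j3 - m1")
          case True
          then show ?thesis using low by simp
        next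
          case False
          then show ?thesis using invariant3_supp[OF f, of m1 m2 "- j3"] by fastforce
        qed
      qed
    next
      case (step m)
      show ?case
      proof (intro allI)
        fix m1 m2
        have "ladder (- 1) j3 m * f m1 m2 (m + 1) = 0"
          using invariant3_ladder[OF f, of "- 1" m1 m2 m] step.IH by simp
        moreover have "ladder (- 1) j3 m > 0"
          using step by (auto simp: ladder_def mags_def)
        ultimately show "f m1 m2 (m + 1) = 0" by simp
      qed
    qed
    then show ?thesis by blast
  next
    case False
    then show ?thesis using invariant3_supp[OF f] by blast
  qed
qed

text \<open>The component that determines an invariant would need a magnetic number outside its
  range. With \<open>m1 = j1\<close> on top the range condition covers integrality and two of the
  triangle inequalities; a failure of \<open>j2 - j1 \<le> j3\<close> requires the roles of the
  first two spins to be exchanged.\<close>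

lemma invariant3_not_triad:
  assumes s: "spin j1" "spin j2" "spin j3" and f: "invariant3 j1 j2 j3 f"
    and n: "\<not> triad j1 j2 j3"
  shows "f m1 m2 m3 = 0"
proof (cases "j3 < j2 - j1")
  case True
  have "j3 - j2 \<notin> mags j1" using True by (auto simp: mags_def)
  then have "f (j3 - j2) j2 (- j3) = 0" using invariant3_supp[OF f] by blast
  from invariant3_eq_0[OF s(2,1,3) invariant3_swap12[OF f] this]
  show ?thesis .
next
  case False
  have "j3 - j1 \<notin> mags j2"
  proof
    assume m: "j3 - j1 \<in> mags j2"
    have "j2 - (j3 - j1) + 2 * j3 \<in> \<int>"
      using Ints_add[OF mags_diff_Ints[OF m] spin_double_Ints[OF s(3)]] .
    then have "j1 + j2 + j3 \<in> \<int>" by (simp add: algebra_simps)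
    then have "triad j1 j2 j3" using m False by (auto simp: triad_def mags_def)
    with n show False ..
  qed
  then have "f j1 (j3 - j1) (- j3) = 0" using invariant3_supp[OF f] by blast
  from invariant3_eq_0[OF s f this] show ?thesis .
qed

text \<open>At \<open>m1 = j1\<close> the parameter \<open>u\<close> is \<open>0\<close>, which
  leaves only the term \<open>k = 0\<close> of Racah's sum.\<close>

lemma threej_top_pos:
  assumes s: "spin j1" "spin j2" "spin j3" and t: "triad j1 j2 j3"
  shows "threej j1 j2 j3 j1 (j3 - j1) (- j3) \<noteq> 0"
proof -
  note ti = triad_Ints[OF t s]
  have m: "j3 - j1 \<in> mags j2"
    using ti by (auto simp: mags_def algebra_simps)
  let ?A = "j1 + j2 - j3" and ?B = "j1 - j2 + j3" and ?C = "- j1 + j2 + j3"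
  have "racah ?A ?B ?C (j1 - j1) (j2 + (j3 - j1)) = (\<Sum>k\<in>{0}. racah_term ?A ?B ?C (j1 - j1) (j2 + (j3 - j1)) (of_int k))"
    by (rule racah_superset) (auto intro!: racah_term_zero)
  also have "\<dots> \<noteq> 0"
    using ti by (simp add: racah_term_def rinv_nonneg algebra_simps)
  finally show ?thesis
    using threej_racah[OF t s _ m, of j1 "- j3"] s
    by (simp add: less_imp_neq[OF tri_weight_pos, symmetric] less_imp_neq[OF mag_weight_pos, symmetric])
qed

lemma invariant3_proportional:
  assumes s: "spin j1" "spin j2" "spin j3" and f: "invariant3 j1 j2 j3 f"
  shows "\<exists>c. \<forall>m1 m2 m3. f m1 m2 m3 = c * threej j1 j2 j3 m1 m2 m3"
proof (cases "triad j1 j2 j3")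
  case True
  \<comment> \<open>This \<open>c\<close> makes the difference vanish at the one component that
    determines an invariant.\<close>
  define c where "c = f j1 (j3 - j1) (- j3) / threej j1 j2 j3 j1 (j3 - j1) (- j3)"
  have "f m1 m2 m3 - c * threej j1 j2 j3 m1 m2 m3 = 0" for m1 m2 m3
    by (rule invariant3_eq_0[OF s invariant3_diff_scaled[OF f threej_invariant3[OF s]]])
      (use threej_top_pos[OF s True] in \<open>simp add: c_def\<close>)
  then show ?thesis by (intro exI[of _ c]) auto
next
  case False
  then show ?thesis using invariant3_not_triad[OF s f] by (intro exI[of _ 0]) simp
qed

section \<open>Orthogonality\<close>

text \<open>Both sides are the coefficient of \<open>x^a\<close> in
  \<open>(1-x)^(-b-1) (1-x)^(-c-1) = (1-x)^(-b-c-2)\<close>. The induction proves it by Pascal's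
  rule applied to the first factor.\<close>

lemma sum_choose_choose:
  "(\<Sum>i\<le>a. (b + (a - i) choose b) * (c + i choose c)) = (a + b + c + 1 choose a)"
proof (induction a arbitrary: b)
  case 0 then show ?case by simp
next
  case (Suc a)
  note outer = Suc.IH
  show ?case
  proof (induction b)
    case 0
    have "(\<Sum>i\<le>Suc a. (c + i choose c)) = (\<Sum>i\<le>Suc a. (c + i choose i))"
      by (intro sum.cong refl) (metis add_diff_cancel_left' binomial_symmetric le_add1)
    also have "\<dots> = Suc (c + Suc a) choose Suc a" by (rule sum_choose_lower)
    finally show ?case by (simp add: add_ac)
  next
    case (Suc b)
    have "(\<Sum>i\<le>Suc a. (Suc b + (Suc a - i) choose Suc b) * (c + i choose c))
      = (\<Sum>i\<le>a. (Suc b + (a - i) choose Suc b) * (c + i choose c))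
        + (\<Sum>i\<le>Suc a. (b + (Suc a - i) choose b) * (c + i choose c))"
    proof -
      have "(\<Sum>i\<le>a. (Suc b + (Suc a - i) choose Suc b) * (c + i choose c))
        = (\<Sum>i\<le>a. (Suc b + (a - i) choose Suc b) * (c + i choose c) + (b + (Suc a - i) choose b) * (c + i choose c))"
        by (intro sum.cong refl) (simp add: Suc_diff_le algebra_simps)
      then show ?thesis by (simp add: sum.distrib)
    qed
    also have "\<dots> = (a + Suc b + c + 1 choose a) + (Suc a + b + c + 1 choose Suc a)"
      unfolding Suc.IH outer ..
    also have "\<dots> = (Suc a + Suc b + c + 1 choose Suc a)" by simp
    finally show ?case .
  qed
qed

text \<open>The preceding convolution in the shape in which squares of 3j-symbols at
  \<open>m3 = - j3\<close> produce it.\<close>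

lemma sum_fact_quotients:
  "(\<Sum>i\<le>a. fact (b + (a - i)) * fact (c + i) / (fact i * fact (a - i)))
    = (fact b * fact c * fact (a + b + c + 1) / (fact a * fact (b + c + 1)) :: real)"
    (is "?lhs = _")
proof -
  have "?lhs = (\<Sum>i\<le>a. fact b * fact c * real ((b + (a - i) choose b) * (c + i choose c)))"
    by (intro sum.cong refl) (simp add: binomial_fact field_simps)
  also have "\<dots> = fact b * fact c * real (a + b + c + 1 choose a)"
    unfolding sum_choose_choose[of b a c, symmetric] of_nat_sum sum_distrib_left ..
  also have "\<dots> = fact b * fact c * fact (a + b + c + 1) / (fact a * fact (b + c + 1))"
    by (subst binomial_fact) (simp_all add: add_ac)
  finally show ?thesis .
qed

text \<open>At the lowest \<open>m3\<close> the squares are explicit quotients of factorials. This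
  is the only place where a norm is computed by summation; all other norms follow from it by Schur's
  lemma.\<close>

lemma threej_top_norm:
  assumes s: "spin j1" "spin j2" "spin j3" and t: "triad j1 j2 j3"
  shows "(\<Sum>m1\<in>mags j1. \<Sum>m2\<in>mags j2. (threej j1 j2 j3 m1 m2 (- j3))\<^sup>2) = 1 / (2 * j3 + 1)"
proof -
  have nat: "\<exists>n. x = real n" if "x \<in> \<int>" "0 \<le> x" for x
    using that by (metis Ints_cases of_int_0_le_iff of_int_of_nat_eq zero_le_imp_eq_int)
  note ti = triad_Ints[OF t s]
  obtain a b c where abc: "j1 + j2 - j3 = real a" "j1 - j2 + j3 = real b" "- j1 + j2 + j3 = real c"
    using nat[OF ti(2,5)] nat[OF ti(3,6)] nat[OF ti(4,7)] by blast
  then have j: "j1 = (real a + real b) / 2" "j2 = (real a + real c) / 2" "j3 = (real b + real c) / 2"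
    by simp_all
  let ?f = "\<lambda>m1 m2. (threej j1 j2 j3 m1 m2 (- j3))\<^sup>2"
  have rf: "rfact (real n) = fact n" for n by (simp add: rfact_def)
  have m: "j1 - real i \<in> mags j1" "j3 - j1 + real i \<in> mags j2" if i: "i \<le> a" for i
  proof -
      have "j1 - (j1 - real i) = real i" "j2 - (j3 - j1 + real i) = real (a - i)"
        using i by (simp_all add: j field_simps of_nat_diff)
      then have "j1 - (j1 - real i) \<in> \<int>" "j2 - (j3 - j1 + real i) \<in> \<int>"
        by (metis Ints_of_nat)+
      moreover have "real i \<le> real a" "0 \<le> real b" "0 \<le> real c" using i by simp_all
      ultimately show "j1 - real i \<in> mags j1" "j3 - j1 + real i \<in> mags j2"
        using abc unfolding mags_def mem_Collect_eq by (intro conjI; linarith)+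
  qed
  have val: "?f (j1 - real i) (j3 - j1 + real i)
    = fact a * fact (b + c) / (fact (a + b + c + 1) * fact b * fact c)
      * (fact (b + (a - i)) * fact (c + i) / (fact i * fact (a - i)))" if i: "i \<le> a" for i
  proof -
    \<comment> \<open>With \<open>u = i\<close> and \<open>v = c + i\<close> the factors
      \<open>rinv (u - k)\<close> and \<open>rinv (C - v + k)\<close> force
      \<open>k = i\<close>.\<close>
    have "racah (real a) (real b) (real c) (real i) (real c + real i)
      = (\<Sum>k\<in>{int i}. racah_term (real a) (real b) (real c) (real i) (real c + real i) (of_int k))"
      by (rule racah_superset) (auto intro!: racah_term_zero)
    also have "\<dots> = sign_int (real i) / (fact i * fact (a - i) * fact b * fact c)"
      using i rf[of "a - i"] by (simp add: racah_term_def rinv_nonneg rf of_nat_diff)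
    finally have r: "racah (real a) (real b) (real c) (real i) (real c + real i) = \<dots>" .
    have e: "j1 - (j1 - real i) = real i" "j2 + (j3 - j1 + real i) = real c + real i"
      "j1 - j2 - - j3 = real b" by (simp_all add: j field_simps)
    have e2: "j1 + (j1 - real i) = real (b + (a - i))" "j2 - (j3 - j1 + real i) = real (a - i)"
      "j3 + - j3 = real 0" "j3 - - j3 = real (b + c)" "j1 + j2 + j3 + 1 = real (a + b + c + 1)"
      using i by (simp_all add: j field_simps of_nat_diff)
    have th: "threej j1 j2 j3 (j1 - real i) (j3 - j1 + real i) (- j3)
      = sign_int (real b) * sqrt (fact a * fact b * fact c / fact (a + b + c + 1))
      * (sqrt (fact (b + (a - i)) * fact i) * sqrt (fact (c + i) * fact (a - i)) * sqrt (fact (b + c)))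
      * (sign_int (real i) / (fact i * fact (a - i) * fact b * fact c))"
      using threej_racah[OF t s m[OF i], of "- j3"] s
      unfolding tri_weight_def mag_weight_def e e2 abc r rf
      by (simp add: rf flip: of_nat_add)
    have sq: "sign_int (real n) ^ 2 = 1" for n by (simp add: power2_eq_square)
    have "?f (j1 - real i) (j3 - j1 + real i)
      = fact a * fact b * fact c / fact (a + b + c + 1)
      * (fact (b + (a - i)) * fact i * (fact (c + i) * fact (a - i)) * fact (b + c))
      / (fact i * fact (a - i) * fact b * fact c)^2"
      unfolding th power_mult_distrib power_divide sq by simp
    moreover have "A * B * C / S * (X * I * (Y * Q) * Z) / (I * Q * B * C)^2 = A * Z / (S * B * C) * (X * Y / (I * Q))"
      if "B \<noteq> 0" "C \<noteq> 0" "I \<noteq> 0" "Q \<noteq> 0" for A B C S X I Y Q Z :: real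
      using that by (simp add: power2_eq_square mult_ac)
    ultimately show ?thesis by (simp only: fact_nonzero not_False_eq_True)
  qed
  \<comment> \<open>The pairs with \<open>m1 + m2 = j3\<close> are parametrized by
    \<open>i = j1 - m1\<close>; all other summands vanish.\<close>
  let ?S = "(\<lambda>i. (j1 - real i, j3 - j1 + real i)) ` {..a}"
  have "(\<Sum>m1\<in>mags j1. \<Sum>m2\<in>mags j2. ?f m1 m2) = (\<Sum>(m1, m2)\<in>mags j1 \<times> mags j2. ?f m1 m2)"
    by (simp add: sum.cartesian_product)
  also have "\<dots> = (\<Sum>(m1, m2)\<in>?S. ?f m1 m2)"
  proof (rule sum.mono_neutral_right)
    show "?S \<subseteq> mags j1 \<times> mags j2"
      using m by auto
    show "\<forall>p\<in>mags j1 \<times> mags j2 - ?S.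
      (case p of (m1, m2) \<Rightarrow> ?f m1 m2) = 0"
    proof clarify
      fix m1 m2 assume m: "m1 \<in> mags j1" "m2 \<in> mags j2"
        and n: "(m1, m2) \<notin> ?S"
      show "?f m1 m2 = 0"
      proof (rule ccontr)
        assume "?f m1 m2 \<noteq> 0"
        then have "m1 + m2 + - j3 = 0" using threej_nonzeroD(5)[of j1 j2 j3 m1 m2 "- j3"] s by auto
        moreover obtain i where i: "j1 - m1 = real i"
          using nat[OF mags_diff_Ints[OF m(1)]] m(1) by (auto simp: mags_def)
        ultimately have "m1 = j1 - real i" "m2 = j3 - j1 + real i" "i \<le> a"
          using m(2) abc by (auto simp: mags_def)
        with n show False by auto
      qed
    qed
  qed simp
  also have "\<dots> = (\<Sum>i\<le>a. ?f (j1 - real i) (j3 - j1 + real i))"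
    by (subst sum.reindex) (auto simp: inj_on_def)
  also have "\<dots> = (\<Sum>i\<le>a. fact a * fact (b + c) / (fact (a + b + c + 1) * fact b * fact c)
      * (fact (b + (a - i)) * fact (c + i) / (fact i * fact (a - i))))"
    by (intro sum.cong refl val) simp
  also have "\<dots> = fact (b + c) / fact (b + c + 1)"
    unfolding sum_distrib_left[symmetric] sum_fact_quotients
  proof -
    have "A * Y / (S * B * C) * (B * C * S / (A * Z)) = Y / Z" if "A \<noteq> 0" "B \<noteq> 0" "C \<noteq> 0" "S \<noteq> 0"
      for A B C S Y Z :: real
      using that by simp
    then show "fact a * fact (b + c) / (fact (a + b + c + 1) * fact b * fact c)
      * (fact b * fact c * fact (a + b + c + 1) / (fact a * fact (b + c + 1))) = (fact (b + c) / fact (b + c + 1) :: real)"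
      by (simp only: fact_nonzero not_False_eq_True)
  qed
  also have "fact (b + c + 1) = (2 * j3 + 1) * (fact (b + c) :: real)" by (simp add: j)
  also have "fact (b + c) / ((2 * j3 + 1) * fact (b + c)) = 1 / (2 * j3 + 1)" by simp
  finally show ?thesis .
qed

section \<open>Contraction of invariants along internal lines\<close>

text \<open>The alternating sum of \<open>F n * G (- n)\<close> is the invariant pairing of two
  copies of spin \<open>l\<close>: shifting the index by one moves the ladder operator from one
  argument to the other and flips the sign.\<close>

lemma contract_ladder:
  assumes l: "spin l" and d: "d = 1 \<or> d = - 1"
  shows "(\<Sum>n\<in>mags l. sign_int (l + n) * (ladder d l n * F (n - d) * G (- n) + F n * ladder d l (- n) * G (- n - d))) = (0::real)"
    (is "?lhs = _")
proof -
  have up: "(\<Sum>n\<in>mags l. sign_int (l + n) * (ladder 1 l n * F (n - 1) * G (- n) + F n * ladder 1 l (- n) * G (- n - 1))) = (0::real)"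
    for F G
  proof -
    have "(\<Sum>n\<in>mags l. sign_int (l + n) * ladder 1 l n * F (n - 1) * G (- n))
      = (\<Sum>n\<in>mags l - {- l}. sign_int (l + n) * ladder 1 l n * F (n - 1) * G (- n))"
      by (rule sum.mono_neutral_right) (auto simp: ladder_def)
    also have "\<dots> = (\<Sum>n\<in>mags l - {l}. - (sign_int (l + n) * F n * ladder 1 l (- n) * G (- n - 1)))"
    proof (rule sum.reindex_bij_witness[of _ "\<lambda>n. n + 1" "\<lambda>n. n - 1"])
      fix n assume n: "n \<in> mags l - {- l}"
      then show "n - 1 \<in> mags l - {l}" using mags_minus_1[OF l, of n] by (auto simp: mags_def)
      show "- (sign_int (l + (n - 1)) * F (n - 1) * ladder 1 l (- (n - 1)) * G (- (n - 1) - 1))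
        = sign_int (l + n) * ladder 1 l n * F (n - 1) * G (- n)"
        using sign_int_minus_1[of "l + n"] by (simp add: ladder_def algebra_simps)
    next
      fix n assume n: "n \<in> mags l - {l}"
      then show "n + 1 \<in> mags l - {- l}" using mags_plus_1[of n l] by (auto simp: mags_def)
    qed auto
    also have "\<dots> = (\<Sum>n\<in>mags l. - (sign_int (l + n) * F n * ladder 1 l (- n) * G (- n - 1)))"
      by (rule sum.mono_neutral_left) (auto simp: ladder_def)
    finally show ?thesis by (simp add: sum.distrib sum_negf distrib_left mult.assoc)
  qed
  show ?thesis
  proof (cases "d = 1")
    case True
    then show ?thesis using up by simp
  next
    case False
    then have d: "d = - 1" using d by simp
    have neg: "ladder (- 1) l n = ladder 1 l (- n)" for n by (simp add: ladder_def)
    \<comment> \<open>Lowering is reduced to raising by \<open>n\<close> to \<open>- n\<close>,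
      applied to the summation and to both functions; the reflection costs the constant sign of
      \<open>2 * l\<close>.\<close>
    have "?lhs = (\<Sum>n\<in>mags l. sign_int (l - n) * (ladder 1 l n * F (- (n - 1)) * G n + F (- n) * ladder 1 l (- n) * G (n + 1)))"
      unfolding d neg
      using sum_mags_uminus[OF l, of "\<lambda>n. sign_int (l + n) * (ladder 1 l (- n) * F (n + 1) * G (- n) + F n * ladder 1 l n * G (- n + 1))"]
      by (simp add: add.commute)
    also have "\<dots> = sign_int (2 * l) * (\<Sum>n\<in>mags l. sign_int (l + n)
       * (ladder 1 l n * F (- (n - 1)) * G (- (- n)) + F (- n) * ladder 1 l (- n) * G (- (- n - 1))))"
      unfolding sum_distrib_left
    proof (rule sum.cong[OF refl])
      fix n assume n: "n \<in> mags l"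
      have "sign_int (2 * l - (l + n)) = sign_int (2 * l) * sign_int (l + n)"
        using mags_add_Ints[OF l n] by (rule sign_int_diff)
      then have "sign_int (l - n) = sign_int (2 * l) * sign_int (l + n)" by simp
      then show "sign_int (l - n) * (ladder 1 l n * F (- (n - 1)) * G n + F (- n) * ladder 1 l (- n) * G (n + 1))
        = sign_int (2 * l) * (sign_int (l + n)
       * (ladder 1 l n * F (- (n - 1)) * G (- (- n)) + F (- n) * ladder 1 l (- n) * G (- (- n - 1))))"
        by (simp add: add.commute mult.assoc)
    qed
    also have "\<dots> = 0" using up[of "\<lambda>n. F (- n)" "\<lambda>n. G (- n)"] by simp
    finally show ?thesis .
  qed
qed


text \<open>A 3j-symbol with a zero column is the invariant pairing up to normalization. Racah's sum
  is reduced to \<open>k = j - m\<close>. Used to close a triangle into a contraction of just two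
  3j-symbols.\<close>

lemma threej_0:
  assumes j: "spin j" and m: "m \<in> mags j"
  shows "threej j j 0 m (- m) 0 = sign_int (j - m) / sqrt (2 * j + 1)"
proof -
  have i: "j - m \<in> \<int>" "2 * j \<in> \<int>" "0 \<le> j - m" "0 \<le> j + m" "0 \<le> j"
    using j m spin_double_Ints[OF j] spin_nonneg[OF j] by (auto simp: mags_def)
  obtain k where k: "j - m = of_int k" using i(1) by (elim Ints_cases)
  have t: "triad j j 0" using i by (auto simp: triad_def)
  have "racah (2 * j) 0 0 (j - m) (j - m) = (\<Sum>l\<in>{k}. racah_term (2 * j) 0 0 (j - m) (j - m) (of_int l))"
    by (rule racah_superset) (auto intro!: racah_term_zero simp: k)
  also have "\<dots> = sign_int (j - m) / (rfact (j - m) * rfact (j + m))"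
    using i by (simp add: racah_term_def rinv_nonneg flip: k)
  finally have r: "racah (2 * j) 0 0 (j - m) (j - m) = \<dots>" .
  have "threej j j 0 m (- m) 0 = sqrt (rfact (2 * j) / rfact (2 * j + 1))
      * (mag_weight j m * mag_weight j m) * (sign_int (j - m) / (rfact (j - m) * rfact (j + m)))"
    using threej_racah[OF t j j spin_0 m, of "- m" 0] m j r
    by (simp add: tri_weight_def mag_weight_def[of 0])
  also have "mag_weight j m * mag_weight j m = rfact (j + m) * rfact (j - m)"
    by (simp add: mag_weight_def less_imp_le)
  also have "rfact (2 * j + 1) = (2 * j + 1) * rfact (2 * j)"
    using rfact_Suc[of "2 * j"] i by simp
  finally show ?thesis by (simp add: real_sqrt_divide real_sqrt_mult)
qed

lemma sum_swap_last:
  "(\<Sum>a\<in>A. \<Sum>b\<in>B. \<Sum>c\<in>C. f a b c) = (\<Sum>a\<in>A. \<Sum>c\<in>C. \<Sum>b\<in>B. f a b c)"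
  by (intro sum.cong refl sum.swap)

lemma sum_rotate:
  "(\<Sum>a\<in>A. \<Sum>b\<in>B. \<Sum>c\<in>C. f a b c) = (\<Sum>b\<in>B. \<Sum>c\<in>C. \<Sum>a\<in>A. f a b c)"
  by (subst sum.swap) (intro sum.cong refl sum.swap)

text \<open>Invariance of \<open>A\<close>, \<open>B\<close> and \<open>C\<close> moves a ladder
  operator from the outer legs to the inner lines, where the two contributions at the ends of each
  line cancel.\<close>

lemma triangle_invariant3:
  assumes l: "spin l1" "spin l2" "spin l3"
    and A: "invariant3 j1 l2 l3 A" and B: "invariant3 l1 j2 l3 B" and C: "invariant3 l1 l2 j3 C"
  shows "invariant3 j1 j2 j3 (\<lambda>m1 m2 m3. \<Sum>n1\<in>mags l1. \<Sum>n2\<in>mags l2. \<Sum>n3\<in>mags l3.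
    sign_int (l1 + n1) * sign_int (l2 + n2) * sign_int (l3 + n3)
      * (A m1 n2 (- n3) * B (- n1) m2 n3 * C n1 (- n2) m3))"
    (is "invariant3 j1 j2 j3 ?f")
proof (rule invariant3I)
  fix m1 m2 m3 assume nz: "?f m1 m2 m3 \<noteq> 0"
  have "\<exists>n1 n2 n3. A m1 n2 (- n3) * B (- n1) m2 n3 * C n1 (- n2) m3 \<noteq> 0"
  proof (rule ccontr)
    assume "\<not> ?thesis"
    then have "?f m1 m2 m3 = 0" by (auto intro!: sum.neutral)
    with nz show False by blast
  qed
  then obtain n1 n2 n3 where n: "A m1 n2 (- n3) \<noteq> 0" "B (- n1) m2 n3 \<noteq> 0" "C n1 (- n2) m3 \<noteq> 0"
    by auto
  show "m1 \<in> mags j1 \<and> m2 \<in> mags j2 \<and> m3 \<in> mags j3 \<and> m1 + m2 + m3 = 0"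
    using invariant3_supp[OF A n(1)] invariant3_supp[OF B n(2)] invariant3_supp[OF C n(3)]
    by (intro conjI) (blast | linarith)+
next
  fix d m1 m2 m3 :: real assume d: "d = 1 \<or> d = - 1"
  let ?s = "\<lambda>n1 n2 n3. sign_int (l1 + n1) * sign_int (l2 + n2) * sign_int (l3 + n3)"
  have a: "ladder d j1 m1 * A (m1 - d) n2 (- n3)
    = - (ladder d l2 n2 * A m1 (n2 - d) (- n3) + ladder d l3 (- n3) * A m1 n2 (- n3 - d))" for n2 n3
    using invariant3_ladder[OF A d, of m1 n2 "- n3"] by linarith
  have b: "ladder d j2 m2 * B (- n1) (m2 - d) n3
    = - (ladder d l1 (- n1) * B (- n1 - d) m2 n3 + ladder d l3 n3 * B (- n1) m2 (n3 - d))" for n1 n3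
    using invariant3_ladder[OF B d, of "- n1" m2 n3] by linarith
  have c: "ladder d j3 m3 * C n1 (- n2) (m3 - d)
    = - (ladder d l1 n1 * C (n1 - d) (- n2) m3 + ladder d l2 (- n2) * C n1 (- n2 - d) m3)" for n1 n2
    using invariant3_ladder[OF C d, of n1 "- n2" m3] by linarith
  let ?Z1 = "\<Sum>n1\<in>mags l1. \<Sum>n2\<in>mags l2. \<Sum>n3\<in>mags l3. sign_int (l1 + n1) *
        (ladder d l1 n1 * C (n1 - d) (- n2) m3 * B (- n1) m2 n3 + C n1 (- n2) m3 * ladder d l1 (- n1) * B (- n1 - d) m2 n3)
          * (sign_int (l2 + n2) * sign_int (l3 + n3) * A m1 n2 (- n3))"
  let ?Z2 = "\<Sum>n1\<in>mags l1. \<Sum>n2\<in>mags l2. \<Sum>n3\<in>mags l3. sign_int (l2 + n2) *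
        (ladder d l2 n2 * A m1 (n2 - d) (- n3) * C n1 (- n2) m3 + A m1 n2 (- n3) * ladder d l2 (- n2) * C n1 (- n2 - d) m3)
          * (sign_int (l1 + n1) * sign_int (l3 + n3) * B (- n1) m2 n3)"
  let ?Z3 = "\<Sum>n1\<in>mags l1. \<Sum>n2\<in>mags l2. \<Sum>n3\<in>mags l3. sign_int (l3 + n3) *
        (ladder d l3 n3 * B (- n1) m2 (n3 - d) * A m1 n2 (- n3) + B (- n1) m2 n3 * ladder d l3 (- n3) * A m1 n2 (- n3 - d))
          * (sign_int (l1 + n1) * sign_int (l2 + n2) * C n1 (- n2) m3)"
  have "ladder d j1 m1 * ?f (m1 - d) m2 m3 + ladder d j2 m2 * ?f m1 (m2 - d) m3 + ladder d j3 m3 * ?f m1 m2 (m3 - d)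
    = (\<Sum>n1\<in>mags l1. \<Sum>n2\<in>mags l2. \<Sum>n3\<in>mags l3. ?s n1 n2 n3 * (
        (ladder d j1 m1 * A (m1 - d) n2 (- n3)) * B (- n1) m2 n3 * C n1 (- n2) m3
      + A m1 n2 (- n3) * (ladder d j2 m2 * B (- n1) (m2 - d) n3) * C n1 (- n2) m3
      + A m1 n2 (- n3) * B (- n1) m2 n3 * (ladder d j3 m3 * C n1 (- n2) (m3 - d))))"
    by (simp add: sum_distrib_left distrib_left sum.distrib mult_ac)
  also have "\<dots> = - (?Z1 + ?Z2 + ?Z3)"
    unfolding a b c sum.distrib[symmetric] sum_negf[symmetric]
    by (intro sum.cong refl) (simp add: algebra_simps)
  also have "?Z1 = 0"
    by (subst sum_rotate, unfold sum_distrib_right[symmetric])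
      (use contract_ladder[OF l(1) d, of "\<lambda>x. C x (- n2) m3" "\<lambda>x. B x m2 n3" for n2 n3] in simp)
  also have "?Z2 = 0"
    by (subst sum_swap_last, unfold sum_distrib_right[symmetric])
      (use contract_ladder[OF l(2) d, of "\<lambda>x. A m1 x (- n3)" "\<lambda>x. C n1 x m3" for n1 n3] in simp)
  also have "?Z3 = 0"
    unfolding sum_distrib_right[symmetric]
    using contract_ladder[OF l(3) d, of "\<lambda>x. B (- n1) m2 x" "\<lambda>x. A m1 n2 x" for n1 n2] by simp
  finally show "ladder d j1 m1 * ?f (m1 - d) m2 m3 + ladder d j2 m2 * ?f m1 (m2 - d) m3 + ladder d j3 m3 * ?f m1 m2 (m3 - d) = 0"
    by simp
qed

text \<open>The sum is a triangle whose third outer leg has spin \<open>0\<close>, hence a multiple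
  of the 3j-symbol of \<open>j\<close>, \<open>j'\<close>, \<open>0\<close>. This symbol enforces
  equal spins and opposite magnetic numbers, and the remaining constant comes from
  \<open>threej_top_norm\<close>.\<close>

lemma threej_orthogonal:
  assumes s: "spin j1" "spin j2" "spin j" "spin j'"
  shows "(\<Sum>m1\<in>mags j1. \<Sum>m2\<in>mags j2. threej j1 j2 j m1 m2 m * threej j1 j2 j' m1 m2 m')
    = (if j = j' \<and> m = m' \<and> m \<in> mags j \<and> triad j1 j2 j then 1 / (2 * j + 1) else 0)"
    (is "?H m m' = _")
proof (cases "triad j1 j2 j \<and> triad j1 j2 j'")
  case False
  then have z: "threej j1 j2 j m1 m2 m * threej j1 j2 j' m1 m2 m' = 0" for m1 m2
    using threej_nonzeroD(1)[of j1 j2 j m1 m2 m] threej_nonzeroD(1)[of j1 j2 j' m1 m2 m'] s by auto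
  show ?thesis using False unfolding z by auto
next
  case t: True
  let ?r = "sqrt (2 * j1 + 1)"
  let ?f = "\<lambda>m m' m0 n1 n2 n3. sign_int (j1 + n1) * sign_int (j1 + n2) * sign_int (j2 + n3)
    * (threej j j1 j2 m n2 (- n3) * threej j1 j' j2 (- n1) m' n3 * threej j1 j1 0 n1 (- n2) m0)"
  have r: "0 < ?r" using spin_nonneg[OF s(1)] by simp
  obtain c where c: "\<forall>m m' m0. (\<Sum>n1\<in>mags j1. \<Sum>n2\<in>mags j1. \<Sum>n3\<in>mags j2. ?f m m' m0 n1 n2 n3) = c * threej j j' 0 m m' m0"
    using invariant3_proportional[OF s(3,4) spin_0 triangle_invariant3[OF s(1,1,2) threej_invariant3[OF s(3,1,2)]
      threej_invariant3[OF s(1,4,2)] threej_invariant3[OF s(1,1) spin_0]]] ..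
  have H: "?H m m' = sign_int (j1 + j2 + m) * ?r * c * threej j j' 0 m (- m') 0" for m m'
  proof -
    have off: "threej j1 j1 0 n1 (- n2) 0 = 0" if "n2 \<noteq> n1" for n1 n2
      using that threej_nonzeroD(5)[OF _ spin_0, of j1 j1 n1 "- n2" 0] by auto
    \<comment> \<open>The zero column forces \<open>n1 = n2\<close>, which collapses one of the
      three inner sums.\<close>
    have "c * threej j j' 0 m (- m') 0 = (\<Sum>n1\<in>mags j1. \<Sum>n2\<in>{n1}. \<Sum>n3\<in>mags j2. ?f m (- m') 0 n1 n2 n3)"
      unfolding c[rule_format, symmetric]
      by (intro sum.cong refl sum.mono_neutral_right) (auto simp: off)
    also have "\<dots> = (\<Sum>n1\<in>mags j1. \<Sum>n3\<in>mags j2. ?f m (- m') 0 n1 n1 (- n3))"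
      by (subst sum_mags_uminus[OF s(2)]) simp
    also have "\<dots> = (\<Sum>n1\<in>mags j1. \<Sum>n3\<in>mags j2. sign_int (j1 + j2 + m) / ?r
      * (threej j1 j2 j n1 n3 m * threej j1 j2 j' n1 n3 m'))"
    proof (intro sum.cong refl)
      fix n1 n3 assume n: "n1 \<in> mags j1" "n3 \<in> mags j2"
      have A: "threej j j1 j2 m n1 n3 = threej j1 j2 j n1 n3 m"
        using threej_swap12[OF s(1,3,2), of m n1 n3] threej_swap23[OF s(1,2,3), of n1 m n3] by (simp add: add_ac)
      have B: "threej j1 j' j2 (- n1) (- m') (- n3) = threej j1 j2 j' n1 n3 m'"
        using threej_swap23[OF s(1,2,4), of "- n1" "- m'" "- n3"] threej_negate[OF s(1,2,4), of n1 n3 m'] by simp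
      show "?f m (- m') 0 n1 n1 (- n3) = sign_int (j1 + j2 + m) / ?r * (threej j1 j2 j n1 n3 m * threej j1 j2 j' n1 n3 m')"
      proof (cases "n1 + n3 + m = 0")
        case True
        then have e: "j1 + j2 + m = (j1 - n1) + (j2 - n3)" by simp
        show ?thesis
          unfolding e sign_int_add[OF mags_diff_Ints[OF n(1)]] threej_0[OF s(1) n(1)] minus_minus A B by simp
      next
        case False
        then have "threej j1 j2 j n1 n3 m = 0" using threej_nonzeroD(5) s(3) by blast
        then show ?thesis by (simp add: A)
      qed
    qed
    finally have "c * threej j j' 0 m (- m') 0 = sign_int (j1 + j2 + m) / ?r * ?H m m'"
      by (simp only: sum_distrib_left)
    then show ?thesis using r unfolding mult.assoc by simp
  qed
  show ?thesis
  proof (cases "j = j' \<and> m = m' \<and> m \<in> mags j")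
    case False
    have "threej j j' 0 m (- m') 0 = 0"
    proof (rule ccontr)
      assume T: "threej j j' 0 m (- m') 0 \<noteq> 0"
      have "triad j j' 0" "m \<in> mags j" "m + - m' + 0 = 0" using threej_nonzeroD(1,2,5)[OF T spin_0] by auto
      then show False using False by (auto simp: triad_def)
    qed
    then show ?thesis using False unfolding H by auto
  next
    case True
    then have e: "j' = j" "m' = m" and m: "m \<in> mags j" by auto
    \<comment> \<open>The signs that depend on \<open>m\<close> combine into the constant exponent
      \<open>j1 + j2 + j\<close>. So the diagonal value is the same for all \<open>m\<close> and can
      be read off at \<open>m = - j\<close>.\<close>
    define K where "K = sign_int (j1 + j2 + j) * ?r * c / sqrt (2 * j + 1)"
    have val: "?H m m = K" if m: "m \<in> mags j" for m
    proof -
      have "sign_int (j1 + j2 + m) * sign_int (j - m) = sign_int (j1 + j2 + m + (j - m))"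
        by (rule sign_int_add'[OF mags_diff_Ints[OF m], symmetric])
      also have "\<dots> = sign_int (j1 + j2 + j)" by (rule arg_cong) simp
      finally show ?thesis
        using H[of m m] unfolding e(1) threej_0[OF s(3) m] K_def by (simp add: mult_ac)
    qed
    have "?H (- j) (- j) = 1 / (2 * j + 1)"
      using threej_top_norm[OF s(1,2,3)] t by (simp add: e power2_eq_square)
    then have "?H m m = 1 / (2 * j + 1)"
      using val[OF m] val[of "- j"] s by simp
    then show ?thesis using t m by (simp add: e)
  qed
qed

section \<open>6j-symbols\<close>

lemma card_mags:
  assumes "spin j"
  shows "real (card (mags j)) = 2 * j + 1"
proof -
  obtain n where n: "2 * j = real n" using assms by (auto simp: spin_def elim: Nats_cases)
  have "mags j = (\<lambda>i. j - real i) ` {..n}"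
  proof
    show "mags j \<subseteq> (\<lambda>i. j - real i) ` {..n}"
    proof
      fix m assume m: "m \<in> mags j"
      then have "j - m \<in> \<int>" "0 \<le> j - m" by (auto simp: mags_def)
      then obtain i where i: "j - m = real i"
        by (metis Ints_cases of_int_0_le_iff of_int_of_nat_eq zero_le_imp_eq_int)
      then have "real i \<le> real n" using m n by (auto simp: mags_def)
      then show "m \<in> (\<lambda>i. j - real i) ` {..n}" using i by (intro image_eqI[of _ _ i]) auto
    qed
    show "(\<lambda>i. j - real i) ` {..n} \<subseteq> mags j"
      using n by (auto simp: mags_def)
  qed
  then have "card (mags j) = Suc n" by (simp add: card_image inj_on_def)
  then show ?thesis using n by simp
qed

text \<open>Each of the \<open>2 * j3 + 1\<close> values of \<open>m3\<close> contributes equally.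
  This normalization turns the factor in Schur's lemma into a full contraction with the
  3j-symbol.\<close>

lemma threej_norm:
  assumes s: "spin j1" "spin j2" "spin j3" and t: "triad j1 j2 j3"
  shows "(\<Sum>m1\<in>mags j1. \<Sum>m2\<in>mags j2. \<Sum>m3\<in>mags j3. (threej j1 j2 j3 m1 m2 m3)\<^sup>2) = 1"
proof -
  let ?f = "\<lambda>m1 m2 m3. (threej j1 j2 j3 m1 m2 m3)\<^sup>2"
  have "(\<Sum>m1\<in>mags j1. \<Sum>m2\<in>mags j2. \<Sum>m3\<in>mags j3. ?f m1 m2 m3)
    = (\<Sum>m1\<in>mags j1. \<Sum>m3\<in>mags j3. \<Sum>m2\<in>mags j2. ?f m1 m2 m3)"
    by (intro sum.cong refl sum.swap)
  also have "\<dots> = (\<Sum>m3\<in>mags j3. \<Sum>m1\<in>mags j1. \<Sum>m2\<in>mags j2. ?f m1 m2 m3)"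
    by (rule sum.swap)
  also have "\<dots> = (\<Sum>m3\<in>mags j3. 1 / (2 * j3 + 1))"
    using threej_orthogonal[OF s s(3)] t by (intro sum.cong refl) (simp add: power2_eq_square)
  also have "\<dots> = 1"
    using card_mags[OF s(3)] spin_nonneg[OF s(3)] by simp
  finally show ?thesis .
qed

lemma sign_int_add3:
  assumes "spin l1" "spin l2" "spin l3" "n1 \<in> mags l1" "n2 \<in> mags l2" "n3 \<in> mags l3"
  shows "sign_int (l1 + n1 + l2 + n2 + l3 + n3) = sign_int (l1 + n1) * sign_int (l2 + n2) * sign_int (l3 + n3)"
proof -
  have "l1 + n1 + l2 + n2 + l3 + n3 = (l1 + n1) + (l2 + n2) + (l3 + n3)" by simp
  then show ?thesis
    using mags_add_Ints[OF assms(2,5)] mags_add_Ints[OF assms(3,6)] by (simp only: sign_int_add')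
qed

text \<open>The triangle is an invariant, hence a multiple of the 3j-symbol; contracting both with the
  3j-symbol identifies the factor as the defining sum of the 6j-symbol.\<close>

lemma threej_triangle:
  assumes j: "spin j1" "spin j2" "spin j3" and l: "spin l1" "spin l2" "spin l3"
  shows "(\<Sum>n1\<in>mags l1. \<Sum>n2\<in>mags l2. \<Sum>n3\<in>mags l3.
      sign_int (l1 + n1) * sign_int (l2 + n2) * sign_int (l3 + n3)
      * (threej j1 l2 l3 m1 n2 (- n3) * threej l1 j2 l3 (- n1) m2 n3 * threej l1 l2 j3 n1 (- n2) m3))
    = sixj j1 j2 j3 l1 l2 l3 * threej j1 j2 j3 m1 m2 m3" (is "?f m1 m2 m3 = _")
proof -
  obtain c where c: "?f m1 m2 m3 = c * threej j1 j2 j3 m1 m2 m3" for m1 m2 m3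
  proof -
    have "invariant3 j1 j2 j3 ?f"
      by (intro triangle_invariant3 threej_invariant3 j l)
    from invariant3_proportional[OF j this] obtain c
      where "\<forall>m1 m2 m3. ?f m1 m2 m3 = c * threej j1 j2 j3 m1 m2 m3" ..
    then show ?thesis by (intro that[of c]) blast
  qed
  show ?thesis
  proof (cases "triad j1 j2 j3")
    case False
    then have "threej j1 j2 j3 m1 m2 m3 = 0" by (simp add: threej_def cg_def)
    then show ?thesis using c by simp
  next
    case True
    have "sixj j1 j2 j3 l1 l2 l3 = (\<Sum>m1\<in>mags j1. \<Sum>m2\<in>mags j2. \<Sum>m3\<in>mags j3.
      threej j1 j2 j3 m1 m2 m3 * ?f m1 m2 m3)"
      unfolding sixj_def sum_distrib_left
      by (intro sum.cong refl) (simp add: sign_int_add3 l mult_ac)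
    also have "\<dots> = c * (\<Sum>m1\<in>mags j1. \<Sum>m2\<in>mags j2. \<Sum>m3\<in>mags j3. (threej j1 j2 j3 m1 m2 m3)\<^sup>2)"
      unfolding c by (simp add: sum_distrib_left power2_eq_square mult_ac)
    also have "\<dots> = c" using threej_norm[OF j True] by simp
    finally show ?thesis using c by simp
  qed
qed

lemma threej_not_triad: "\<not> triad j1 j2 j3 \<Longrightarrow> threej j1 j2 j3 m1 m2 m3 = 0"
  by (simp add: threej_def cg_def)

text \<open>Used to settle phases: if the symbol vanishes the identity at hand is trivial, and
  otherwise its triads supply the integrality that \<open>sign_int\<close> requires.\<close>

lemma sixj_nonzeroD:
  assumes "sixj j1 j2 j3 l1 l2 l3 \<noteq> 0"
  shows "triad j1 j2 j3" "triad j1 l2 l3" "triad l1 j2 l3" "triad l1 l2 j3"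
proof -
  have "sixj j1 j2 j3 l1 l2 l3 = 0"
    if "\<not> (triad j1 j2 j3 \<and> triad j1 l2 l3 \<and> triad l1 j2 l3 \<and> triad l1 l2 j3)"
    using that unfolding sixj_def by (intro sum.neutral ballI) (auto simp: threej_not_triad)
  with assms show "triad j1 j2 j3" "triad j1 l2 l3" "triad l1 j2 l3" "triad l1 l2 j3" by blast+
qed

section \<open>Tetrahedral symmetries of the 6j-symbol\<close>

text \<open>The summand takes all six magnetic numbers as one tuple, so that a symmetry is a single
  bijection of the index set.\<close>

definition sixj_term where
  "sixj_term j1 j2 j3 l1 l2 l3 = (\<lambda>(m1, m2, m3, n1, n2, n3).
      sign_int (l1 + n1 + l2 + n2 + l3 + n3)
      * threej j1 j2 j3 m1 m2 m3
      * threej j1 l2 l3 m1 n2 (- n3)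
      * threej l1 j2 l3 (- n1) m2 n3
      * threej l1 l2 j3 n1 (- n2) m3)"

lemma sixj_eq_sum_sixj_term:
  "sixj j1 j2 j3 l1 l2 l3
    = sum (sixj_term j1 j2 j3 l1 l2 l3) (mags j1 \<times> mags j2 \<times> mags j3 \<times> mags l1 \<times> mags l2 \<times> mags l3)"
  by (simp add: sixj_def sixj_term_def sum.cartesian_product split_def)

text \<open>Two columns are exchanged in each of the four 3j-symbols. The resulting four triad signs
  are compensated by reversing the magnetic numbers of the lower row.\<close>

lemma sixj_swap12:
  assumes s: "spin j1" "spin j2" "spin j3" "spin l1" "spin l2" "spin l3"
  shows "sixj j2 j1 j3 l2 l1 l3 = sixj j1 j2 j3 l1 l2 l3"
proof (cases "triad j1 j2 j3 \<and> triad j1 l2 l3 \<and> triad l1 j2 l3 \<and> triad l1 l2 j3")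
  case False
  then have "sixj j2 j1 j3 l2 l1 l3 = 0" "sixj j1 j2 j3 l1 l2 l3 = 0"
    using sixj_nonzeroD[of j2 j1 j3 l2 l1 l3] sixj_nonzeroD[of j1 j2 j3 l1 l2 l3]
    by (auto simp: triad_swap12)
  then show ?thesis by simp
next
  case True
  then have i: "j1 + j2 + j3 \<in> \<int>" "j1 + l2 + l3 \<in> \<int>" "l1 + j2 + l3 \<in> \<int>" "l1 + l2 + j3 \<in> \<int>"
    by (auto simp: triad_def)
  show ?thesis
    unfolding sixj_eq_sum_sixj_term
  proof (rule sum.reindex_bij_witness[of _
      "\<lambda>(m1, m2, m3, n1, n2, n3). (m2, m1, m3, - n2, - n1, - n3)"
      "\<lambda>(m1, m2, m3, n1, n2, n3). (m2, m1, m3, - n2, - n1, - n3)"])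
    fix p assume "p \<in> mags j2 \<times> mags j1 \<times> mags j3 \<times> mags l2 \<times> mags l1 \<times> mags l3"
    then obtain m1 m2 m3 n1 n2 n3 where p: "p = (m1, m2, m3, n1, n2, n3)"
      and n: "n1 \<in> mags l2" "n2 \<in> mags l1" "n3 \<in> mags l3" by auto
    have k: "- (l2 + n1) - (l1 + n2) - (l3 + n3) - (j1 + j2 + j3) \<in> \<int>"
      using mags_add_Ints[OF s(5) n(1)] mags_add_Ints[OF s(4) n(2)] mags_add_Ints[OF s(6) n(3)] i
      by (intro Ints_diff Ints_minus)
    have "sign_int (l1 + - n2 + l2 + - n1 + l3 + - n3)
      = sign_int (l2 + n1 + l1 + n2 + l3 + n3 + (j1 + j2 + j3) + (l1 + j2 + l3) + (j1 + l2 + l3) + (l1 + l2 + j3))"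
      by (rule sign_int_eqI[OF k]) simp
    also have "\<dots> = sign_int (l2 + n1 + l1 + n2 + l3 + n3) * sign_int (j1 + j2 + j3) * sign_int (l1 + j2 + l3)
      * sign_int (j1 + l2 + l3) * sign_int (l1 + l2 + j3)"
      using i by (simp only: sign_int_add')
    finally show "sixj_term j1 j2 j3 l1 l2 l3 (case p of (m1, m2, m3, n1, n2, n3) \<Rightarrow> (m2, m1, m3, - n2, - n1, - n3))
      = sixj_term j2 j1 j3 l2 l1 l3 p"
      unfolding p using threej_swap12[OF s(1,2,3), of m1 m2 m3] threej_swap12[OF s(4,2,6), of m1 n2 "- n3"]
        threej_swap12[OF s(1,5,6), of "- n1" m2 n3] threej_swap12[OF s(4,5,3), of n1 "- n2" m3]
      by (simp add: sixj_term_def mult_ac)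
  qed (use s in auto)
qed

lemma sixj_swap23:
  assumes s: "spin j1" "spin j2" "spin j3" "spin l1" "spin l2" "spin l3"
  shows "sixj j1 j3 j2 l1 l3 l2 = sixj j1 j2 j3 l1 l2 l3"
proof (cases "triad j1 j2 j3 \<and> triad j1 l2 l3 \<and> triad l1 j2 l3 \<and> triad l1 l2 j3")
  case False
  then have "sixj j1 j3 j2 l1 l3 l2 = 0" "sixj j1 j2 j3 l1 l2 l3 = 0"
    using sixj_nonzeroD[of j1 j3 j2 l1 l3 l2] sixj_nonzeroD[of j1 j2 j3 l1 l2 l3]
    by (auto simp: triad_swap23)
  then show ?thesis by simp
next
  case True
  then have i: "j1 + j2 + j3 \<in> \<int>" "j1 + l2 + l3 \<in> \<int>" "l1 + j2 + l3 \<in> \<int>" "l1 + l2 + j3 \<in> \<int>"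
    by (auto simp: triad_def)
  show ?thesis
    unfolding sixj_eq_sum_sixj_term
  proof (rule sum.reindex_bij_witness[of _
      "\<lambda>(m1, m2, m3, n1, n2, n3). (m1, m3, m2, - n1, - n3, - n2)"
      "\<lambda>(m1, m2, m3, n1, n2, n3). (m1, m3, m2, - n1, - n3, - n2)"])
    fix p assume "p \<in> mags j1 \<times> mags j3 \<times> mags j2 \<times> mags l1 \<times> mags l3 \<times> mags l2"
    then obtain m1 m2 m3 n1 n2 n3 where p: "p = (m1, m2, m3, n1, n2, n3)"
      and n: "n1 \<in> mags l1" "n2 \<in> mags l3" "n3 \<in> mags l2" by auto
    have k: "- (l1 + n1) - (l3 + n2) - (l2 + n3) - (j1 + j2 + j3) \<in> \<int>"
      using mags_add_Ints[OF s(4) n(1)] mags_add_Ints[OF s(6) n(2)] mags_add_Ints[OF s(5) n(3)] i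
      by (intro Ints_diff Ints_minus)
    have "sign_int (l1 + - n1 + l2 + - n3 + l3 + - n2)
      = sign_int (l1 + n1 + l3 + n2 + l2 + n3 + (j1 + j2 + j3) + (j1 + l2 + l3) + (l1 + l2 + j3) + (l1 + j2 + l3))"
      by (rule sign_int_eqI[OF k]) simp
    also have "\<dots> = sign_int (l1 + n1 + l3 + n2 + l2 + n3) * sign_int (j1 + j2 + j3) * sign_int (j1 + l2 + l3)
      * sign_int (l1 + l2 + j3) * sign_int (l1 + j2 + l3)"
      using i by (simp only: sign_int_add')
    finally show "sixj_term j1 j2 j3 l1 l2 l3 (case p of (m1, m2, m3, n1, n2, n3) \<Rightarrow> (m1, m3, m2, - n1, - n3, - n2))
      = sixj_term j1 j3 j2 l1 l3 l2 p"
      unfolding p using threej_swap23[OF s(1,2,3), of m1 m2 m3] threej_swap23[OF s(1,5,6), of m1 n2 "- n3"]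
        threej_swap23[OF s(4,5,3), of "- n1" m2 n3] threej_swap23[OF s(4,2,6), of n1 "- n2" m3]
      by (simp add: sixj_term_def mult_ac)
  qed (use s in auto)
qed

text \<open>The four triads are permuted among themselves, and two 3j-symbols reappear with reversed
  magnetic numbers. The signs match only if the magnetic numbers satisfy the sum rules, so the
  remaining summands are shown to vanish on both sides.\<close>

lemma sixj_upside12:
  assumes s: "spin j1" "spin j2" "spin j3" "spin l1" "spin l2" "spin l3"
  shows "sixj l1 l2 j3 j1 j2 l3 = sixj j1 j2 j3 l1 l2 l3"
proof (cases "triad j1 j2 j3 \<and> triad j1 l2 l3 \<and> triad l1 j2 l3 \<and> triad l1 l2 j3")
  case False
  then have "sixj l1 l2 j3 j1 j2 l3 = 0" "sixj j1 j2 j3 l1 l2 l3 = 0"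
    using sixj_nonzeroD[of l1 l2 j3 j1 j2 l3] sixj_nonzeroD[of j1 j2 j3 l1 l2 l3]
    by auto
  then show ?thesis by simp
next
  case True
  then have i: "j1 + j2 + j3 \<in> \<int>" "j1 + l2 + l3 \<in> \<int>" "l1 + j2 + l3 \<in> \<int>" "l1 + l2 + j3 \<in> \<int>"
    by (auto simp: triad_def)
  show ?thesis
    unfolding sixj_eq_sum_sixj_term
  proof (rule sum.reindex_bij_witness[of _
      "\<lambda>(n1, n2, m3, m1, m2, n3). (m1, - m2, m3, n1, - n2, n3)"
      "\<lambda>(m1, m2, m3, n1, n2, n3). (n1, - n2, m3, m1, - m2, n3)"])
    fix p assume "p \<in> mags l1 \<times> mags l2 \<times> mags j3 \<times> mags j1 \<times> mags j2 \<times> mags l3"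
    then obtain m1 m2 m3 n1 n2 n3 where p: "p = (m1, m2, m3, n1, n2, n3)"
      and n: "m2 \<in> mags l2" "n2 \<in> mags j2" by auto
    show "sixj_term j1 j2 j3 l1 l2 l3 (case p of (m1, m2, m3, n1, n2, n3) \<Rightarrow> (n1, - n2, m3, m1, - m2, n3))
      = sixj_term l1 l2 j3 j1 j2 l3 p"
    proof (cases "n1 = m2 + n3 \<and> m1 = n3 - n2")
      case True
      have k: "(l2 - m2) - (j2 + n2) - (j1 + l2 + l3) \<in> \<int>"
        by (rule Ints_diff[OF Ints_diff[OF mags_diff_Ints[OF n(1)] mags_add_Ints[OF s(2) n(2)]] i(2)])
      have "sign_int (l1 + m1 + l2 + - m2 + l3 + n3)
        = sign_int (j1 + n1 + j2 + n2 + l3 + n3 + (l1 + j2 + l3) + (j1 + l2 + l3))"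
        by (rule sign_int_eqI[OF k]) (use True in simp)
      also have "\<dots> = sign_int (j1 + n1 + j2 + n2 + l3 + n3) * sign_int (l1 + j2 + l3) * sign_int (j1 + l2 + l3)"
        using i by (simp only: sign_int_add')
      finally show ?thesis
        unfolding p using threej_negate[OF s(4,2,6), of "- m1" "- n2" n3]
          threej_negate[OF s(1,5,6), of n1 "- m2" "- n3"]
        by (simp add: sixj_term_def mult_ac)
    next
      case False
      then have "threej l1 j2 l3 m1 n2 (- n3) * threej j1 l2 l3 (- n1) m2 n3 = 0"
        using threej_nonzeroD(5)[OF _ s(6), of l1 j2 m1 n2 "- n3"] threej_nonzeroD(5)[OF _ s(6), of j1 l2 "- n1" m2 n3]
        by fastforce
      moreover from this have "threej l1 j2 l3 (- m1) (- n2) n3 * threej j1 l2 l3 n1 (- m2) (- n3) = 0"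
        using threej_negate[OF s(4,2,6), of m1 n2 "- n3"]
          threej_negate[OF s(1,5,6), of "- n1" m2 n3] by auto
      ultimately show ?thesis
        unfolding p by (auto simp: sixj_term_def)
    qed
  qed (use s in auto)
qed

section \<open>Matrix elements of vector operators\<close>

lemma threej_swap13:
  assumes s: "spin j1" "spin j2" "spin j3"
  shows "threej j3 j2 j1 m3 m2 m1 = sign_int (j1 + j2 + j3) * threej j1 j2 j3 m1 m2 m3"
  using threej_swap12[OF s(2,3,1), of m3 m2 m1] threej_swap23[OF s(2,1,3), of m2 m3 m1]
    threej_swap12[OF s, of m2 m1 m3]
  by (simp add: add_ac)

lemma cg_eq_threej:
  "spin j \<Longrightarrow> cg j1 m1 j2 m2 j m = sign_int (j1 - j2 + m) * sqrt (2 * j + 1) * threej j1 j2 j m1 m2 (- m)"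
  using spin_nonneg[of j] by (simp add: threej_def)

lemma cg_orthonormal:
  assumes s: "spin a" "spin j" "spin b" "spin b'"
  shows "(\<Sum>m\<in>mags a. \<Sum>x\<in>mags j. cg a m j x b M * cg a m j x b' M')
    = (if b = b' \<and> M = M' \<and> M \<in> mags b \<and> triad a j b then 1 else 0)"
proof -
  have "(\<Sum>m\<in>mags a. \<Sum>x\<in>mags j. cg a m j x b M * cg a m j x b' M')
    = sign_int (a - j + M) * sign_int (a - j + M') * sqrt (2 * b + 1) * sqrt (2 * b' + 1)
      * (\<Sum>m\<in>mags a. \<Sum>x\<in>mags j. threej a j b m x (- M) * threej a j b' m x (- M'))"
    unfolding cg_eq_threej[OF s(3)] cg_eq_threej[OF s(4)] sum_distrib_left
    by (intro sum.cong refl) (simp add: mult_ac)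
  then show ?thesis
    unfolding threej_orthogonal[OF s] using s spin_nonneg[OF s(3)] by (auto simp: mult.assoc)
qed

text \<open>\<open>(-1)\<^sup>a\<^sup>-\<^sup>m\<close> times the 3j-symbol: by the Wigner-Eckart theorem, the shape of the matrix elements
  \<open>\<langle>a m| V\<^sub>q |a' m'\<rangle>\<close> of the spherical components \<open>q = -1, 0, 1\<close> of every vector operator.\<close>

definition vec_elem where
  "vec_elem a a' m q m' = sign_int (a - m) * threej a 1 a' (- m) q m'"

text \<open>The reduced matrix element of an angular momentum of spin \<open>j\<close>;
  \<open>sph_elem_0\<close>, \<open>sph_elem_1\<close> and \<open>sph_elem_minus_1\<close> confirm
  the normalization.\<close>

definition red_elem where
  "red_elem j = sqrt (j * (j + 1) * (2 * j + 1))"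

definition sph_elem where
  "sph_elem j q x y = red_elem j * vec_elem j j x q y"

text \<open>Exchanging the outer columns and reversing the magnetic numbers produces the same triad
  sign twice. What remains is the rule that the adjoint of the component \<open>q\<close> is, up to
  sign, the component \<open>- q\<close>.\<close>

lemma vec_elem_adjoint:
  assumes s: "spin a" "spin a'"
  shows "vec_elem a a' m q m' = sign_int (a' - a) * sign_int q * vec_elem a' a m' (- q) m"
proof (cases "threej a 1 a' (- m) q m' = 0")
  case True
  then show ?thesis
    using threej_swap13[OF s(1) spin_1 s(2), of "- m'" "- q" m] threej_negate[OF s(1) spin_1 s(2), of "- m" q m']
    by (simp add: vec_elem_def)
next
  case False
  note nz = threej_nonzeroD[OF False s(2)]
  have m: "m \<in> mags a" using nz(2) s by simp
  have aa: "a + 1 + a' \<in> \<int>" using nz(1) by (simp add: triad_def)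
  have "(a + 1 + a') - 2 * a' - 1 \<in> \<int>" using aa spin_double_Ints[OF s(2)] by (intro Ints_diff Ints_1)
  then have i1: "a - a' \<in> \<int>" by simp
  have iq: "q \<in> \<int>" using nz(3) by (auto simp: mags_1)
  have k: "a - a' - q \<in> \<int>" using i1 iq by (rule Ints_diff)
  have "sign_int (a - m) = sign_int (a' - a + q + (a' - m'))"
    by (rule sign_int_eqI[OF k]) (use nz(5) in simp)
  also have "\<dots> = sign_int (a' - a) * sign_int q * sign_int (a' - m')"
    using iq mags_diff_Ints[OF nz(4)] by (simp only: sign_int_add')
  finally show ?thesis
    using threej_swap13[OF s(1) spin_1 s(2), of "- m'" "- q" m] threej_negate[OF s(1) spin_1 s(2), of "- m" q m']
    by (simp add: vec_elem_def mult_ac)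
qed

lemma sph_elem_adjoint: "spin j \<Longrightarrow> sph_elem j (- q) x y = sign_int q * sph_elem j q y x"
  using vec_elem_adjoint[of j j y q x] by (simp add: sph_elem_def mult_ac)

lemma vec_elem_not_triad: "\<not> triad a 1 a' \<Longrightarrow> vec_elem a a' m q m' = 0"
  by (simp add: vec_elem_def threej_not_triad)

text \<open>An operator on the first of two coupled factors: the two Clebsch-Gordan coefficients and
  the operator form a triangle with outer legs \<open>b\<close>, \<open>1\<close>, \<open>b'\<close>
  and inner lines \<open>a'\<close>, \<open>j\<close>, \<open>a\<close>.\<close>

lemma cg_vec_elem_first:
  assumes s: "spin a" "spin a'" "spin j" "spin b" "spin b'"
    and t: "triad a j b" "triad a' j b'"
  shows "(\<Sum>m'\<in>mags a'. \<Sum>x\<in>mags j. \<Sum>m\<in>mags a. cg a m j x b M * cg a' m' j x b' M' * vec_elem a a' m q m')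
    = sign_int (a + j + b' + 1) * sqrt (2 * b + 1) * sqrt (2 * b' + 1) * sixj b 1 b' a' j a * vec_elem b b' M q M'"
proof (cases "triad a 1 a'")
  case False
  moreover have "sixj b 1 b' a' j a = 0"
    using False sixj_nonzeroD(3)[of b 1 b' a' j a] triad_swap12 triad_swap23 by blast
  ultimately show ?thesis by (simp add: vec_elem_not_triad)
next
  case True
  have i: "a + j + b \<in> \<int>" "a' + j + b' \<in> \<int>" "a + 1 + a' \<in> \<int>"
    using t True by (auto simp: triad_def)
  let ?K = "sign_int (a + j + b' + 1) * sqrt (2 * b + 1) * sqrt (2 * b' + 1) * sign_int (b - M)"
  let ?t = "\<lambda>m' x m. sign_int (a' - m') * sign_int (j + x) * sign_int (a - m)
      * (threej b j a (- M) x m * threej a' 1 a m' q (- m) * threej a' j b' (- m') (- x) M')"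
  have "?K * (sixj b 1 b' a' j a * threej b 1 b' (- M) q M')
    = ?K * (\<Sum>m'\<in>mags a'. \<Sum>x\<in>mags j. \<Sum>m\<in>mags a. ?t m' x m)"
    unfolding threej_triangle[OF s(4) spin_1 s(5) s(2,3,1), symmetric]
    \<comment> \<open>Reflecting the sums over the lines \<open>a'\<close> and \<open>a\<close>
      brings the triangle's arguments into the form of the coefficients.\<close>
    by (subst sum_mags_uminus[OF s(2), symmetric], subst sum_mags_uminus[OF s(1), symmetric]) simp
  also have "\<dots> = (\<Sum>m'\<in>mags a'. \<Sum>x\<in>mags j. \<Sum>m\<in>mags a.
      cg a m j x b M * cg a' m' j x b' M' * vec_elem a a' m q m')"
    unfolding sum_distrib_left
  proof (intro sum.cong refl)
    fix m' x m assume m: "m' \<in> mags a'" "x \<in> mags j" "m \<in> mags a"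
    show "?K * ?t m' x m
      = cg a m j x b M * cg a' m' j x b' M' * vec_elem a a' m q m'"
    \<comment> \<open>The signs agree only where the magnetic numbers add up; elsewhere both sides
      vanish.\<close>
    proof (cases "M = m + x \<and> M' = m' + x")
      case False
      then have "threej b j a (- M) x m * threej a' j b' (- m') (- x) M' = 0"
        using threej_nonzeroD(5)[OF _ s(1), of b j "- M" x m] threej_nonzeroD(5)[OF _ s(5), of a' j "- m'" "- x" M']
        by fastforce
      moreover have "cg a m j x b M * cg a' m' j x b' M' = 0" using False by (auto simp: cg_def)
      ultimately show ?thesis by auto
    next
      case M: True
      have mi: "a + m \<in> \<int>" "a' + m' \<in> \<int>" "a' - m' \<in> \<int>" "j - x \<in> \<int>" "j + x \<in> \<int>"
        using m s mags_add_Ints mags_diff_Ints by blast+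
      have k: "- (a + j + b) - (a' + j + b') - (j - x) + (a + m) + (a' + m') - (a + 1 + a') \<in> \<int>"
        by (insert i mi, (assumption | rule Ints_diff Ints_add Ints_minus)+)
      have "(a + m) - (j - x) \<in> \<int>" "(a' + m') - (j - x) \<in> \<int>"
        using mi by (auto intro: Ints_diff)
      then have c: "a - j + M \<in> \<int>" "a' - j + M' \<in> \<int>" using M by (simp_all add: algebra_simps)
      have bm: "b - M \<in> \<int>"
      proof -
        have "(a + j + b) - (a + m) - (j + x) \<in> \<int>"
          by (insert i mi, (assumption | rule Ints_diff)+)
        then show ?thesis using M by (simp add: algebra_simps)
      qed
      have "sign_int (a - j + M) * sign_int (a' - j + M') = sign_int (a - j + M + (a' - j + M'))"
        using c by (simp only: sign_int_add')
      also have "\<dots> = sign_int ((a + j + b' + 1) + (b - M) + (a' - m') + (j + x) + (a + j + b) + (a + 1 + a') + (a' + j + b'))"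
        by (rule sign_int_eqI[OF k]) (use M in simp)
      also have "\<dots> = sign_int (a + j + b' + 1) * sign_int (b - M) * sign_int (a' - m') * sign_int (j + x)
          * sign_int (a + j + b) * sign_int (a + 1 + a') * sign_int (a' + j + b')"
        using i mi bm by (simp only: sign_int_add')
      finally have sg: "sign_int (a - j + M) * sign_int (a' - j + M') = \<dots>" .
      have th: "threej b j a (- M) x m = sign_int (a + j + b) * threej a j b m x (- M)"
        "threej a' 1 a m' q (- m) = sign_int (a + 1 + a') * threej a 1 a' (- m) q m'"
        "threej a' j b' (- m') (- x) M' = sign_int (a' + j + b') * threej a' j b' m' x (- M')"
        using threej_swap13[OF s(1,3,4), of "- M" x m] threej_swap13[OF s(1) spin_1 s(2), of m' q "- m"]
          threej_negate[OF s(2,3,5), of m' x "- M'"] by simp_all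
      have "cg a m j x b M * cg a' m' j x b' M' * vec_elem a a' m q m'
        = (sign_int (a - j + M) * sign_int (a' - j + M')) * (sqrt (2 * b + 1) * sqrt (2 * b' + 1) * sign_int (a - m)
          * (threej a j b m x (- M) * threej a 1 a' (- m) q m' * threej a' j b' m' x (- M')))"
        unfolding cg_eq_threej[OF s(4)] cg_eq_threej[OF s(5)] vec_elem_def by (simp add: mult_ac)
      also have "\<dots> = ?K * ?t m' x m"
        unfolding sg th by (simp only: mult_ac)
      finally show ?thesis by simp
    qed
  qed
  finally show ?thesis by (simp add: vec_elem_def mult_ac)
qed

lemma cg_swap:
  assumes s: "spin a" "spin j" "spin b" and t: "triad a j b"
  shows "cg a m j x b M = sign_int (a + j - b) * cg j x a m b M"
proof (cases "threej a j b m x (- M) = 0")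
  case True
  then show ?thesis
    using threej_swap12[OF s, of x m "- M"] by (simp add: cg_eq_threej s)
next
  case False
  note ti = triad_Ints[OF t s]
  have k: "- (2 * j) \<in> \<int>" using spin_double_Ints[OF s(2)] by (rule Ints_minus)
  have "sign_int (a - j + M) = sign_int ((j - a + M) + (a + j - b) + (a + j + b))"
    by (rule sign_int_eqI[OF k]) simp
  also have "\<dots> = sign_int (j - a + M) * sign_int (a + j - b) * sign_int (a + j + b)"
    using ti by (simp only: sign_int_add')
  finally show ?thesis
    using threej_swap12[OF s, of x m "- M"] by (simp add: cg_eq_threej s mult_ac)
qed

text \<open>The coupled factors are exchanged, which makes the operator act on the first one. The
  two exchange signs merge with the one of \<open>cg_vec_elem_first\<close>.\<close>

lemma cg_sph_elem_second:
  assumes s: "spin a" "spin j" "spin b" "spin b'" and t: "triad a j b" "triad a j b'"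
  shows "(\<Sum>y\<in>mags j. \<Sum>m\<in>mags a. \<Sum>x\<in>mags j. cg a m j x b M * cg a m j y b' M' * sph_elem j q x y)
    = red_elem j * sign_int (a + j + b + 1) * sqrt (2 * b + 1) * sqrt (2 * b' + 1) * sixj b 1 b' j a j * vec_elem b b' M q M'"
    (is "?lhs = _")
proof -
  have t': "triad j a b" "triad j a b'" using t triad_swap12 by blast+
  note ti = triad_Ints[OF t(1) s(1,2,3)] and ti' = triad_Ints[OF t(2) s(1,2,4)]
  have ji: "j + a + b' + 1 \<in> \<int>"
  proof -
    have "j + a + b' + 1 = (a + j + b') + 1" by simp
    then show ?thesis using ti'(1) by (metis Ints_1 Ints_add)
  qed
  have "?lhs = red_elem j * sign_int (a + j - b) * sign_int (a + j - b')
      * (\<Sum>y\<in>mags j. \<Sum>m\<in>mags a. \<Sum>x\<in>mags j. cg j x a m b M * cg j y a m b' M' * vec_elem j j x q y)"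
    unfolding cg_swap[OF s(1,2,3) t(1)] cg_swap[OF s(1,2,4) t(2)] sph_elem_def sum_distrib_left
    by (intro sum.cong refl) (simp add: mult_ac)
  also have "\<dots> = red_elem j * (sign_int (a + j - b) * sign_int (a + j - b') * sign_int (j + a + b' + 1))
      * sqrt (2 * b + 1) * sqrt (2 * b' + 1) * sixj b 1 b' j a j * vec_elem b b' M q M'"
    unfolding cg_vec_elem_first[OF s(2,2,1,3,4) t'] by (simp add: mult_ac)
  also have "sign_int (a + j - b) * sign_int (a + j - b') * sign_int (j + a + b' + 1)
      = sign_int ((a + j - b) + (a + j - b') + (j + a + b' + 1))"
    using ti' ji by (simp only: sign_int_add')
  also have "\<dots> = sign_int (a + j + b + 1)"
    by (rule sign_int_eqI[OF ti(2)]) simp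
  finally show ?thesis .
qed

text \<open>A scalar product of vector operators cannot change the total spin \<open>b\<close>, only
  the inner spin from \<open>a\<close> to \<open>a'\<close>. The sum is a triangle with inner lines
  \<open>j\<close>, \<open>a\<close>, \<open>1\<close> and outer legs \<open>a'\<close>,
  \<open>j\<close>, \<open>b\<close>, hence again a Clebsch-Gordan coefficient.\<close>

lemma cg_scalar_bra:
  assumes s: "spin a" "spin a'" "spin j" "spin b" and t: "triad a j b"
    and m': "m' \<in> mags a'" and y: "y \<in> mags j"
  shows "(\<Sum>x\<in>mags j. \<Sum>m\<in>mags a. \<Sum>q\<in>mags 1.
      sign_int q * cg a m j x b M * vec_elem a a' m q m' * sph_elem j (- q) x y)
    = red_elem j * sign_int (a' + j + b) * sixj a' j b j a 1 * cg a' m' j y b M"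
proof (cases "triad a 1 a'")
  case False
  moreover have "sixj a' j b j a 1 = 0"
    using False sixj_nonzeroD(2)[of a' j b j a 1] triad_swap12 triad_swap23 by blast
  ultimately show ?thesis by (simp add: vec_elem_not_triad)
next
  case True
  have i: "a + j + b \<in> \<int>" "a + 1 + a' \<in> \<int>"
    using t True by (auto simp: triad_def)
  have i': "a' + j + b \<in> \<int>"
  proof -
    have "(a + 1 + a') + (a + j + b) - 2 * a - 1 \<in> \<int>"
      by (insert i spin_double_Ints[OF s(1)] Ints_1[where 'a = real], (assumption | rule Ints_diff Ints_add)+)
    then show ?thesis by (simp add: algebra_simps)
  qed
  let ?K = "red_elem j * sign_int (a' + j + b) * (sign_int (a' - j + M) * sqrt (2 * b + 1))"
  let ?t = "\<lambda>x m q. sign_int (j + x) * sign_int (a - m) * sign_int (1 - q)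
      * (threej a' a 1 m' (- m) q * threej j j 1 (- x) y (- q) * threej j a b x m (- M))"
  have "?K * (sixj a' j b j a 1 * threej a' j b m' y (- M))
    = ?K * (\<Sum>x\<in>mags j. \<Sum>m\<in>mags a. \<Sum>q\<in>mags 1. ?t x m q)"
    unfolding threej_triangle[OF s(2,3,4) s(3,1) spin_1, symmetric]
    by (subst sum_mags_uminus[OF s(1), symmetric], subst sum_mags_uminus[OF spin_1, symmetric]) simp
  also have "\<dots> = (\<Sum>x\<in>mags j. \<Sum>m\<in>mags a. \<Sum>q\<in>mags 1.
      sign_int q * cg a m j x b M * vec_elem a a' m q m' * sph_elem j (- q) x y)"
    unfolding sum_distrib_left
  proof (intro sum.cong refl)
    fix x m q assume m: "x \<in> mags j" "m \<in> mags a" "q \<in> mags 1"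
    have th: "threej a' a 1 m' (- m) q = threej a 1 a' (- m) q m'"
        "threej j j 1 (- x) y (- q) = sign_int (j + 1 + j) * threej j 1 j (- x) (- q) y"
        "threej j a b x m (- M) = sign_int (a + j + b) * threej a j b m x (- M)"
      using threej_swap12[OF s(1,2) spin_1, of m' "- m" q] threej_swap23[OF s(1) spin_1 s(2), of "- m" m' q]
        threej_swap23[OF s(3) spin_1 s(3), of "- x" y "- q"] threej_swap12[OF s(1,3,4), of x m "- M"]
      by (simp_all add: add_ac)
    show "?K * ?t x m q
      = sign_int q * cg a m j x b M * vec_elem a a' m q m' * sph_elem j (- q) x y"
    proof (cases "M = m + x")
      case False
      then have "threej a j b m x (- M) = 0"
        using threej_nonzeroD(5)[OF _ s(4), of a j m x "- M"] by fastforce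
      then show ?thesis unfolding th cg_eq_threej[OF s(4)] by simp
    next
      case M: True
      have mi: "a + m \<in> \<int>" "j - x \<in> \<int>" "j + x \<in> \<int>" "q \<in> \<int>"
        using m s mags_add_Ints mags_diff_Ints by (auto simp: mags_1)
      have qi: "1 - q \<in> \<int>" using mi by simp
      have ji: "j + 1 + j \<in> \<int>" using spin_double_Ints[OF s(3)] Ints_add[OF _ Ints_1, of "2 * j"] by (simp add: add_ac)
      have k: "q - (a' + j + b) - (j + x) - 1 \<in> \<int>"
        by (insert i' mi Ints_1[where 'a = real], (assumption | rule Ints_diff)+)
      have c1: "a - j + M \<in> \<int>"
        using Ints_diff[OF mi(1,2)] M by (simp add: algebra_simps)
      have "sign_int q * sign_int (a - j + M) * sign_int (j - x) = sign_int (q + (a - j + M) + (j - x))"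
        using c1 mi by (simp only: sign_int_add')
      also have "\<dots> = sign_int ((a' - j + M) + (a' + j + b) + (j + x) + (1 - q) + (j + 1 + j) + (a + j + b))"
        by (rule sign_int_eqI[OF k]) (use M in simp)
      also have "\<dots> = sign_int (a' - j + M) * sign_int (a' + j + b) * sign_int (j + x) * sign_int (1 - q)
          * sign_int (j + 1 + j) * sign_int (a + j + b)"
        using i i' mi qi ji by (simp only: sign_int_add')
      finally have sg: "sign_int q * sign_int (a - j + M) * sign_int (j - x) = \<dots>" .
      have "sign_int q * cg a m j x b M * vec_elem a a' m q m' * sph_elem j (- q) x y
        = (sign_int q * sign_int (a - j + M) * sign_int (j - x)) * (sqrt (2 * b + 1) * sign_int (a - m) * red_elem j
          * (threej a j b m x (- M) * threej a 1 a' (- m) q m' * threej j 1 j (- x) (- q) y))"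
        unfolding cg_eq_threej[OF s(4)] vec_elem_def sph_elem_def by (simp add: mult_ac)
      also have "\<dots> = ?K * ?t x m q"
        unfolding sg th by (simp only: mult_ac)
      finally show ?thesis by simp
    qed
  qed
  finally show ?thesis by (simp add: cg_eq_threej s mult_ac)
qed

text \<open>The adjoint of \<open>cg_scalar_bra\<close>: the reversal signs of the two operators and
  of \<open>q\<close> cancel up to the sign of \<open>a' - a\<close>.\<close>

lemma cg_scalar_ket:
  assumes s: "spin a" "spin a'" "spin j" "spin b" and t: "triad a' j b"
    and m: "m \<in> mags a" and x: "x \<in> mags j"
  shows "(\<Sum>y\<in>mags j. \<Sum>m'\<in>mags a'. \<Sum>q\<in>mags 1.
      sign_int q * cg a' m' j y b M * vec_elem a a' m q m' * sph_elem j (- q) x y)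
    = red_elem j * sign_int (a' + j + b) * sixj a j b j a' 1 * cg a m j x b M"
    (is "?lhs = ?rhs")
proof -
  have si: "sign_int (- q) = sign_int q" if "q \<in> mags 1" for q
    using that by (intro sign_int_uminus) (auto simp: mags_1)
  have "?lhs = (\<Sum>y\<in>mags j. \<Sum>m'\<in>mags a'. \<Sum>q\<in>mags 1.
      sign_int (- q) * cg a' m' j y b M * vec_elem a a' m (- q) m' * sph_elem j q x y)"
    by (subst sum_mags_uminus[OF spin_1, symmetric]) simp
  also have "\<dots> = sign_int (a' - a) * (\<Sum>y\<in>mags j. \<Sum>m'\<in>mags a'. \<Sum>q\<in>mags 1.
      sign_int q * cg a' m' j y b M * vec_elem a' a m' q m * sph_elem j (- q) y x)"
    unfolding sum_distrib_left
  proof (intro sum.cong refl)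
    fix y m' q :: real assume "q \<in> mags 1"
    then show "sign_int (- q) * cg a' m' j y b M * vec_elem a a' m (- q) m' * sph_elem j q x y
      = sign_int (a' - a) * (sign_int q * cg a' m' j y b M * vec_elem a' a m' q m * sph_elem j (- q) y x)"
      using vec_elem_adjoint[OF s(1,2), of m "- q" m'] sph_elem_adjoint[OF s(3), of q y x] si[of q]
      by (simp add: mult_ac)
  qed
  also have "\<dots> = red_elem j * (sign_int (a' - a) * sign_int (a + j + b)) * sixj a j b j a' 1 * cg a m j x b M"
    unfolding cg_scalar_bra[OF s(2,1,3,4) t m x] by (simp add: mult_ac)
  also have "\<dots> = ?rhs"
  \<comment> \<open>The sign of \<open>a' - a\<close> can be merged only when
    \<open>a + j + b\<close> is an integer, which a nonvanishing symbol guarantees.\<close>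
  proof (cases "sixj a j b j a' 1 = 0")
    case False
    then have "a + j + b \<in> \<int>" using sixj_nonzeroD(1)[OF False] by (simp add: triad_def)
    then have "sign_int (a' - a + (a + j + b)) = sign_int (a' - a) * sign_int (a + j + b)"
      by (rule sign_int_add')
    moreover have "a' - a + (a + j + b) = a' + j + b" by simp
    ultimately show ?thesis by simp
  qed simp
  finally show ?thesis .
qed

section \<open>One-site operators\<close>

lemma spin_pos:
  assumes "spin j" "0 < j"
  shows "1 \<le> 2 * j" "triad j 1 j"
proof -
  obtain n where "2 * j = real n" using assms by (auto simp: spin_def elim: Nats_cases)
  then show j: "1 \<le> 2 * j" using assms(2) by (cases n) auto
  have "2 * j + 1 \<in> \<int>" using spin_double_Ints[OF assms(1)] by simp
  then have "j + 1 + j \<in> \<int>" by (simp add: algebra_simps)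
  then show "triad j 1 j" using j by (auto simp: triad_def)
qed

text \<open>The triangle coefficient is the root of \<open>(2j-1)! / (2j+2)!\<close>, whose
  reciprocal is \<open>4 j (j+1) (2j+1)\<close>; the reduced matrix element cancels it up to a
  half.\<close>

lemma red_elem_tri_weight:
  assumes "spin j" "0 < j"
  shows "red_elem j * tri_weight j 1 j = 1 / 2"
proof -
  note j = spin_pos(1)[OF assms]
  have i: "2 * j \<in> \<int>" by (rule spin_double_Ints[OF assms(1)])
  have r1: "rfact (2 * j) = 2 * j * rfact (2 * j - 1)"
    using rfact_Suc[of "2 * j - 1"] i j by simp
  have r2: "rfact (2 * j + 1) = (2 * j + 1) * rfact (2 * j)"
    using rfact_Suc[of "2 * j"] i j by simp
  have "rfact (2 * j + 1 + 1) = (2 * j + 1 + 1) * rfact (2 * j + 1)"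
    using i j by (intro rfact_Suc) auto
  then have r3: "rfact (2 * j + 2) = (2 * j + 2) * ((2 * j + 1) * (2 * j * rfact (2 * j - 1)))"
    unfolding r2 r1 by (simp add: add.assoc)
  have e: "j + 1 - j = 1" "j - 1 + j = 2 * j - 1" "- j + 1 + j = 1" "j + 1 + j + 1 = 2 * j + 2"
    by simp_all
  have "red_elem j * tri_weight j 1 j
    = sqrt (j * (j + 1) * (2 * j + 1) * (rfact (2 * j - 1) / ((2 * j + 2) * ((2 * j + 1) * (2 * j * rfact (2 * j - 1))))))"
    unfolding red_elem_def tri_weight_def e r3 by (simp flip: real_sqrt_mult)
  also have "j * (j + 1) * (2 * j + 1) * (rfact (2 * j - 1) / ((2 * j + 2) * ((2 * j + 1) * (2 * j * rfact (2 * j - 1))))) = 1 / 4"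
  proof -
    have "j * (j + 1) * (2 * j + 1) * (F / ((2 * j + 2) * ((2 * j + 1) * (2 * j * F)))) = 1 / 4"
      if "F \<noteq> 0" for F
    proof -
      have "(2 * j + 2) * ((2 * j + 1) * (2 * j * F)) = 4 * (j * (j + 1) * (2 * j + 1) * F)"
        by (simp add: algebra_simps)
      moreover have "j * (j + 1) * (2 * j + 1) * F \<noteq> 0" using that assms(2) by auto
      ultimately show ?thesis by (simp add: field_simps)
    qed
    from this[OF rfact_nonzero] show ?thesis .
  qed
  finally show ?thesis by (simp add: real_sqrt_divide)
qed

text \<open>For the triad \<open>j 1 j\<close> the parameter \<open>A\<close> is \<open>1\<close>,
  so that only \<open>k = 0\<close> and \<open>k = 1\<close> remain in Racah's sum.\<close>

lemma sph_elem_racah: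
  assumes j: "spin j" "0 < j" and m: "x \<in> mags j" "y \<in> mags j" "q \<in> mags 1" "x = q + y"
  shows "sph_elem j q x y = 1 / 2 * (sign_int (j - x) * sign_int (j - 1 - y))
    * (mag_weight j x * mag_weight 1 q * mag_weight j y) * racah 1 (2 * j - 1) 1 (j + x) (1 + q)"
proof -
  note t = spin_pos(2)[OF j]
  have e: "j + 1 - j = 1" "j - 1 + j = 2 * j - 1" "- j + 1 + j = 1" "j - - x = j + x" by simp_all
  have mx: "- x \<in> mags j" "- x + q + y = 0" using mags_minus[OF j(1) m(1)] m(4) by simp_all
  have "sph_elem j q x y = red_elem j * tri_weight j 1 j * (sign_int (j - x) * sign_int (j - 1 - y))
    * (mag_weight j x * mag_weight 1 q * mag_weight j y) * racah 1 (2 * j - 1) 1 (j + x) (1 + q)"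
    using threej_racah[OF t j(1) spin_1 j(1) mx(1) m(3,2) mx(2)] unfolding e mag_weight_minus
    by (simp only: sph_elem_def vec_elem_def mult_ac)
  then show ?thesis using red_elem_tri_weight[OF j] by simp
qed

lemma sign_int_1: "sign_int 1 = - 1"
  by (simp add: sign_int_def)

lemma sign_int_neg_1: "sign_int (- 1) = - 1"
  using sign_int_uminus[of 1] by (simp add: sign_int_1)

lemma rinv_0: "rinv 0 = 1" and rinv_1: "rinv 1 = 1"
  by (simp_all add: rinv_def)

lemma racah_1: "racah 1 B C u v = racah_term 1 B C u v 0 + racah_term 1 B C u v 1"
proof -
  have "{0..1::int} = {0, 1}" by auto
  then show ?thesis by (simp add: racah_def)
qed

lemma sph_elem_0:
  assumes j: "spin j" and m: "x \<in> mags j" "y \<in> mags j"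
  shows "sph_elem j 0 x y = (if x = y then x else 0)"
proof (cases "x = y")
  case False
  then show ?thesis
    using threej_nonzeroD(5)[OF _ j, of j 1 "- x" 0 y] by (auto simp: sph_elem_def vec_elem_def)
next
  case True
  show ?thesis
  \<comment> \<open>For \<open>j = 0\<close> the triad \<open>j 1 j\<close> fails; there both sides
    are zero because the reduced matrix element is.\<close>
  proof (cases "j = 0")
    case j0: True
    then show ?thesis using m True by (simp add: sph_elem_def red_elem_def)
  next
    case False
    then have j0: "0 < j" using spin_nonneg[OF j] by simp
    have i: "j + x \<in> \<int>" "j - x \<in> \<int>" "0 \<le> j + x" "0 \<le> j - x"
      using mags_add_Ints[OF j m(1)] mags_diff_Ints[OF m(1)] m(1) by (simp_all add: mags_def)
    have a: "2 * j - 1 - (j + x) + 0 = j - x - 1" "2 * j - 1 - (j + x) + 1 = j - x" by simp_all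
    have "racah 1 (2 * j - 1) 1 (j + x) (1 + 0) = rinv (j + x) * rinv (j - x - 1) - rinv (j + x - 1) * rinv (j - x)"
      unfolding racah_1 racah_term_def a by (simp add: rinv_0 rinv_1 sign_int_1)
    also have "\<dots> = - 2 * x * (rinv (j + x) * rinv (j - x))"
      unfolding rinv_rec[OF i(1), symmetric] rinv_rec[OF i(2), symmetric] by (simp add: algebra_simps)
    also have "\<dots> = - 2 * x / (rfact (j + x) * rfact (j - x))"
      using i by (simp add: rinv_nonneg)
    finally have r: "racah 1 (2 * j - 1) 1 (j + x) (1 + 0) = \<dots>" .
    have w: "mag_weight j x * mag_weight 1 0 * mag_weight j x = rfact (j + x) * rfact (j - x)"
      by (simp add: mag_weight_def less_imp_le)
    have sg: "sign_int (j - x) * sign_int (j - 1 - x) = - 1"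
      using sign_int_minus_1[of "j - x"] by (simp add: algebra_simps)
    have "sph_elem j 0 x x = 1 / 2 * (- 1) * (rfact (j + x) * rfact (j - x)) * (- 2 * x / (rfact (j + x) * rfact (j - x)))"
      using sph_elem_racah[OF j j0 m(1) m(1), of 0] unfolding r w sg by (simp add: mags_1)
    then show ?thesis using True by simp
  qed
qed

text \<open>Of the two Racah terms only \<open>k = 1\<close> survives. The factor
  \<open>- 1 / sqrt 2\<close> is the standard normalization of the component \<open>q = 1\<close>
  relative to the raising operator.\<close>

lemma sph_elem_1:
  assumes j: "spin j" and m: "x \<in> mags j" "y \<in> mags j"
  shows "sph_elem j 1 x y = (if x = y + 1 then - ladder 1 j x / sqrt 2 else 0)"
proof (cases "x = y + 1")
  case False
  then show ?thesis
    using threej_nonzeroD(5)[OF _ j, of j 1 "- x" 1 y] by (auto simp: sph_elem_def vec_elem_def)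
next
  case True
  have y: "y = x - 1" using True by simp
  have j0: "0 < j" using m True by (auto simp: mags_def)
  have i: "j + x \<in> \<int>" "j - x \<in> \<int>" "1 \<le> j + x" "0 \<le> j - x"
    using mags_add_Ints[OF j m(1)] mags_diff_Ints[OF m(1)] m True by (simp_all add: mags_def)
  have a: "2 * j - 1 - (j + x) + 0 = j - x - 1" "2 * j - 1 - (j + x) + 1 = j - x" by simp_all
  have r: "racah 1 (2 * j - 1) 1 (j + x) (1 + 1) = - 1 / (rfact (j + x - 1) * rfact (j - x))"
    unfolding racah_1 racah_term_def a
    using i by (simp add: rinv_0 rinv_1 sign_int_1 rinv_nonneg rinv_neg)
  have e: "j + (x - 1) = j + x - 1" "j - (x - 1) = j - x + 1" by simp_all
  have "mag_weight j (x - 1) * mag_weight j (x - 1) = rfact (j + x - 1) * ((j - x + 1) * rfact (j - x))"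
    unfolding mag_weight_def e rfact_Suc[OF i(2,4)] using i(4) by (simp add: less_imp_le)
  then have "(j - x + 1) * (ladder 1 j x * (rfact (j + x - 1) * rfact (j - x)))
    = ladder 1 j x * mag_weight j (x - 1) * mag_weight j (x - 1)"
    by simp
  also have "\<dots> = (j - x + 1) * mag_weight j x * mag_weight j (x - 1)"
    using ladder_mag_weight[OF i] by simp
  finally have w: "mag_weight j x * mag_weight j (x - 1) = ladder 1 j x * (rfact (j + x - 1) * rfact (j - x))"
    using i(4) by simp
  have w1: "mag_weight 1 1 = sqrt 2" by (simp add: mag_weight_def)
  have sg: "sign_int (j - x) * sign_int (j - 1 - (x - 1)) = 1" by simp
  have "sph_elem j 1 x y = 1 / 2 * 1 * (sqrt 2 * (mag_weight j x * mag_weight j (x - 1))) * (- 1 / (rfact (j + x - 1) * rfact (j - x)))"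
    using sph_elem_racah[OF j j0 m, of 1] unfolding y r sg w1 by (simp add: mags_1 mult_ac)
  also have "\<dots> = - (sqrt 2 / 2) * ladder 1 j x" unfolding w by simp
  also have "sqrt 2 / 2 = 1 / sqrt 2" by (simp add: real_div_sqrt field_simps)
  finally show ?thesis using True by simp
qed

lemma sph_elem_minus_1:
  assumes j: "spin j" and m: "x \<in> mags j" "y \<in> mags j"
  shows "sph_elem j (- 1) x y = (if y = x + 1 then ladder 1 j y / sqrt 2 else 0)"
  using sph_elem_adjoint[OF j, of 1 x y] sph_elem_1[OF j m(2,1)] sign_int_plus_1[of 0] by simp

lemma raise_elem_sph:
  assumes "spin j" "x \<in> mags j" "y \<in> mags j"
  shows "raise_elem j x y = of_real (- sqrt 2 * sph_elem j 1 x y)"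
  using sph_elem_1[OF assms] by (simp add: raise_elem_def ladder_def algebra_simps)

lemma lower_elem_sph:
  assumes "spin j" "x \<in> mags j" "y \<in> mags j"
  shows "lower_elem j x y = of_real (sqrt 2 * sph_elem j (- 1) x y)"
  using sph_elem_minus_1[OF assms] by (auto simp: lower_elem_def ladder_def algebra_simps)

lemma sum_mags_1: "(\<Sum>q\<in>mags 1. f q) = f 0 + f 1 + f (- 1)"
  by (simp add: mags_1 add_ac)

lemma sum_1_3: "(\<Sum>i\<in>{1..3::nat}. f i) = f 1 + f 2 + f 3"
  by (simp add: numeral_eq_Suc add_ac)

text \<open>In the first two Cartesian components the products of two raising or two lowering parts
  cancel; the mixed products carry the factor \<open>sqrt 2\<close> twice, which absorbs the
  halves.\<close>

lemma spin_elem_dot: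
  assumes j: "spin j" "spin j'" and m: "x \<in> mags j" "y \<in> mags j" "x' \<in> mags j'" "y' \<in> mags j'"
  shows "(\<Sum>i\<in>{1..3}. spin_elem i j x y * spin_elem i j' x' y')
    = of_real (\<Sum>q\<in>mags 1. sign_int q * sph_elem j q x y * sph_elem j' (- q) x' y')"
    (is "?lhs = ?rhs")
proof -
  let ?s = "complex_of_real (sqrt 2)"
  let ?A = "complex_of_real (sph_elem j 1 x y)" and ?B = "complex_of_real (sph_elem j (- 1) x y)"
  let ?A' = "complex_of_real (sph_elem j' 1 x' y')" and ?B' = "complex_of_real (sph_elem j' (- 1) x' y')"
  let ?Z = "complex_of_real (sph_elem j 0 x y)" and ?Z' = "complex_of_real (sph_elem j' 0 x' y')"
  have s2: "?s * ?s = 2" by (metis abs_numeral of_real_mult of_real_numeral real_sqrt_mult_self)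
  have S: "spin_elem 1 j x y = (- (?s * ?A) + ?s * ?B) / 2" "spin_elem 2 j x y = (- (?s * ?A) - ?s * ?B) / (2 * \<i>)"
    "spin_elem 3 j x y = ?Z"
    using sph_elem_0[OF j(1) m(1,2)]
    by (simp_all add: spin_elem_def raise_elem_sph[OF j(1) m(1,2)] lower_elem_sph[OF j(1) m(1,2)])
  have S': "spin_elem 1 j' x' y' = (- (?s * ?A') + ?s * ?B') / 2" "spin_elem 2 j' x' y' = (- (?s * ?A') - ?s * ?B') / (2 * \<i>)"
    "spin_elem 3 j' x' y' = ?Z'"
    using sph_elem_0[OF j(2) m(3,4)]
    by (simp_all add: spin_elem_def raise_elem_sph[OF j(2) m(3,4)] lower_elem_sph[OF j(2) m(3,4)])
  have alg: "(- (s * A) + s * B) / 2 * ((- (s * A') + s * B') / 2) + (- (s * A) - s * B) / (2 * \<i>) * ((- (s * A') - s * B') / (2 * \<i>))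
    = - (s * s) * (A * B' + B * A') / 2" for s A B A' B' :: complex
    by (simp add: field_simps)
  have "?lhs = - (?s * ?s) * (?A * ?B' + ?B * ?A') / 2 + ?Z * ?Z'"
    unfolding sum_1_3 S S' alg ..
  also have "\<dots> = ?rhs"
    unfolding s2 by (simp add: sum_mags_1 sign_int_1 sign_int_neg_1)
  finally show ?thesis .
qed

text \<open>Orthogonality of the 3j-symbols for \<open>j 1 j\<close> makes the sum diagonal, with
  value the squared reduced matrix element divided by \<open>2 * j + 1\<close>.\<close>

lemma spin_elem_casimir:
  assumes j: "spin j" and m: "x \<in> mags j" "y \<in> mags j"
  shows "(\<Sum>i\<in>{1..3}. \<Sum>z\<in>mags j. spin_elem i j x z * spin_elem i j z y) = of_bool (x = y) * of_real (j * (j + 1))"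
    (is "?lhs = _")
proof -
  have "?lhs = of_real (\<Sum>z\<in>mags j. \<Sum>q\<in>mags 1. sign_int q * sph_elem j q x z * sph_elem j (- q) z y)"
    unfolding of_real_sum[of _ "mags j"]
    by (subst sum.swap, intro sum.cong refl, subst spin_elem_dot[OF j j]) (use m in auto)
  also have "(\<Sum>z\<in>mags j. \<Sum>q\<in>mags 1. sign_int q * sph_elem j q x z * sph_elem j (- q) z y)
    = (red_elem j)\<^sup>2 * (sign_int (j - x) * sign_int (j - y))
      * (\<Sum>z\<in>mags j. \<Sum>q\<in>mags 1. threej j 1 j z q (- x) * threej j 1 j z q (- y))"
    unfolding sum_distrib_left
  proof (intro sum.cong refl)
    fix z q
    have "threej j 1 j (- x) q z * threej j 1 j (- y) q z = threej j 1 j z q (- x) * threej j 1 j z q (- y)"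
      using threej_swap13[OF j spin_1 j, of "- x" q z] threej_swap13[OF j spin_1 j, of "- y" q z]
      by simp
    then show "sign_int q * sph_elem j q x z * sph_elem j (- q) z y = (red_elem j)\<^sup>2 * (sign_int (j - x) * sign_int (j - y))
      * (threej j 1 j z q (- x) * threej j 1 j z q (- y))"
      unfolding sph_elem_adjoint[OF j, of q z y]
      by (simp add: sph_elem_def vec_elem_def power2_eq_square mult_ac)
  qed
  also have "\<dots> = of_bool (x = y) * (j * (j + 1))"
  proof (cases "x = y")
    case True
    show ?thesis
    proof (cases "j = 0")
      case False
      then have "0 < j" using spin_nonneg[OF j] by simp
      note j2 = spin_pos(1)[OF j this] and t = spin_pos(2)[OF j this]
      have "(red_elem j)\<^sup>2 = j * (j + 1) * (2 * j + 1)" using j2 by (simp add: red_elem_def)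
      then show ?thesis
        unfolding threej_orthogonal[OF j spin_1 j j] using True m j t j2 by simp
    qed (simp add: red_elem_def)
  qed (use threej_orthogonal[OF j spin_1 j j] in simp)
  finally show ?thesis by simp
qed

section \<open>Operators on the sites of the tensor product\<close>

definition site_op :: "(nat \<Rightarrow> real) \<Rightarrow> nat \<Rightarrow> (real \<Rightarrow> real \<Rightarrow> complex) \<Rightarrow> state \<Rightarrow> state" where
  "site_op j n T \<psi> = (\<lambda>s. \<Sum>m\<in>mags (j n). T (s n) m * \<psi> (s(n := m)))"

lemma ang_eq_site_op: "ang j n i = site_op j n (spin_elem i (j n))"
  by (simp add: fun_eq_iff ang_def site_op_def)

lemma configs_mags: "s \<in> configs N j \<Longrightarrow> n \<in> {1..N} \<Longrightarrow> s n \<in> mags (j n)"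
  by (auto simp: configs_def)

lemma configs_upd: "s \<in> configs N j \<Longrightarrow> n \<in> {1..N} \<Longrightarrow> m \<in> mags (j n) \<Longrightarrow> s(n := m) \<in> configs N j"
  by (auto simp: configs_def PiE_def extensional_def)

lemma finite_configs [simp]: "finite (configs N j)"
  unfolding configs_def by (intro finite_PiE) auto

text \<open>States are meaningful only on \<open>configs N j\<close>. A one-site operator reads its
  argument only there, so identities known on configurations may be used under nested
  operators.\<close>

lemma site_op_cong:
  assumes "s \<in> configs N j" "n \<in> {1..N}" "\<And>s. s \<in> configs N j \<Longrightarrow> \<psi> s = \<phi> s"
    "\<And>x y. x \<in> mags (j n) \<Longrightarrow> y \<in> mags (j n) \<Longrightarrow> T x y = T' x y"
  shows "site_op j n T \<psi> s = site_op j n T' \<phi> s"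
  unfolding site_op_def using assms configs_upd configs_mags by (intro sum.cong refl) auto

lemma site_op_lincomb:
  "site_op j n T (\<lambda>s. c * \<psi> s + d * \<phi> s) s = c * site_op j n T \<psi> s + d * site_op j n T \<phi> s"
  by (simp add: site_op_def sum_distrib_left sum.distrib[symmetric] algebra_simps)

lemma site_op_sum:
  "site_op j n T (\<lambda>s. \<Sum>q\<in>Q. c q * \<psi> q s) s = (\<Sum>q\<in>Q. c q * site_op j n T (\<psi> q) s)"
  unfolding site_op_def by (simp add: sum_distrib_left mult.left_commute) (rule sum.swap)

lemma site_op_commute:
  assumes "k \<noteq> n"
  shows "site_op j k T (site_op j n T' \<psi>) s = site_op j n T' (site_op j k T \<psi>) s"
  using assms unfolding site_op_def
  by (simp add: sum_distrib_left fun_upd_twist[OF assms] mult.left_commute) (rule sum.swap)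

lemma site_op_same:
  "site_op j n T (site_op j n T' \<psi>) s = site_op j n (\<lambda>x y. \<Sum>z\<in>mags (j n). T x z * T' z y) \<psi> s"
  unfolding site_op_def by (simp add: sum_distrib_left sum_distrib_right mult.assoc) (rule sum.swap)

definition dot_op :: "(nat \<Rightarrow> real) \<Rightarrow> nat \<Rightarrow> nat \<Rightarrow> state \<Rightarrow> state" where
  "dot_op j k n \<psi> = (\<lambda>s. \<Sum>i\<in>{1..3}. ang j k i (ang j n i \<psi>) s)"

lemma ang_sq:
  assumes s: "s \<in> configs N j" and n: "n \<in> {1..N}" and j: "spin (j n)"
  shows "(\<Sum>i\<in>{1..3}. ang j n i (ang j n i \<psi>) s) = of_real (j n * (j n + 1)) * \<psi> s"
proof -
  have "(\<Sum>i\<in>{1..3}. ang j n i (ang j n i \<psi>) s)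
    = (\<Sum>y\<in>mags (j n). (\<Sum>i\<in>{1..3}. \<Sum>z\<in>mags (j n). spin_elem i (j n) (s n) z * spin_elem i (j n) z y) * \<psi> (s(n := y)))"
    unfolding ang_eq_site_op site_op_same unfolding site_op_def sum_distrib_right by (rule sum.swap)
  also have "\<dots> = (\<Sum>y\<in>mags (j n). of_bool (s n = y) * of_real (j n * (j n + 1)) * \<psi> (s(n := y)))"
    using spin_elem_casimir[OF j configs_mags[OF s n]] by (intro sum.cong refl) simp
  also have "\<dots> = (\<Sum>y\<in>{s n}. of_bool (s n = y) * of_real (j n * (j n + 1)) * \<psi> (s(n := y)))"
    using configs_mags[OF s n] by (intro sum.mono_neutral_right) auto
  finally show ?thesis by simp
qed

lemma vec_sq_add:
  assumes s: "s \<in> configs N j" and n: "k \<in> {1..N}" "n \<in> {1..N}" "k \<noteq> n" and j: "spin (j k)" "spin (j n)"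
  shows "vec_sq (vec_add (ang j k) (ang j n)) \<psi> s
    = of_real (j k * (j k + 1) + j n * (j n + 1)) * \<psi> s + 2 * dot_op j k n \<psi> s"
proof -
  have "vec_sq (vec_add (ang j k) (ang j n)) \<psi> s
    = (\<Sum>i\<in>{1..3}. ang j k i (ang j k i \<psi>) s + ang j n i (ang j n i \<psi>) s + 2 * ang j k i (ang j n i \<psi>) s)"
    unfolding vec_sq_def vec_add_def ang_eq_site_op
    using site_op_lincomb[of j _ _ 1 _ 1]
    by (intro sum.cong refl) (simp add: site_op_commute[OF n(3)[symmetric]])
  also have "\<dots> = of_real (j k * (j k + 1)) * \<psi> s + of_real (j n * (j n + 1)) * \<psi> s + 2 * dot_op j k n \<psi> s"
    unfolding sum.distrib ang_sq[OF s n(1) j(1)] ang_sq[OF s n(2) j(2)] dot_op_def sum_distrib_left ..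
  finally show ?thesis by (simp add: algebra_simps)
qed

lemma dot_op_cong:
  assumes "s \<in> configs N j" "k \<in> {1..N}" "n \<in> {1..N}" "\<And>s. s \<in> configs N j \<Longrightarrow> \<psi> s = \<phi> s"
  shows "dot_op j k n \<psi> s = dot_op j k n \<phi> s"
  unfolding dot_op_def ang_eq_site_op
  by (intro sum.cong refl site_op_cong[OF assms(1,2)] site_op_cong[OF _ assms(3,4)]) auto

lemma dot_op_lincomb:
  "dot_op j k n (\<lambda>s. c * \<psi> s + d * \<phi> s) s = c * dot_op j k n \<psi> s + d * dot_op j k n \<phi> s"
proof -
  have e: "site_op j n T (\<lambda>s. c * \<psi> s + d * \<phi> s) = (\<lambda>s. c * site_op j n T \<psi> s + d * site_op j n T \<phi> s)" for T
    by (simp add: fun_eq_iff site_op_lincomb)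
  show ?thesis
    unfolding dot_op_def ang_eq_site_op e site_op_lincomb by (simp add: sum.distrib sum_distrib_left)
qed

lemma q_hat_eq:
  assumes s: "s \<in> configs N j" and n: "I \<in> {1..N}" "J \<in> {1..N}" "K \<in> {1..N}" "I \<noteq> J" "J \<noteq> K"
    and j: "spin (j I)" "spin (j J)" "spin (j K)"
  shows "q_hat j I J K \<psi> s = 4 * (dot_op j I J (dot_op j J K \<psi>) s - dot_op j J K (dot_op j I J \<psi>) s)"
proof -
  let ?c = "complex_of_real (j I * (j I + 1) + j J * (j J + 1))"
  let ?d = "complex_of_real (j J * (j J + 1) + j K * (j K + 1))"
  note A = vec_sq_add[OF _ n(1,2,4) j(1,2)] and B = vec_sq_add[OF _ n(2,3,5) j(2,3)]
  have 1: "dot_op j I J (vec_sq (vec_add (ang j J) (ang j K)) \<psi>) s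
    = dot_op j I J (\<lambda>s. ?d * \<psi> s + 2 * dot_op j J K \<psi> s) s"
    by (rule dot_op_cong[OF s n(1,2)]) (rule B)
  have 2: "dot_op j J K (vec_sq (vec_add (ang j I) (ang j J)) \<psi>) s
    = dot_op j J K (\<lambda>s. ?c * \<psi> s + 2 * dot_op j I J \<psi> s) s"
    by (rule dot_op_cong[OF s n(2,3)]) (rule A)
  show ?thesis
    unfolding q_hat_def commutator_def A[OF s] B[OF s] 1 2 dot_op_lincomb
    by (simp add: algebra_simps)
qed

abbreviation sph_op :: "(nat \<Rightarrow> real) \<Rightarrow> nat \<Rightarrow> real \<Rightarrow> state \<Rightarrow> state" where
  "sph_op j n q \<equiv> site_op j n (\<lambda>x y. of_real (sph_elem (j n) q x y))"

lemma dot_op_spherical: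
  assumes s: "s \<in> configs N j" and n: "k \<in> {1..N}" "n \<in> {1..N}" "k \<noteq> n" and j: "spin (j k)" "spin (j n)"
  shows "dot_op j k n \<psi> s = (\<Sum>q\<in>mags 1. of_real (sign_int q) * sph_op j k q (sph_op j n (- q) \<psi>) s)"
    (is "_ = ?rhs")
proof -
  have "dot_op j k n \<psi> s = (\<Sum>i\<in>{1..3}. \<Sum>x\<in>mags (j k). \<Sum>y\<in>mags (j n).
      spin_elem i (j k) (s k) x * spin_elem i (j n) (s n) y * \<psi> (s(k := x, n := y)))"
    unfolding dot_op_def ang_eq_site_op site_op_def using n(3)
    by (simp add: sum_distrib_left mult.assoc)
  also have "\<dots> = (\<Sum>x\<in>mags (j k). \<Sum>y\<in>mags (j n).
      (\<Sum>i\<in>{1..3}. spin_elem i (j k) (s k) x * spin_elem i (j n) (s n) y) * \<psi> (s(k := x, n := y)))"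
    by (subst sum_rotate) (simp only: sum_distrib_right)
  also have "\<dots> = (\<Sum>x\<in>mags (j k). \<Sum>y\<in>mags (j n).
      of_real (\<Sum>q\<in>mags 1. sign_int q * sph_elem (j k) q (s k) x * sph_elem (j n) (- q) (s n) y) * \<psi> (s(k := x, n := y)))"
    using configs_mags[OF s n(1)] configs_mags[OF s n(2)]
    by (intro sum.cong refl) (simp only: spin_elem_dot[OF j])
  also have "\<dots> = (\<Sum>q\<in>mags 1. \<Sum>x\<in>mags (j k). \<Sum>y\<in>mags (j n).
      of_real (sign_int q * sph_elem (j k) q (s k) x * sph_elem (j n) (- q) (s n) y) * \<psi> (s(k := x, n := y)))"
    by (subst sum_rotate[of _ _ _ "mags 1"]) (simp only: of_real_sum sum_distrib_right)
  also have "\<dots> = ?rhs"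
    unfolding site_op_def using n(3)
    by (simp add: sum_distrib_left mult.assoc)
  finally show ?thesis .
qed

section \<open>Tensor products of one-site matrices\<close>

definition tensor_op :: "nat \<Rightarrow> (nat \<Rightarrow> real) \<Rightarrow> (nat \<Rightarrow> real \<Rightarrow> real \<Rightarrow> real) \<Rightarrow> state \<Rightarrow> state" where
  "tensor_op N j U \<psi> = (\<lambda>s. \<Sum>s'\<in>configs N j. of_real (\<Prod>n\<in>{1..N}. U n (s n) (s' n)) * \<psi> s')"

lemma prod_of_bool_eq: "finite A \<Longrightarrow> (\<Prod>n\<in>A. of_bool (P n)) = (of_bool (\<forall>n\<in>A. P n) :: 'a :: comm_semiring_1)"
  by (induction A rule: finite_induct) auto

lemma tensor_op_id:
  assumes s: "s \<in> configs N j"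
  shows "tensor_op N j (\<lambda>_ x y. of_bool (x = y)) \<psi> s = \<psi> s"
proof -
  have eq: "s' = s" if "s' \<in> configs N j" "\<forall>n\<in>{1..N}. s n = s' n" for s'
    using that s unfolding configs_def by (intro PiE_ext[of s' "{1..N}" _ s]) auto
  have "tensor_op N j (\<lambda>_ x y. of_bool (x = y)) \<psi> s
    = (\<Sum>s'\<in>configs N j. of_real (of_bool (\<forall>n\<in>{1..N}. s n = s' n)) * \<psi> s')"
    unfolding tensor_op_def by (intro sum.cong refl) (simp add: prod_of_bool_eq)
  also have "\<dots> = (\<Sum>s'\<in>{s}. of_real (of_bool (\<forall>n\<in>{1..N}. s n = s' n)) * \<psi> s')"
    using s eq by (intro sum.mono_neutral_right) auto
  finally show ?thesis by simp
qed

text \<open>A one-site operator may be inserted where the product still carries the identity, whose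
  delta collapses the extra sum.\<close>

lemma site_op_tensor_op:
  assumes s: "s \<in> configs N j" and n: "n \<in> {1..N}" and U: "U n = (\<lambda>x y. of_bool (x = y))"
  shows "site_op j n (\<lambda>x y. of_real (T x y)) (tensor_op N j U \<psi>) s = tensor_op N j (U(n := T)) \<psi> s"
    (is "?lhs = _")
proof -
  let ?P = "\<lambda>s'. \<Prod>k\<in>{1..N} - {n}. U k (s k) (s' k)"
  let ?g = "\<lambda>x s'. of_real (T (s n) x * (of_bool (x = s' n) * ?P s')) * \<psi> s'"
  have e: "(\<Prod>k\<in>{1..N}. U k ((s(n := x)) k) (s' k)) = of_bool (x = s' n) * ?P s'" for x s'
    using n by (subst prod.remove[OF _ n]) (auto simp: U intro!: prod.cong)
  have f: "(\<Prod>k\<in>{1..N}. (U(n := T)) k (s k) (s' k)) = T (s n) (s' n) * ?P s'" for s'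
    using n by (subst prod.remove[OF _ n]) (auto intro!: prod.cong)
  have "?lhs = (\<Sum>s'\<in>configs N j. \<Sum>x\<in>mags (j n). ?g x s')"
    unfolding site_op_def tensor_op_def e sum_distrib_left by (subst sum.swap) (simp add: mult.assoc)
  also have "\<dots> = (\<Sum>s'\<in>configs N j. of_real (T (s n) (s' n) * ?P s') * \<psi> s')"
  proof (intro sum.cong refl)
    fix s' assume s': "s' \<in> configs N j"
    have "(\<Sum>x\<in>mags (j n). ?g x s')
      = (\<Sum>x\<in>{s' n}. ?g x s')"
      using configs_mags[OF s' n] by (intro sum.mono_neutral_right) auto
    then show "(\<Sum>x\<in>mags (j n). ?g x s')
      = of_real (T (s n) (s' n) * ?P s') * \<psi> s'" by simp
  qed
  finally show ?thesis unfolding tensor_op_def f .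
qed

section \<open>Coupling one more factor\<close>

lemma cg_eq_0: "m1 + m2 \<noteq> m \<Longrightarrow> cg j1 m1 j2 m2 j m = 0"
  by (simp add: cg_def)

text \<open>The last magnetic number is read off from the configuration instead of being summed with
  a delta, and all values are real because the Clebsch-Gordan coefficients are.\<close>

fun coupled_real :: "(nat \<Rightarrow> real) \<Rightarrow> (nat \<Rightarrow> real) \<Rightarrow> nat \<Rightarrow> real \<Rightarrow> (nat \<Rightarrow> real) \<Rightarrow> real" where
  "coupled_real j a 0 m s = 0"
| "coupled_real j a (Suc 0) m s = of_bool (s 1 = m)"
| "coupled_real j a (Suc (Suc n)) m s =
    (\<Sum>m'\<in>mags (a (Suc n)). cg (a (Suc n)) m' (j (Suc (Suc n))) (s (Suc (Suc n))) (a (Suc (Suc n))) m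
       * coupled_real j a (Suc n) m' s)"

lemma coupled_eq_coupled_real:
  assumes "\<And>k. k \<in> {1..n} \<Longrightarrow> s k \<in> mags (j k)"
  shows "coupled j a n m s = of_real (coupled_real j a n m s)"
  using assms
proof (induction j a n m s rule: coupled_real.induct)
  case (3 j a n m s)
  let ?n = "Suc (Suc n)"
  let ?F = "\<lambda>(m', mn). of_real (cg (a (Suc n)) m' (j ?n) mn (a ?n) m)
       * tensor_ket ?n (coupled j a (Suc n) m') mn s"
  have IH: "coupled j a (Suc n) m' s = of_real (coupled_real j a (Suc n) m' s)" if "m' \<in> mags (a (Suc n))" for m'
    using 3 that by auto
  have sn: "s ?n \<in> mags (j ?n)" using 3(2) by simp
  have "coupled j a ?n m s = sum ?F (mags (a (Suc n)) \<times> mags (j ?n))"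
    unfolding coupled.simps
    by (rule sum.mono_neutral_left) (auto intro: cg_eq_0)
  also have "\<dots> = (\<Sum>m'\<in>mags (a (Suc n)). \<Sum>mn\<in>mags (j ?n). ?F (m', mn))"
    by (simp add: sum.cartesian_product)
  also have "\<dots> = (\<Sum>m'\<in>mags (a (Suc n)). \<Sum>mn\<in>{s ?n}. ?F (m', mn))"
    using sn by (intro sum.cong refl sum.mono_neutral_right) (auto simp: tensor_ket_def)
  also have "\<dots> = of_real (coupled_real j a ?n m s)"
    by (simp add: tensor_ket_def IH)
  finally show ?case .
qed simp_all

lemma coupled_real_cong:
  assumes "\<And>k. k \<in> {1..n} \<Longrightarrow> s k = s' k"
  shows "coupled_real j a n m s = coupled_real j a n m s'"
  using assms
proof (induction j a n m s arbitrary: s' rule: coupled_real.induct)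
  case (3 j a n m s)
  have "s (Suc (Suc n)) = s' (Suc (Suc n))" using 3(2) by simp
  moreover have "coupled_real j a (Suc n) m' s = coupled_real j a (Suc n) m' s'" if "m' \<in> mags (a (Suc n))" for m'
    using 3 that by auto
  ultimately show ?case by simp
qed simp_all

lemma sum_configs_Suc:
  "(\<Sum>s\<in>configs (Suc n) j. f s) = (\<Sum>x\<in>mags (j (Suc n)). \<Sum>s\<in>configs n j. f (s(Suc n := x)))"
proof -
  have e: "{1..Suc n} = insert (Suc n) {1..n}" by auto
  have "configs (Suc n) j = (\<lambda>(x, s). s(Suc n := x)) ` (mags (j (Suc n)) \<times> configs n j)"
    unfolding configs_def e by (rule PiE_insert_eq)
  moreover have "inj_on (\<lambda>(x, s). s(Suc n := x)) (mags (j (Suc n)) \<times> configs n j)"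
    unfolding configs_def by (rule inj_combinator) simp
  ultimately show ?thesis
    by (simp add: sum.reindex sum.cartesian_product split_def)
qed

text \<open>The matrix element between coupled states of total spins \<open>b\<close>, \<open>b'\<close> of an operator that acts by
  \<open>B\<close> on the first factors (with spins \<open>a\<close>, \<open>a'\<close>) and by \<open>T\<close> on the last factor.\<close>

definition couple_elem where
  "couple_elem a a' j b b' T B M M' = (\<Sum>x\<in>mags j. \<Sum>y\<in>mags j. \<Sum>m'\<in>mags a'. \<Sum>m\<in>mags a.
     cg a m j x b M * cg a' m' j y b' M' * T x y * (B m m' :: real))"

text \<open>The matrix element of a product operator between two coupled states, evaluated along the
  coupling tree; \<open>coupled_elem_eq_sum\<close> is the justification.\<close>

fun coupled_elem where
  "coupled_elem j a a' U 0 m m' = 0"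
| "coupled_elem j a a' U (Suc 0) m m' = U 1 m m'"
| "coupled_elem j a a' U (Suc (Suc n)) m m' =
    couple_elem (a (Suc n)) (a' (Suc n)) (j (Suc (Suc n))) (a (Suc (Suc n))) (a' (Suc (Suc n)))
      (U (Suc (Suc n))) (coupled_elem j a a' U (Suc n)) m m'"

lemma coupled_elem_Suc:
  "1 \<le> n \<Longrightarrow> coupled_elem j a a' U (Suc n) =
    couple_elem (a n) (a' n) (j (Suc n)) (a (Suc n)) (a' (Suc n)) (U (Suc n)) (coupled_elem j a a' U n)"
  by (cases n) (auto simp: fun_eq_iff)

lemma couple_elem_cong:
  assumes "\<And>x y. x \<in> mags j \<Longrightarrow> y \<in> mags j \<Longrightarrow> T x y = T' x y"
    and "\<And>m m'. m \<in> mags a \<Longrightarrow> m' \<in> mags a' \<Longrightarrow> B m m' = B' m m'"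
  shows "couple_elem a a' j b b' T B M M' = couple_elem a a' j b b' T' B' M M'"
  unfolding couple_elem_def using assms by (intro sum.cong refl) simp

lemma couple_elem_scale:
  "couple_elem a a' j b b' T (\<lambda>m m'. c * B m m') M M' = c * couple_elem a a' j b b' T B M M'"
  by (simp add: couple_elem_def sum_distrib_left mult_ac)

lemma sum_reorder5:
  "(\<Sum>q\<in>Q. \<Sum>x\<in>X. \<Sum>y\<in>Y. \<Sum>k\<in>K. \<Sum>m\<in>M. f q x y k m)
    = (\<Sum>k\<in>K. \<Sum>y\<in>Y. \<Sum>x\<in>X. \<Sum>m\<in>M. \<Sum>q\<in>Q. f q x y k m)"
proof -
  have "(\<Sum>(q, x, y, k, m)\<in>Q \<times> X \<times> Y \<times> K \<times> M. f q x y k m) = (\<Sum>(k, y, x, m, q)\<in>K \<times> Y \<times> X \<times> M \<times> Q. f q x y k m)"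
    by (rule sum.reindex_bij_witness[of _ "\<lambda>(k, y, x, m, q). (q, x, y, k, m)" "\<lambda>(q, x, y, k, m). (k, y, x, m, q)"]) auto
  then show ?thesis by (simp add: sum.cartesian_product split_def)
qed

text \<open>The first order puts the sums contracted on the bra side innermost, the second those on
  the ket side.\<close>

lemma sum_reorder6:
  "(\<Sum>q\<in>Q. \<Sum>x\<in>X. \<Sum>y\<in>Y. \<Sum>k\<in>K. \<Sum>m\<in>M. \<Sum>z\<in>Z. f q x y k m z)
    = (\<Sum>y\<in>Y. \<Sum>k\<in>K. \<Sum>z\<in>Z. \<Sum>x\<in>X. \<Sum>m\<in>M. \<Sum>q\<in>Q. f q x y k m z)"
    (is "?lhs = _")
  "(\<Sum>q\<in>Q. \<Sum>x\<in>X. \<Sum>y\<in>Y. \<Sum>k\<in>K. \<Sum>m\<in>M. \<Sum>z\<in>Z. f q x y k m z)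
    = (\<Sum>z\<in>Z. \<Sum>m\<in>M. \<Sum>x\<in>X. \<Sum>y\<in>Y. \<Sum>k\<in>K. \<Sum>q\<in>Q. f q x y k m z)"
proof -
  have "(\<Sum>(q, x, y, k, m, z)\<in>Q \<times> X \<times> Y \<times> K \<times> M \<times> Z. f q x y k m z)
    = (\<Sum>(y, k, z, x, m, q)\<in>Y \<times> K \<times> Z \<times> X \<times> M \<times> Q. f q x y k m z)"
    by (rule sum.reindex_bij_witness[of _ "\<lambda>(y, k, z, x, m, q). (q, x, y, k, m, z)"
      "\<lambda>(q, x, y, k, m, z). (y, k, z, x, m, q)"]) auto
  then show "?lhs = (\<Sum>y\<in>Y. \<Sum>k\<in>K. \<Sum>z\<in>Z. \<Sum>x\<in>X. \<Sum>m\<in>M. \<Sum>q\<in>Q. f q x y k m z)"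
    by (simp add: sum.cartesian_product split_def)
  have "(\<Sum>(q, x, y, k, m, z)\<in>Q \<times> X \<times> Y \<times> K \<times> M \<times> Z. f q x y k m z)
    = (\<Sum>(z, m, x, y, k, q)\<in>Z \<times> M \<times> X \<times> Y \<times> K \<times> Q. f q x y k m z)"
    by (rule sum.reindex_bij_witness[of _ "\<lambda>(z, m, x, y, k, q). (q, x, y, k, m, z)"
      "\<lambda>(q, x, y, k, m, z). (z, m, x, y, k, q)"]) auto
  then show "?lhs = (\<Sum>z\<in>Z. \<Sum>m\<in>M. \<Sum>x\<in>X. \<Sum>y\<in>Y. \<Sum>k\<in>K. \<Sum>q\<in>Q. f q x y k m z)"
    by (simp add: sum.cartesian_product split_def)
qed

text \<open>Linearity in the first factors: once a spherical index occurs only at earlier sites, its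
  sum can be performed before coupling the next one.\<close>

lemma couple_elem_lincomb:
  "(\<Sum>q\<in>Q. c q * couple_elem a a' j b b' T (B q) M M') = couple_elem a a' j b b' T (\<lambda>m m'. \<Sum>q\<in>Q. c q * B q m m') M M'"
proof -
  have "(\<Sum>q\<in>Q. c q * couple_elem a a' j b b' T (B q) M M')
    = (\<Sum>q\<in>Q. \<Sum>x\<in>mags j. \<Sum>y\<in>mags j. \<Sum>m'\<in>mags a'. \<Sum>m\<in>mags a.
     cg a m j x b M * cg a' m' j y b' M' * T x y * (c q * B q m m'))"
    by (simp add: couple_elem_def sum_distrib_left mult_ac)
  also have "\<dots> = (\<Sum>m'\<in>mags a'. \<Sum>y\<in>mags j. \<Sum>x\<in>mags j. \<Sum>m\<in>mags a. \<Sum>q\<in>Q.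
     cg a m j x b M * cg a' m' j y b' M' * T x y * (c q * B q m m'))"
    by (rule sum_reorder5)
  also have "\<dots> = (\<Sum>x\<in>mags j. \<Sum>y\<in>mags j. \<Sum>m'\<in>mags a'. \<Sum>m\<in>mags a. \<Sum>q\<in>Q.
     cg a m j x b M * cg a' m' j y b' M' * T x y * (c q * B q m m'))"
    by (subst sum_rotate[of _ _ _ "mags a'"], subst sum.swap) (rule refl)
  finally show ?thesis by (simp add: couple_elem_def sum_distrib_left)
qed

section \<open>The elementary moves when one factor is coupled\<close>

lemma couple_elem_id:
  assumes s: "spin a" "spin j" "spin b" "spin b'" and t: "triad a j b"
    and M: "M \<in> mags b"
  shows "couple_elem a a j b b' (\<lambda>x y. of_bool (x = y)) (\<lambda>m m'. of_bool (m = m')) M M' = of_bool (b = b' \<and> M = M')"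
    (is "?lhs = _")
proof -
  let ?f = "\<lambda>x y m' m. cg a m j x b M * cg a m' j y b' M' * of_bool (x = y) * of_bool (m = m')"
  have "?lhs = (\<Sum>x\<in>mags j. \<Sum>y\<in>{x}. \<Sum>m'\<in>mags a. \<Sum>m\<in>mags a. ?f x y m' m)"
    unfolding couple_elem_def by (intro sum.cong refl sum.mono_neutral_right) auto
  also have "\<dots> = (\<Sum>x\<in>mags j. \<Sum>y\<in>{x}. \<Sum>m'\<in>mags a. \<Sum>m\<in>{m'}. ?f x y m' m)"
    by (intro sum.cong refl sum.mono_neutral_right) auto
  also have "\<dots> = (\<Sum>m\<in>mags a. \<Sum>x\<in>mags j. cg a m j x b M * cg a m j x b' M')"
    by simp (rule sum.swap)
  finally show ?thesis using cg_orthonormal[OF s] t M by simp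
qed

lemma couple_elem_vec_first:
  assumes s: "spin a" "spin a'" "spin j" "spin b" "spin b'" and t: "triad a j b" "triad a' j b'"
  shows "couple_elem a a' j b b' (\<lambda>x y. of_bool (x = y)) (\<lambda>m m'. vec_elem a a' m q m') M M'
    = sign_int (a + j + b' + 1) * sqrt (2 * b + 1) * sqrt (2 * b' + 1) * sixj b 1 b' a' j a * vec_elem b b' M q M'"
    (is "?lhs = _")
proof -
  have "?lhs = (\<Sum>x\<in>mags j. \<Sum>y\<in>{x}. \<Sum>m'\<in>mags a'. \<Sum>m\<in>mags a.
      cg a m j x b M * cg a' m' j y b' M' * of_bool (x = y) * vec_elem a a' m q m')"
    unfolding couple_elem_def by (intro sum.cong refl sum.mono_neutral_right) auto
  also have "\<dots> = (\<Sum>m'\<in>mags a'. \<Sum>x\<in>mags j. \<Sum>m\<in>mags a. cg a m j x b M * cg a' m' j x b' M' * vec_elem a a' m q m')"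
    by simp (rule sum.swap)
  finally show ?thesis unfolding cg_vec_elem_first[OF assms] .
qed

lemma couple_elem_sph_last:
  assumes s: "spin a" "spin j" "spin b" "spin b'" and t: "triad a j b" "triad a j b'"
  shows "couple_elem a a j b b' (sph_elem j q) (\<lambda>m m'. of_bool (m = m')) M M'
    = red_elem j * sign_int (a + j + b + 1) * sqrt (2 * b + 1) * sqrt (2 * b' + 1) * sixj b 1 b' j a j * vec_elem b b' M q M'"
    (is "?lhs = _")
proof -
  have "?lhs = (\<Sum>x\<in>mags j. \<Sum>y\<in>mags j. \<Sum>m'\<in>mags a. \<Sum>m\<in>{m'}.
      cg a m j x b M * cg a m' j y b' M' * sph_elem j q x y * of_bool (m = m'))"
    unfolding couple_elem_def by (intro sum.cong refl sum.mono_neutral_right) auto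
  also have "\<dots> = (\<Sum>y\<in>mags j. \<Sum>m\<in>mags a. \<Sum>x\<in>mags j. cg a m j x b M * cg a m j y b' M' * sph_elem j q x y)"
    by simp (rule sum_rotate)
  finally show ?thesis unfolding cg_sph_elem_second[OF assms] .
qed

text \<open>The contracted component stands next to the bra and replaces its inner spin
  \<open>a\<close> by \<open>a'\<close>; the component \<open>p\<close> then acts over the common
  inner spin \<open>a'\<close>. The two moves have opposite signs, so only the minus
  remains.\<close>

lemma couple_elem_scalar_vec:
  assumes s: "spin a" "spin a'" "spin j" "spin b" "spin b'" and t: "triad a j b" "triad a' j b'"
  shows "(\<Sum>q\<in>mags 1. sign_int q * couple_elem a a' j b b'
      (\<lambda>x y. \<Sum>z\<in>mags j. sph_elem j (- q) x z * sph_elem j p z y) (\<lambda>m m'. vec_elem a a' m q m') M M')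
    = - ((red_elem j)\<^sup>2 * sqrt (2 * b + 1) * sqrt (2 * b' + 1) * sixj a' j b j a 1 * sixj b 1 b' j a' j) * vec_elem b b' M p M'"
    (is "?lhs = ?rhs")
proof -
  have "?lhs = (\<Sum>q\<in>mags 1. \<Sum>x\<in>mags j. \<Sum>y\<in>mags j. \<Sum>m'\<in>mags a'. \<Sum>m\<in>mags a. \<Sum>z\<in>mags j.
        (cg a' m' j y b' M' * sph_elem j p z y) * (sign_int q * cg a m j x b M * vec_elem a a' m q m' * sph_elem j (- q) x z))"
    by (simp add: couple_elem_def sum_distrib_left sum_distrib_right mult_ac)
  also have "\<dots> = (\<Sum>y\<in>mags j. \<Sum>m'\<in>mags a'. \<Sum>z\<in>mags j. (cg a' m' j y b' M' * sph_elem j p z y) *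
      (\<Sum>x\<in>mags j. \<Sum>m\<in>mags a. \<Sum>q\<in>mags 1. sign_int q * cg a m j x b M * vec_elem a a' m q m' * sph_elem j (- q) x z))"
    by (subst sum_reorder6(1)) (simp only: sum_distrib_left)
  also have "\<dots> = (\<Sum>y\<in>mags j. \<Sum>m'\<in>mags a'. \<Sum>z\<in>mags j. (cg a' m' j y b' M' * sph_elem j p z y) *
      (red_elem j * sign_int (a' + j + b) * sixj a' j b j a 1 * cg a' m' j z b M))"
    by (intro sum.cong refl) (simp only: cg_scalar_bra[OF s(1-4) t(1)])
  also have "\<dots> = (red_elem j * sign_int (a' + j + b) * sixj a' j b j a 1) *
     (\<Sum>y\<in>mags j. \<Sum>m'\<in>mags a'. \<Sum>z\<in>mags j. cg a' m' j z b M * cg a' m' j y b' M' * sph_elem j p z y)"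
    by (simp add: sum_distrib_left mult_ac)
  also have "\<dots> = ?rhs"
  \<comment> \<open>The second move needs the mixed triad \<open>a' j b\<close>, which a
    nonvanishing symbol provides.\<close>
  proof (cases "sixj a' j b j a 1 = 0")
    case False
    have t': "triad a' j b" by (rule sixj_nonzeroD(1)[OF False])
    show ?thesis
      unfolding cg_sph_elem_second[OF s(2-5) t' t(2)] sign_int_plus_1
      by (simp add: power2_eq_square mult_ac)
  qed simp
  finally show ?thesis .
qed

text \<open>In the opposite order the contraction acts on the ket and makes \<open>a\<close> the
  common inner spin. Here the two signs involve different spins and do not cancel, which is the
  origin of the different phases of the two bracket terms.\<close>

lemma couple_elem_vec_scalar:
  assumes s: "spin a" "spin a'" "spin j" "spin b" "spin b'" and t: "triad a j b" "triad a' j b'"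
  shows "(\<Sum>q\<in>mags 1. sign_int q * couple_elem a a' j b b'
      (\<lambda>x y. \<Sum>z\<in>mags j. sph_elem j p x z * sph_elem j (- q) z y) (\<lambda>m m'. vec_elem a a' m q m') M M')
    = (red_elem j)\<^sup>2 * (sign_int (a' + j + b') * sign_int (a + j + b + 1)) * sqrt (2 * b + 1) * sqrt (2 * b' + 1)
      * sixj a j b' j a' 1 * sixj b 1 b' j a j * vec_elem b b' M p M'"
    (is "?lhs = ?rhs")
proof -
  have "?lhs = (\<Sum>q\<in>mags 1. \<Sum>x\<in>mags j. \<Sum>y\<in>mags j. \<Sum>m'\<in>mags a'. \<Sum>m\<in>mags a. \<Sum>z\<in>mags j.
        (cg a m j x b M * sph_elem j p x z) * (sign_int q * cg a' m' j y b' M' * vec_elem a a' m q m' * sph_elem j (- q) z y))"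
    by (simp add: couple_elem_def sum_distrib_left sum_distrib_right mult_ac)
  also have "\<dots> = (\<Sum>z\<in>mags j. \<Sum>m\<in>mags a. \<Sum>x\<in>mags j. (cg a m j x b M * sph_elem j p x z) *
      (\<Sum>y\<in>mags j. \<Sum>m'\<in>mags a'. \<Sum>q\<in>mags 1. sign_int q * cg a' m' j y b' M' * vec_elem a a' m q m' * sph_elem j (- q) z y))"
    by (subst sum_reorder6(2)) (simp only: sum_distrib_left)
  also have "\<dots> = (\<Sum>z\<in>mags j. \<Sum>m\<in>mags a. \<Sum>x\<in>mags j. (cg a m j x b M * sph_elem j p x z) *
      (red_elem j * sign_int (a' + j + b') * sixj a j b' j a' 1 * cg a m j z b' M'))"
    by (intro sum.cong refl) (simp only: cg_scalar_ket[OF s(1,2,3,5) t(2)])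
  also have "\<dots> = (red_elem j * sign_int (a' + j + b') * sixj a j b' j a' 1) *
     (\<Sum>z\<in>mags j. \<Sum>m\<in>mags a. \<Sum>x\<in>mags j. cg a m j x b M * cg a m j z b' M' * sph_elem j p x z)"
    by (simp add: sum_distrib_left mult_ac)
  also have "\<dots> = ?rhs"
  proof (cases "sixj a j b' j a' 1 = 0")
    case False
    have t': "triad a j b'" by (rule sixj_nonzeroD(1)[OF False])
    show ?thesis
      unfolding cg_sph_elem_second[OF s(1,3,4,5) t(1) t']
      by (simp add: power2_eq_square mult_ac)
  qed simp
  finally show ?thesis .
qed

text \<open>The contraction replaces the inner spin of the bra by that of the ket, after which
  orthonormality forces equal total spins.\<close>

lemma couple_elem_scalar:
  assumes s: "spin a" "spin a'" "spin j" "spin b" "spin b'" and t: "triad a j b" "triad a' j b'"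
    and M: "M \<in> mags b"
  shows "(\<Sum>q\<in>mags 1. sign_int q * couple_elem a a' j b b' (sph_elem j (- q)) (\<lambda>m m'. vec_elem a a' m q m') M M')
    = red_elem j * sign_int (a' + j + b) * sixj a' j b j a 1 * of_bool (b = b' \<and> M = M')"
proof -
  have "(\<Sum>q\<in>mags 1. sign_int q * couple_elem a a' j b b' (sph_elem j (- q)) (\<lambda>m m'. vec_elem a a' m q m') M M')
    = (\<Sum>q\<in>mags 1. \<Sum>x\<in>mags j. \<Sum>y\<in>mags j. \<Sum>m'\<in>mags a'. \<Sum>m\<in>mags a.
        cg a' m' j y b' M' * (sign_int q * cg a m j x b M * vec_elem a a' m q m' * sph_elem j (- q) x y))"
    by (simp add: couple_elem_def sum_distrib_left mult_ac)
  also have "\<dots> = (\<Sum>m'\<in>mags a'. \<Sum>y\<in>mags j. cg a' m' j y b' M' *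
      (\<Sum>x\<in>mags j. \<Sum>m\<in>mags a. \<Sum>q\<in>mags 1. sign_int q * cg a m j x b M * vec_elem a a' m q m' * sph_elem j (- q) x y))"
    by (subst sum_reorder5) (simp only: sum_distrib_left)
  also have "\<dots> = (\<Sum>m'\<in>mags a'. \<Sum>y\<in>mags j. cg a' m' j y b' M' *
      (red_elem j * sign_int (a' + j + b) * sixj a' j b j a 1 * cg a' m' j y b M))"
    by (intro sum.cong refl) (simp only: cg_scalar_bra[OF s(1-4) t(1)])
  also have "\<dots> = red_elem j * sign_int (a' + j + b) * sixj a' j b j a 1 *
      (\<Sum>m'\<in>mags a'. \<Sum>y\<in>mags j. cg a' m' j y b M * cg a' m' j y b' M')"
    by (simp add: sum_distrib_left mult_ac)
  also have "\<dots> = red_elem j * sign_int (a' + j + b) * sixj a' j b j a 1 * of_bool (b = b' \<and> M = M')"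
    using cg_orthonormal[OF s(2-5), of M M'] M sixj_nonzeroD(1)[of a' j b j a 1] by auto
  finally show ?thesis .
qed

lemma sum_bilinear:
  fixes A R P A' R' :: "_ \<Rightarrow> _"
  shows "(\<Sum>s\<in>S. \<Sum>s'\<in>S'. (\<Sum>m\<in>M. A m * R m s) * (u * P s s') * (\<Sum>m'\<in>M'. A' m' * R' m' s'))
    = (\<Sum>m'\<in>M'. \<Sum>m\<in>M. A m * A' m' * u * (\<Sum>s\<in>S. \<Sum>s'\<in>S'. R m s * P s s' * (R' m' s' :: real)))"
    (is "?lhs = _")
proof -
  have "?lhs = (\<Sum>s\<in>S. \<Sum>s'\<in>S'. \<Sum>m'\<in>M'. \<Sum>m\<in>M. A m * A' m' * u * (R m s * P s s' * R' m' s'))"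
    by (intro sum.cong refl, subst sum.swap) (simp add: sum_distrib_left sum_distrib_right mult_ac)
  also have "\<dots> = (\<Sum>m'\<in>M'. \<Sum>s\<in>S. \<Sum>s'\<in>S'. \<Sum>m\<in>M. A m * A' m' * u * (R m s * P s s' * R' m' s'))"
    by (rule sum_rotate[symmetric])
  also have "\<dots> = (\<Sum>m'\<in>M'. \<Sum>m\<in>M. \<Sum>s\<in>S. \<Sum>s'\<in>S'. A m * A' m' * u * (R m s * P s s' * R' m' s'))"
    by (intro sum.cong refl sum_rotate[symmetric])
  finally show ?thesis by (simp only: sum_distrib_left)
qed

text \<open>Induction on the number of factors: a configuration splits off its last entry, both
  coupled states unfold once, and the product matrix factorizes.\<close>

lemma coupled_elem_eq_sum:
  assumes "1 \<le> n" "a 1 = j 1" "a' 1 = j 1" "m \<in> mags (a n)" "m' \<in> mags (a' n)"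
  shows "(\<Sum>s\<in>configs n j. \<Sum>s'\<in>configs n j. coupled_real j a n m s * (\<Prod>k\<in>{1..n}. U k (s k) (s' k)) * coupled_real j a' n m' s')
    = coupled_elem j a a' U n m m'"
  using assms(1,4,5)
proof (induction n arbitrary: m m' rule: dec_induct)
  case base
  have c0: "configs 0 j = {\<lambda>_. undefined}" by (simp add: configs_def)
  have "(\<Sum>x\<in>mags (j 1). \<Sum>y\<in>mags (j 1). of_bool (x = m) * U 1 x y * of_bool (y = m'))
    = (\<Sum>x\<in>{m}. \<Sum>y\<in>mags (j 1). of_bool (x = m) * U 1 x y * of_bool (y = m'))"
    using base assms(2) by (intro sum.mono_neutral_right) auto
  also have "\<dots> = (\<Sum>x\<in>{m}. \<Sum>y\<in>{m'}. of_bool (x = m) * U 1 x y * of_bool (y = m'))"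
    using base assms(3) by (intro sum.cong refl sum.mono_neutral_right) auto
  finally show ?case by (simp add: sum_configs_Suc c0)
next
  case (step n)
  then obtain k where k: "n = Suc k" by (cases n) auto
  let ?n = "Suc n"
  have up: "coupled_real j b ?n M (s(?n := x)) = (\<Sum>m\<in>mags (b n). cg (b n) m (j ?n) x (b ?n) M * coupled_real j b n m s)" for b M s x
    using coupled_real_cong[of n "s(?n := x)" s j b] by (simp add: k)
  have pr: "(\<Prod>k\<in>{1..?n}. U k ((s(?n := x)) k) ((s'(?n := y)) k)) = U ?n x y * (\<Prod>k\<in>{1..n}. U k (s k) (s' k))" for s s' x y
  proof -
    have e: "{1..Suc n} = insert (Suc n) {1..n}" by auto
    show ?thesis unfolding e by (subst prod.insert) (auto intro!: prod.cong)
  qed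
  let ?g = "\<lambda>x s y s'. (\<Sum>m0\<in>mags (a n). cg (a n) m0 (j ?n) x (a ?n) m * coupled_real j a n m0 s)
        * (U ?n x y * (\<Prod>k\<in>{1..n}. U k (s k) (s' k)))
        * (\<Sum>m1\<in>mags (a' n). cg (a' n) m1 (j ?n) y (a' ?n) m' * coupled_real j a' n m1 s')"
  have "(\<Sum>s\<in>configs ?n j. \<Sum>s'\<in>configs ?n j. coupled_real j a ?n m s * (\<Prod>k\<in>{1..?n}. U k (s k) (s' k)) * coupled_real j a' ?n m' s')
    = (\<Sum>x\<in>mags (j ?n). \<Sum>s\<in>configs n j. \<Sum>y\<in>mags (j ?n). \<Sum>s'\<in>configs n j. ?g x s y s')"
    unfolding sum_configs_Suc up pr ..
  also have "\<dots> = (\<Sum>x\<in>mags (j ?n). \<Sum>y\<in>mags (j ?n). \<Sum>s\<in>configs n j. \<Sum>s'\<in>configs n j. ?g x s y s')"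
    by (intro sum.cong refl sum.swap)
  also have "\<dots> = couple_elem (a n) (a' n) (j ?n) (a ?n) (a' ?n) (U ?n) (coupled_elem j a a' U n) m m'"
    unfolding sum_bilinear couple_elem_def using step.IH by (intro sum.cong refl) simp
  finally show ?case using coupled_elem_Suc[of n j a a' U] step.hyps by simp
qed

section \<open>The recoupling chain\<close>

lemma phase_Ints: "x \<in> \<int> \<Longrightarrow> phase x = of_real (sign_int x)"
  by (auto simp: phase_int sign_int_def elim!: Ints_cases)

lemma phase_1: "phase 1 = - 1"
  using phase_int[of 1] by simp

lemma phase_0: "phase 0 = 1"
  using phase_int[of 0] by simp

lemma phase_eqI: "k \<in> \<int> \<Longrightarrow> x = y + 2 * k \<Longrightarrow> phase x = phase y"
  by (simp add: phase_add phase_Ints sign_int_double)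

text \<open>This and the next two lemmas bring the symbols delivered by the triangles into the
  arrangement with \<open>1\<close> at the lower left.\<close>

lemma sixj_recouple_first:
  assumes "spin a" "spin a'" "spin j" "spin b" "spin b'"
  shows "sixj b 1 b' a' j a = sixj j a' b' 1 b a"
  using sixj_upside12[OF spin_1 assms(4,5,3,2,1)] sixj_swap12[OF assms(4) spin_1 assms(5,2,3,1)] by simp

text \<open>Exchanging the outer columns shows that \<open>b\<close> and \<open>b'\<close> play
  symmetric roles. The first form is used at \<open>J\<close>, the second at
  \<open>I\<close>.\<close>

lemma sixj_recouple_last:
  assumes "spin a" "spin j" "spin b" "spin b'"
  shows "sixj b 1 b' j a j = sixj a j b' 1 b j" "sixj b 1 b' j a j = sixj a j b 1 b' j"
proof -
  have *: "sixj b 1 b' j a j = sixj a j b' 1 b j" if "spin b" "spin b'" for b b'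
    using sixj_upside12[OF spin_1 that assms(1,2,2)] sixj_swap12[OF that(1) spin_1 that(2) assms(2,1,2)] by simp
  show "sixj b 1 b' j a j = sixj a j b' 1 b j" using * assms by blast
  have "sixj b 1 b' j a j = sixj b' 1 b j a j"
    using sixj_swap12[OF assms(3) spin_1 assms(4,2,1,2)] sixj_swap23[OF spin_1 assms(3,4,1,2,2)]
      sixj_swap12[OF assms(4) spin_1 assms(3,2,1,2)] by simp
  then show "sixj b 1 b' j a j = sixj a j b 1 b' j" using * assms by simp
qed

lemma sixj_scalar:
  assumes "spin a" "spin a'" "spin j" "spin b"
  shows "sixj a' j b j a 1 = sixj b j a' 1 a j" "sixj a' j b j a 1 = sixj b j a 1 a' j"
proof -
  have *: "sixj a' j b j a 1 = sixj b j a' 1 a j" if "spin a" "spin a'" for a a'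
    using sixj_swap12[OF that(2) assms(3,4) assms(3) that(1) spin_1] sixj_swap23[OF assms(3) that(2) assms(4) that(1) assms(3) spin_1]
      sixj_swap12[OF assms(3,4) that(2,1) spin_1 assms(3)] by simp
  show "sixj a' j b j a 1 = sixj b j a' 1 a j" using * assms by blast
  have "sixj a' j b j a 1 = sixj j a b a' j 1"
    using sixj_upside12[OF assms(3,1,4,2,3) spin_1] .
  also have "\<dots> = sixj a j b j a' 1" using sixj_swap12[OF assms(1,3,4,3,2) spin_1] .
  finally show "sixj a' j b j a 1 = sixj b j a 1 a' j" using * assms by simp
qed

lemma coupled_spins:
  fixes j a :: "nat \<Rightarrow> real" and n N :: nat
  assumes "\<And>n. n \<in> {1..N} \<Longrightarrow> spin (j n)" "a 1 = j 1"
    and "\<And>n. n \<in> {2..N} \<Longrightarrow> triad (a (n - 1)) (j n) (a n)" "1 \<le> n" "n \<le> N"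
  shows "spin (a n)"
  using assms(4,5)
proof (induction n rule: dec_induct)
  case base then show ?case using assms(1)[of 1] assms(2) by simp
next
  case (step n)
  then show ?case using triad_imp_spin[OF assms(3)[of "Suc n"]] assms(1)[of "Suc n"] by auto
qed

text \<open>Two coupling histories over the same spins: \<open>a\<close> belongs to the bra and
  \<open>a'\<close> to the ket.\<close>

locale recoupling_pair =
  fixes N I J K :: nat and j a a' :: "nat \<Rightarrow> real"
  assumes spin_j: "\<And>n. n \<in> {1..N} \<Longrightarrow> spin (j n)"
    and idx: "1 < I" "I < J" "J < K" "K \<le> N"
    and init: "a 1 = j 1" "a' 1 = j 1"
    and tri: "\<And>n. n \<in> {2..N} \<Longrightarrow> triad (a (n - 1)) (j n) (a n)"
    and tri': "\<And>n. n \<in> {2..N} \<Longrightarrow> triad (a' (n - 1)) (j n) (a' n)"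
begin

lemma spin_a: "1 \<le> n \<Longrightarrow> n \<le> N \<Longrightarrow> spin (a n)"
  and spin_a': "1 \<le> n \<Longrightarrow> n \<le> N \<Longrightarrow> spin (a' n)"
  using coupled_spins[of N j] spin_j init tri tri' by blast+

lemma spins_Suc:
  assumes "1 \<le> n" "Suc n \<le> N"
  shows "spin (a n)" "spin (a' n)" "spin (j (Suc n))" "spin (a (Suc n))" "spin (a' (Suc n))"
    "triad (a n) (j (Suc n)) (a (Suc n))" "triad (a' n) (j (Suc n)) (a' (Suc n))"
  using assms spin_a spin_a' spin_j tri[of "Suc n"] tri'[of "Suc n"] by auto

definition idm :: "real \<Rightarrow> real \<Rightarrow> real" where "idm = (\<lambda>x y. of_bool (x = y))"

lemma coupled_elem_id:
  assumes "\<And>k. k \<in> {1..n} \<Longrightarrow> U k = idm" "1 \<le> n" "n \<le> N" "m \<in> mags (a n)" "m' \<in> mags (a' n)"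
  shows "coupled_elem j a a' U n m m' = of_bool ((\<forall>k\<in>{2..n}. a k = a' k) \<and> m = m')"
  using assms(2,3,1,4,5)
proof (induction n arbitrary: m m' rule: dec_induct)
  case base then show ?case by (simp add: idm_def)
next
  case (step n)
  note sp = spins_Suc[of n]
  have e: "{2..Suc n} = insert (Suc n) {2..n}" using step.hyps by auto
  have "coupled_elem j a a' U (Suc n) m m'
    = couple_elem (a n) (a' n) (j (Suc n)) (a (Suc n)) (a' (Suc n)) (\<lambda>x y. of_bool (x = y))
        (\<lambda>m m'. of_bool (\<forall>k\<in>{2..n}. a k = a' k) * of_bool (m = m')) m m'"
    unfolding coupled_elem_Suc[OF step.hyps(1)]
    using step by (intro couple_elem_cong) (auto simp: idm_def)
  also have "\<dots> = of_bool (\<forall>k\<in>{2..n}. a k = a' k) *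
     couple_elem (a n) (a' n) (j (Suc n)) (a (Suc n)) (a' (Suc n)) (\<lambda>x y. of_bool (x = y)) (\<lambda>m m'. of_bool (m = m')) m m'"
    by (rule couple_elem_scale)
  also have "\<dots> = of_bool ((\<forall>k\<in>{2..Suc n}. a k = a' k) \<and> m = m')"
  proof (cases "\<forall>k\<in>{2..n}. a k = a' k")
    case True
    \<comment> \<open>For \<open>n = 1\<close> the range of compared spins is empty, and equality
      comes from the common start \<open>j 1\<close>.\<close>
    then have "a' n = a n" using init step.hyps by (cases "n = 1") auto
    then show ?thesis
      using couple_elem_id[of "a n" "j (Suc n)" "a (Suc n)" "a' (Suc n)" m m'] sp step True
      unfolding e by auto
  qed (auto simp: e)
  finally show ?case .
qed

definition step_factor :: "nat \<Rightarrow> real" where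
  "step_factor n = sign_int (a (n - 1) + j n + a' n + 1) * sqrt (2 * a n + 1) * sqrt (2 * a' n + 1)
    * sixj (a n) 1 (a' n) (a' (n - 1)) (j n) (a (n - 1))"

text \<open>What site \<open>I\<close> creates from the identity on the preceding factors. The
  deltas below \<open>I\<close> are included because \<open>sixj\<close> names only the bra's spin
  \<open>a (I - 1)\<close>.\<close>

definition source_factor :: real where
  "source_factor = of_bool (\<forall>k\<in>{2..I - 1}. a k = a' k) * (red_elem (j I) * sign_int (a (I - 1) + j I + a I + 1)
    * sqrt (2 * a I + 1) * sqrt (2 * a' I + 1) * sixj (a I) 1 (a' I) (j I) (a (I - 1)) (j I))"

lemma vec_elem_step:
  assumes n: "1 \<le> n" "Suc n \<le> N" and U: "T = idm"
    and B: "\<And>m m'. m \<in> mags (a n) \<Longrightarrow> m' \<in> mags (a' n) \<Longrightarrow> B m m' = c * vec_elem (a n) (a' n) m q m'"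
  shows "couple_elem (a n) (a' n) (j (Suc n)) (a (Suc n)) (a' (Suc n)) T B M M'
    = c * step_factor (Suc n) * vec_elem (a (Suc n)) (a' (Suc n)) M q M'"
    (is "?lhs = ?rhs")
proof -
  note sp = spins_Suc[OF n]
  have "?lhs = couple_elem (a n) (a' n) (j (Suc n)) (a (Suc n)) (a' (Suc n)) (\<lambda>x y. of_bool (x = y))
       (\<lambda>m m'. c * vec_elem (a n) (a' n) m q m') M M'"
    using B U by (intro couple_elem_cong) (auto simp: idm_def)
  also have "\<dots> = ?rhs"
    unfolding couple_elem_scale couple_elem_vec_first[OF sp] by (simp add: step_factor_def mult_ac)
  finally show ?thesis .
qed

abbreviation "left_factor \<equiv> source_factor * (\<Prod>k\<in>{I+1..J-1}. step_factor k)"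

lemma coupled_elem_source:
  assumes U: "\<And>k. k \<in> {1..n} \<Longrightarrow> k \<noteq> I \<Longrightarrow> U k = idm" "U I = sph_elem (j I) q" and n: "I \<le> n" "n \<le> N"
    and m: "m \<in> mags (a n)" "m' \<in> mags (a' n)"
  shows "coupled_elem j a a' U n m m' = source_factor * (\<Prod>k\<in>{I+1..n}. step_factor k) * vec_elem (a n) (a' n) m q m'"
  using n U(1) m
proof (induction n arbitrary: m m' rule: dec_induct)
  case base
  obtain i where i: "I = Suc i" "1 \<le> i" using idx by (cases I) auto
  have i1: "I - 1 = i" "I \<le> N" using i(1) idx by auto
  note sp = spins_Suc[of i, OF i(2), folded i(1), OF i1(2)]
  have "coupled_elem j a a' U I m m'
    = couple_elem (a i) (a' i) (j I) (a I) (a' I) (sph_elem (j I) q)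
        (\<lambda>m m'. of_bool (\<forall>k\<in>{2..i}. a k = a' k) * of_bool (m = m')) m m'"
    unfolding coupled_elem_Suc[OF i(2), folded i(1)] U(2)
    using i base coupled_elem_id[of i U] by (intro couple_elem_cong) auto
  also have "\<dots> = of_bool (\<forall>k\<in>{2..i}. a k = a' k) *
     couple_elem (a i) (a' i) (j I) (a I) (a' I) (sph_elem (j I) q) (\<lambda>m m'. of_bool (m = m')) m m'"
    by (rule couple_elem_scale)
  also have "\<dots> = source_factor * vec_elem (a I) (a' I) m q m'"
  proof (cases "\<forall>k\<in>{2..i}. a k = a' k")
    case True
    then have e: "a' i = a i" using init i by (cases "i = 1") auto
    show ?thesis
      using True couple_elem_sph_last[OF sp(1,3,4,5,6) sp(7)[unfolded e], of q m m']
      unfolding e source_factor_def i1 by simp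
  next
    case False
    then show ?thesis unfolding source_factor_def i1 by auto
  qed
  finally show ?case by simp
next
  case (step n)
  have n: "1 \<le> n" using step.hyps idx by simp
  have "{I+1..Suc n} = insert (Suc n) {I+1..n}" using step.hyps by auto
  then have pr: "(\<Prod>k\<in>{I+1..Suc n}. step_factor k) = (\<Prod>k\<in>{I+1..n}. step_factor k) * step_factor (Suc n)"
    by simp
  show ?case
    unfolding coupled_elem_Suc[OF n] pr mult.assoc[symmetric]
    by (rule vec_elem_step[OF n]) (use step in auto)
qed

definition target_factor :: real where
  "target_factor = red_elem (j K) * sign_int (a' (K - 1) + j K + a K) * sixj (a' (K - 1)) (j K) (a K) (j K) (a (K - 1)) 1"

text \<open>\<open>q\<close> is the index contracted between \<open>I\<close> and \<open>J\<close>,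
  and \<open>p\<close> the one between \<open>J\<close> and \<open>K\<close>. The order of the two
  components at \<open>J\<close> is left open in \<open>T\<close>.\<close>

definition site_matrices where
  "site_matrices T q p = (\<lambda>_. idm)(I := sph_elem (j I) q, K := sph_elem (j K) (- p), J := T q p)"

lemma site_matrices_simps:
  "site_matrices T q p I = sph_elem (j I) q" "site_matrices T q p K = sph_elem (j K) (- p)"
  "site_matrices T q p J = T q p" "k \<noteq> I \<Longrightarrow> k \<noteq> J \<Longrightarrow> k \<noteq> K \<Longrightarrow> site_matrices T q p k = idm"
  using idx by (auto simp: site_matrices_def)

text \<open>The rest of the chain sees the matrix at \<open>J\<close> only through the scalar
  \<open>E\<close>, so both operator orders are treated by one argument.\<close>

context
  fixes T :: "real \<Rightarrow> real \<Rightarrow> real \<Rightarrow> real \<Rightarrow> real" and E :: real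
  assumes T: "\<And>p M M'. (\<Sum>q\<in>mags 1. sign_int q * couple_elem (a (J - 1)) (a' (J - 1)) (j J) (a J) (a' J) (T q p)
      (\<lambda>m m'. vec_elem (a (J - 1)) (a' (J - 1)) m q m') M M') = E * vec_elem (a J) (a' J) M p M'"
begin

text \<open>The sum over \<open>q\<close> is carried out at \<open>J\<close>, the last site where
  \<open>q\<close> occurs. The result is again a vector operator, now with component
  \<open>p\<close>, and it propagates as before.\<close>

lemma sum_coupled_elem_middle:
  assumes n: "J \<le> n" "n \<le> K - 1" and m: "m \<in> mags (a n)" "m' \<in> mags (a' n)"
  shows "(\<Sum>q\<in>mags 1. sign_int q * coupled_elem j a a' (site_matrices T q p) n m m')
    = left_factor * E * (\<Prod>k\<in>{J+1..n}. step_factor k) * vec_elem (a n) (a' n) m p m'"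
  using n m
proof (induction n arbitrary: m m' rule: dec_induct)
  case base
  obtain i where i: "J = Suc i" "1 \<le> i" "I \<le> i" using idx by (cases J) auto
  have iJ: "J - 1 = i" and iN: "i \<le> N" using i(1) idx by auto
  let ?c = "left_factor"
  have 1: "coupled_elem j a a' (site_matrices T q p) J m m'
    = ?c * couple_elem (a i) (a' i) (j J) (a J) (a' J) (T q p) (\<lambda>m m'. vec_elem (a i) (a' i) m q m') m m'" for q
  proof -
    have "coupled_elem j a a' (site_matrices T q p) J m m'
      = couple_elem (a i) (a' i) (j J) (a J) (a' J) (T q p) (\<lambda>m m'. ?c * vec_elem (a i) (a' i) m q m') m m'"
      unfolding coupled_elem_Suc[OF i(2), folded i(1)] site_matrices_simps(3)
    proof (intro couple_elem_cong refl)
      fix m m' assume m: "m \<in> mags (a i)" "m' \<in> mags (a' i)"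
      have U: "site_matrices T q p k = idm" if "k \<in> {1..i}" "k \<noteq> I" for k
        using that i idx by (intro site_matrices_simps) auto
      show "coupled_elem j a a' (site_matrices T q p) i m m'
        = left_factor * vec_elem (a i) (a' i) m q m'"
        unfolding iJ by (rule coupled_elem_source[where U = "site_matrices T q p", OF U site_matrices_simps(1) i(3) iN m])
    qed
    then show ?thesis by (simp only: couple_elem_scale)
  qed
  have "(\<Sum>q\<in>mags 1. sign_int q * coupled_elem j a a' (site_matrices T q p) J m m')
    = ?c * (\<Sum>q\<in>mags 1. sign_int q * couple_elem (a i) (a' i) (j J) (a J) (a' J) (T q p) (\<lambda>m m'. vec_elem (a i) (a' i) m q m') m m')"
    unfolding 1 sum_distrib_left by (intro sum.cong refl) (simp add: mult_ac)
  also have "\<dots> = ?c * (E * vec_elem (a J) (a' J) m p m')"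
    using T[of p m m'] unfolding iJ by simp
  finally show ?case by (simp add: mult_ac)
next
  case (step n)
  have n: "1 \<le> n" "Suc n \<le> N" using step idx by auto
  have "{J+1..Suc n} = insert (Suc n) {J+1..n}" using step.hyps by auto
  then have pr: "(\<Prod>k\<in>{J+1..Suc n}. step_factor k) = (\<Prod>k\<in>{J+1..n}. step_factor k) * step_factor (Suc n)"
    by simp
  have U: "site_matrices T q p (Suc n) = idm" for q
    using step idx by (intro site_matrices_simps) auto
  \<comment> \<open>The index \<open>0\<close> is a placeholder: at this site the matrix is
    \<open>idm\<close> for every \<open>q\<close>.\<close>
  have "(\<Sum>q\<in>mags 1. sign_int q * coupled_elem j a a' (site_matrices T q p) (Suc n) m m')
    = couple_elem (a n) (a' n) (j (Suc n)) (a (Suc n)) (a' (Suc n)) (site_matrices T 0 p (Suc n))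
      (\<lambda>m m'. \<Sum>q\<in>mags 1. sign_int q * coupled_elem j a a' (site_matrices T q p) n m m') m m'"
    unfolding coupled_elem_Suc[OF n(1)] U by (rule couple_elem_lincomb)
  also have "\<dots> = left_factor * E * (\<Prod>k\<in>{J+1..n}. step_factor k)
      * step_factor (Suc n) * vec_elem (a (Suc n)) (a' (Suc n)) m p m'"
    by (rule vec_elem_step[OF n U]) (use step in auto)
  finally show ?case unfolding pr by (simp only: mult.assoc)
qed

text \<open>At \<open>K\<close> the sum over \<open>p\<close> leaves a multiple of the identity, so
  every later coupling adds one more delta.\<close>

lemma sum_coupled_elem:
  assumes n: "K \<le> n" "n \<le> N" and m: "m \<in> mags (a n)" "m' \<in> mags (a' n)"
  shows "(\<Sum>p\<in>mags 1. sign_int p * (\<Sum>q\<in>mags 1. sign_int q * coupled_elem j a a' (site_matrices T q p) n m m'))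
    = left_factor * E * (\<Prod>k\<in>{J+1..K-1}. step_factor k)
      * target_factor * of_bool ((\<forall>k\<in>{K..n}. a k = a' k) \<and> m = m')"
  using n m
proof (induction n arbitrary: m m' rule: dec_induct)
  case base
  obtain i where i: "K = Suc i" "1 \<le> i" "J \<le> i" using idx by (cases K) auto
  have iK: "K - 1 = i" using i(1) by simp
  note sp = spins_Suc[of i, OF i(2), folded i(1), OF idx(4)]
  let ?c = "left_factor * E * (\<Prod>k\<in>{J+1..K-1}. step_factor k)"
  have 1: "(\<Sum>q\<in>mags 1. sign_int q * coupled_elem j a a' (site_matrices T q p) K m m')
    = ?c * couple_elem (a i) (a' i) (j K) (a K) (a' K) (sph_elem (j K) (- p)) (\<lambda>m m'. vec_elem (a i) (a' i) m p m') m m'" for p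
  proof -
    have "(\<Sum>q\<in>mags 1. sign_int q * coupled_elem j a a' (site_matrices T q p) K m m')
      = couple_elem (a i) (a' i) (j K) (a K) (a' K) (sph_elem (j K) (- p))
      (\<lambda>m m'. \<Sum>q\<in>mags 1. sign_int q * coupled_elem j a a' (site_matrices T q p) i m m') m m'"
      unfolding coupled_elem_Suc[OF i(2), folded i(1)] site_matrices_simps(2)
      by (rule couple_elem_lincomb)
    also have "\<dots> = couple_elem (a i) (a' i) (j K) (a K) (a' K) (sph_elem (j K) (- p))
      (\<lambda>m m'. ?c * vec_elem (a i) (a' i) m p m') m m'"
      unfolding iK using i by (intro couple_elem_cong refl sum_coupled_elem_middle) auto
    finally show ?thesis by (simp only: couple_elem_scale)
  qed
  have "(\<Sum>p\<in>mags 1. sign_int p * (\<Sum>q\<in>mags 1. sign_int q * coupled_elem j a a' (site_matrices T q p) K m m'))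
    = ?c * (\<Sum>p\<in>mags 1. sign_int p * couple_elem (a i) (a' i) (j K) (a K) (a' K) (sph_elem (j K) (- p)) (\<lambda>m m'. vec_elem (a i) (a' i) m p m') m m')"
    unfolding 1 sum_distrib_left by (intro sum.cong refl) (simp add: mult_ac)
  also have "\<dots> = ?c * (target_factor * of_bool (a K = a' K \<and> m = m'))"
    using couple_elem_scalar[OF sp base(2), of m'] unfolding target_factor_def iK by simp
  finally show ?case by (simp add: mult_ac)
next
  case (step n)
  have n: "1 \<le> n" "Suc n \<le> N" using step idx by auto
  note sp = spins_Suc[OF n]
  let ?c = "left_factor * E * (\<Prod>k\<in>{J+1..K-1}. step_factor k) * target_factor"
  have e: "{K..Suc n} = insert (Suc n) {K..n}" using step.hyps by auto
  have U: "site_matrices T q p (Suc n) = idm" for q p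
    using step idx by (intro site_matrices_simps) auto
  have "(\<Sum>p\<in>mags 1. sign_int p * (\<Sum>q\<in>mags 1. sign_int q * coupled_elem j a a' (site_matrices T q p) (Suc n) m m'))
    = couple_elem (a n) (a' n) (j (Suc n)) (a (Suc n)) (a' (Suc n)) idm
      (\<lambda>m m'. \<Sum>p\<in>mags 1. sign_int p * (\<Sum>q\<in>mags 1. sign_int q * coupled_elem j a a' (site_matrices T q p) n m m')) m m'"
    unfolding coupled_elem_Suc[OF n(1)] U couple_elem_lincomb ..
  also have "\<dots> = couple_elem (a n) (a' n) (j (Suc n)) (a (Suc n)) (a' (Suc n)) (\<lambda>x y. of_bool (x = y))
      (\<lambda>m m'. (?c * of_bool (\<forall>k\<in>{K..n}. a k = a' k)) * of_bool (m = m')) m m'"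
    using step by (intro couple_elem_cong) (auto simp: idm_def)
  also have "\<dots> = ?c * of_bool (\<forall>k\<in>{K..n}. a k = a' k) *
      couple_elem (a n) (a' n) (j (Suc n)) (a (Suc n)) (a' (Suc n)) (\<lambda>x y. of_bool (x = y)) (\<lambda>m m'. of_bool (m = m')) m m'"
    by (rule couple_elem_scale)
  also have "\<dots> = ?c * of_bool ((\<forall>k\<in>{K..Suc n}. a k = a' k) \<and> m = m')"
  proof (cases "\<forall>k\<in>{K..n}. a k = a' k")
    case True
    then have "a' n = a n" using step.hyps by auto
    then show ?thesis
      using couple_elem_id[of "a n" "j (Suc n)" "a (Suc n)" "a' (Suc n)" m m'] sp step.prems True
      unfolding e by auto
  qed (auto simp: e)
  finally show ?case .
qed

end

end

section \<open>The matrix element\<close>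

context recoupling_pair
begin

text \<open>The matrices are inserted in the order \<open>I\<close>, \<open>K\<close>,
  \<open>J\<close>, as in \<open>site_matrices\<close>; every site still carries the identity when
  its turn comes.\<close>

lemma site_ops_eq_tensor_op:
  assumes s: "s \<in> configs N j"
  shows "site_op j J (\<lambda>x y. of_real (T x y)) (site_op j K (\<lambda>x y. of_real (V x y))
      (site_op j I (\<lambda>x y. of_real (W x y)) \<psi>)) s = tensor_op N j ((\<lambda>_. idm)(I := W, K := V, J := T)) \<psi> s"
proof -
  have n: "I \<in> {1..N}" "J \<in> {1..N}" "K \<in> {1..N}" "I \<noteq> J" "J \<noteq> K" "I \<noteq> K" using idx by auto
  have 0: "\<psi> s = tensor_op N j (\<lambda>_. idm) \<psi> s" if "s \<in> configs N j" for s
    using tensor_op_id[OF that] by (simp add: idm_def)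
  have 1: "site_op j I (\<lambda>x y. of_real (W x y)) \<psi> s = tensor_op N j ((\<lambda>_. idm)(I := W)) \<psi> s" if "s \<in> configs N j" for s
    using site_op_cong[OF that n(1) 0 refl] site_op_tensor_op[OF that n(1), of "\<lambda>_. idm"] by (simp add: idm_def)
  have 2: "site_op j K (\<lambda>x y. of_real (V x y)) (site_op j I (\<lambda>x y. of_real (W x y)) \<psi>) s
      = tensor_op N j ((\<lambda>_. idm)(I := W, K := V)) \<psi> s" if "s \<in> configs N j" for s
    using site_op_cong[OF that n(3) 1 refl] site_op_tensor_op[OF that n(3), of "(\<lambda>_. idm)(I := W)"] n
    by (simp add: idm_def)
  show ?thesis
    using site_op_cong[OF s n(2) 2 refl] site_op_tensor_op[OF s n(2), of "(\<lambda>_. idm)(I := W, K := V)"] n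
    by (simp add: idm_def)
qed

lemma site_op_sum_on_configs:
  assumes s: "s \<in> configs N j" and n: "k \<in> {1..N}" "n \<in> {1..N}"
    and \<phi>: "\<And>s. s \<in> configs N j \<Longrightarrow> \<phi> s = (\<Sum>p\<in>Q. c p * \<eta> p s)"
  shows "site_op j k A (site_op j n B \<phi>) s = (\<Sum>p\<in>Q. c p * site_op j k A (site_op j n B (\<eta> p)) s)"
proof -
  have 1: "site_op j n B \<phi> s = (\<Sum>p\<in>Q. c p * site_op j n B (\<eta> p) s)" if "s \<in> configs N j" for s
    unfolding site_op_sum[symmetric] by (rule site_op_cong[OF that n(2) \<phi> refl])
  show ?thesis
    using site_op_cong[OF s n(1) 1 refl, where T = A] by (simp only: site_op_sum)
qed

definition mat_ij_jk where
  "mat_ij_jk q p = (\<lambda>x y. \<Sum>z\<in>mags (j J). sph_elem (j J) (- q) x z * sph_elem (j J) p z y)"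

definition mat_jk_ij where
  "mat_jk_ij q p = (\<lambda>x y. \<Sum>z\<in>mags (j J). sph_elem (j J) p x z * sph_elem (j J) (- q) z y)"

text \<open>Operators on different sites commute, so the two components at \<open>J\<close> can be
  made adjacent and multiplied as matrices; their order alone distinguishes the two
  products.\<close>

lemma dot_ops_eq_tensor_op:
  assumes s: "s \<in> configs N j"
  shows "dot_op j I J (dot_op j J K \<psi>) s = (\<Sum>p\<in>mags 1. of_real (sign_int p) *
      (\<Sum>q\<in>mags 1. of_real (sign_int q) * tensor_op N j (site_matrices mat_ij_jk q p) \<psi> s))"
    and "dot_op j J K (dot_op j I J \<psi>) s = (\<Sum>p\<in>mags 1. of_real (sign_int p) *
      (\<Sum>q\<in>mags 1. of_real (sign_int q) * tensor_op N j (site_matrices mat_jk_ij q p) \<psi> s))"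
proof -
  let ?R = "\<lambda>T. (\<Sum>p\<in>mags 1. of_real (sign_int p) *
      (\<Sum>q\<in>mags 1. of_real (sign_int q) * tensor_op N j (site_matrices T q p) \<psi> s))"
  have n: "I \<in> {1..N}" "J \<in> {1..N}" "K \<in> {1..N}" "I \<noteq> J" "J \<noteq> K" "I \<noteq> K" using idx by auto
  have sp: "spin (j I)" "spin (j J)" "spin (j K)" using n spin_j by auto
  have same: "sph_op j J q (sph_op j J p \<phi>)
    = site_op j J (\<lambda>x y. of_real (\<Sum>z\<in>mags (j J). sph_elem (j J) q x z * sph_elem (j J) p z y)) \<phi>" for q p \<phi>
    by (simp add: fun_eq_iff site_op_same)
  have com: "site_op j k A (site_op j l B \<phi>) = site_op j l B (site_op j k A \<phi>)" if "k \<noteq> l" for k l A B \<phi>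
    using site_op_commute[OF that] by (simp add: fun_eq_iff)
  have 1: "sph_op j I q (sph_op j J (- q) (sph_op j J p (sph_op j K (- p) \<psi>))) s
    = tensor_op N j (site_matrices mat_ij_jk q p) \<psi> s" for q p
    unfolding same com[OF n(4)] com[OF n(6)] site_ops_eq_tensor_op[OF s] by (simp add: site_matrices_def mat_ij_jk_def)
  have 2: "sph_op j J p (sph_op j K (- p) (sph_op j I q (sph_op j J (- q) \<psi>))) s
    = tensor_op N j (site_matrices mat_jk_ij q p) \<psi> s" for q p
    unfolding com[OF n(4)] com[OF n(5)[symmetric]] same site_ops_eq_tensor_op[OF s]
    by (simp add: site_matrices_def mat_jk_ij_def)
  have "dot_op j I J (dot_op j J K \<psi>) s = (\<Sum>q\<in>mags 1. of_real (sign_int q) *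
      (\<Sum>p\<in>mags 1. of_real (sign_int p) * sph_op j I q (sph_op j J (- q) (sph_op j J p (sph_op j K (- p) \<psi>))) s))"
    unfolding dot_op_spherical[OF s n(1,2,4) sp(1,2)]
    by (intro sum.cong refl arg_cong[where f = "(*) _"] site_op_sum_on_configs[OF s n(1,2)]
        dot_op_spherical[OF _ n(2,3,5) sp(2,3)])
  also have "\<dots> = ?R mat_ij_jk"
    unfolding 1 sum_distrib_left by (subst sum.swap) (simp add: mult.left_commute)
  finally show "dot_op j I J (dot_op j J K \<psi>) s = \<dots>" .
  have "dot_op j J K (dot_op j I J \<psi>) s = (\<Sum>p\<in>mags 1. of_real (sign_int p) *
      (\<Sum>q\<in>mags 1. of_real (sign_int q) * sph_op j J p (sph_op j K (- p) (sph_op j I q (sph_op j J (- q) \<psi>))) s))"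
    unfolding dot_op_spherical[OF s n(2,3,5) sp(2,3)]
    by (intro sum.cong refl arg_cong[where f = "(*) _"] site_op_sum_on_configs[OF s n(2,3)]
        dot_op_spherical[OF _ n(1,2,4) sp(1,2)])
  then show "dot_op j J K (dot_op j I J \<psi>) s = ?R mat_jk_ij"
    unfolding 2 .
qed

lemma sum_coupled_tensor_op:
  assumes "a N = 0" "a' N = 0"
  shows "(\<Sum>s\<in>configs N j. cnj (coupled j a N 0 s) * tensor_op N j U (coupled j a' N 0) s)
    = of_real (coupled_elem j a a' U N 0 0)"
proof -
  have c: "coupled j b N 0 s = of_real (coupled_real j b N 0 s)" if "s \<in> configs N j" for b s
    using configs_mags[OF that] by (intro coupled_eq_coupled_real) auto
  have "coupled_elem j a a' U N 0 0 = (\<Sum>s\<in>configs N j. \<Sum>s'\<in>configs N j.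
      coupled_real j a N 0 s * (\<Prod>k\<in>{1..N}. U k (s k) (s' k)) * coupled_real j a' N 0 s')"
    using coupled_elem_eq_sum[of N a j a' 0 0 U] assms idx init by simp
  then show ?thesis
    unfolding tensor_op_def by (simp add: c sum_distrib_left mult.assoc cong: sum.cong)
qed

definition bracket_ij_jk :: real where
  "bracket_ij_jk = - ((red_elem (j J))\<^sup>2 * sqrt (2 * a J + 1) * sqrt (2 * a' J + 1)
    * sixj (a' (J - 1)) (j J) (a J) (j J) (a (J - 1)) 1 * sixj (a J) 1 (a' J) (j J) (a' (J - 1)) (j J))"

definition bracket_jk_ij :: real where
  "bracket_jk_ij = (red_elem (j J))\<^sup>2 * (sign_int (a' (J - 1) + j J + a' J) * sign_int (a (J - 1) + j J + a J + 1))
    * sqrt (2 * a J + 1) * sqrt (2 * a' J + 1)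
    * sixj (a (J - 1)) (j J) (a' J) (j J) (a' (J - 1)) 1 * sixj (a J) 1 (a' J) (j J) (a (J - 1)) (j J)"

lemma braket_q_hat:
  assumes 0: "a N = 0" "a' N = 0"
  shows "braket N j (basis_vec N j a) (q_hat j I J K (basis_vec N j a'))
    = of_real (4 * (left_factor * (bracket_ij_jk - bracket_jk_ij)
        * (\<Prod>k\<in>{J+1..K-1}. step_factor k) * target_factor * of_bool (\<forall>k\<in>{K..N}. a k = a' k)))"
    (is "?lhs = _")
proof -
  have n: "I \<in> {1..N}" "J \<in> {1..N}" "K \<in> {1..N}" "I \<noteq> J" "J \<noteq> K" using idx by auto
  have sp: "spin (j I)" "spin (j J)" "spin (j K)" using n spin_j by auto
  have "J = Suc (J - 1)" "1 \<le> J - 1" using idx by auto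
  then have spJ: "spin (a (J - 1))" "spin (a' (J - 1))" "spin (j J)" "spin (a J)" "spin (a' J)"
    "triad (a (J - 1)) (j J) (a J)" "triad (a' (J - 1)) (j J) (a' J)"
    using spins_Suc[of "J - 1"] n by auto
  let ?\<psi> = "coupled j a N 0" and ?\<psi>' = "coupled j a' N 0"
  let ?S = "\<lambda>T. \<Sum>p\<in>mags 1. sign_int p * (\<Sum>q\<in>mags 1. sign_int q * coupled_elem j a a' (site_matrices T q p) N 0 0)"
  have lin: "(\<Sum>s\<in>configs N j. cnj (?\<psi> s) * (\<Sum>p\<in>mags 1. of_real (sign_int p) *
      (\<Sum>q\<in>mags 1. of_real (sign_int q) * tensor_op N j (site_matrices T q p) ?\<psi>' s))) = of_real (?S T)" (is "?A = _") for T
  proof -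
    have "?A
      = (\<Sum>s\<in>configs N j. \<Sum>p\<in>mags 1. \<Sum>q\<in>mags 1. of_real (sign_int p) * of_real (sign_int q) *
        (cnj (?\<psi> s) * tensor_op N j (site_matrices T q p) ?\<psi>' s))"
      by (simp add: sum_distrib_left mult_ac)
    also have "\<dots> = (\<Sum>p\<in>mags 1. \<Sum>q\<in>mags 1. of_real (sign_int p) * of_real (sign_int q) *
        (\<Sum>s\<in>configs N j. cnj (?\<psi> s) * tensor_op N j (site_matrices T q p) ?\<psi>' s))"
      by (subst sum_rotate) (simp only: sum_distrib_left)
    also have "\<dots> = of_real (?S T)"
      unfolding sum_coupled_tensor_op[OF 0] by (simp add: sum_distrib_left mult.assoc)
    finally show ?thesis .
  qed
  have "?lhs = 4 * ((\<Sum>s\<in>configs N j. cnj (?\<psi> s) * dot_op j I J (dot_op j J K ?\<psi>') s)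
      - (\<Sum>s\<in>configs N j. cnj (?\<psi> s) * dot_op j J K (dot_op j I J ?\<psi>') s))"
    unfolding braket_def basis_vec_def
    by (simp add: q_hat_eq[OF _ n sp] sum_distrib_left sum_subtractf[symmetric] algebra_simps cong: sum.cong)
  also have "\<dots> = of_real (4 * (?S mat_ij_jk - ?S mat_jk_ij))"
    by (simp add: dot_ops_eq_tensor_op lin cong: sum.cong)
  \<comment> \<open>The conjunct \<open>0 = 0\<close> is the condition \<open>m = m'\<close> of the
    chain at total magnetic number zero.\<close>
  also have "?S mat_ij_jk = left_factor * bracket_ij_jk
      * (\<Prod>k\<in>{J+1..K-1}. step_factor k) * target_factor * of_bool ((\<forall>k\<in>{K..N}. a k = a' k) \<and> (0::real) = 0)"
    by (rule sum_coupled_elem)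
      (use idx 0 couple_elem_scalar_vec[OF spJ] in \<open>auto simp: mat_ij_jk_def bracket_ij_jk_def\<close>)
  also have "?S mat_jk_ij = left_factor * bracket_jk_ij
      * (\<Prod>k\<in>{J+1..K-1}. step_factor k) * target_factor * of_bool ((\<forall>k\<in>{K..N}. a k = a' k) \<and> (0::real) = 0)"
    by (rule sum_coupled_elem)
      (use idx 0 couple_elem_vec_scalar[OF spJ] in \<open>auto simp: mat_jk_ij_def bracket_jk_ij_def\<close>)
  finally show ?thesis by (simp add: algebra_simps)
qed

section \<open>From integer signs to complex phases\<close>

lemma triad_sum_Ints:
  assumes "n \<in> {2..N}"
  shows "a (n - 1) + j n + a n \<in> \<int>" "a' (n - 1) + j n + a' n \<in> \<int>"
  using tri[OF assms] tri'[OF assms] by (auto simp: triad_def)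

lemma triad_1_diff_Ints: "triad x 1 y \<Longrightarrow> spin x \<Longrightarrow> y - x \<in> \<int>"
proof -
  assume t: "triad x 1 y" and x: "spin x"
  have "x + 1 + y \<in> \<int>" using t by (simp add: triad_def)
  from Ints_diff[OF Ints_diff[OF this Ints_1] spin_double_Ints[OF x]] show "y - x \<in> \<int>" by simp
qed

lemma source_factor_eq:
  "of_real source_factor = of_bool (\<forall>k\<in>{2..I - 1}. a k = a' k) * phase (a (I - 1) + j I + a I + 1)
    * of_real (red_elem (j I) * (sqrt (2 * a I + 1) * sqrt (2 * a' I + 1)) * sixj (a (I - 1)) (j I) (a I) 1 (a' I) (j I))"
proof -
  have n: "I \<in> {2..N}" using idx by simp
  have sp: "spin (a (I - 1))" "spin (j I)" "spin (a I)" "spin (a' I)"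
    using idx spin_a[of "I - 1"] spin_a[of I] spin_a'[of I] spin_j[of I] by auto
  have "a (I - 1) + j I + a I + 1 \<in> \<int>" using triad_sum_Ints(1)[OF n] by simp
  then show ?thesis
    unfolding source_factor_def sixj_recouple_last(2)[OF sp] by (simp add: phase_Ints)
qed

definition step_term :: "nat \<Rightarrow> complex" where
  "step_term n = of_real (sqrt ((2 * a' n + 1) * (2 * a n + 1))) * phase (a' (n - 1) + a (n - 1) + 1)
    * of_real (sixj (j n) (a' (n - 1)) (a' n) 1 (a n) (a (n - 1)))"

text \<open>The exponent is rewritten as \<open>j n\<close>, plus a difference of consecutive
  \<open>a'\<close>, plus the exponent shown in the product. The differences telescope, and only
  their end points survive in the overall phase. If the exponent is not an integer the 6j-symbol
  vanishes.\<close>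

lemma step_factor_eq:
  assumes n: "n \<in> {2..N}"
  shows "of_real (step_factor n) = phase (j n) * phase (a' n - a' (n - 1)) * step_term n"
proof -
  have sp: "spin (a (n - 1))" "spin (a' (n - 1))" "spin (j n)" "spin (a n)" "spin (a' n)"
    using n spin_a spin_a' spin_j by auto
  show ?thesis
  proof (cases "sixj (a n) 1 (a' n) (a' (n - 1)) (j n) (a (n - 1)) = 0")
  case True
  show ?thesis using True sixj_recouple_first[OF sp] by (simp add: step_factor_def step_term_def)
next
  case False
  have "a' n - a n \<in> \<int>"
    using triad_1_diff_Ints[OF sixj_nonzeroD(1)[OF False] sp(4)] .
  from Ints_add[OF Ints_add[OF triad_sum_Ints(1)[OF n] this] Ints_1]
  have i: "a (n - 1) + j n + a' n + 1 \<in> \<int>" by (simp add: algebra_simps)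
  have "phase (a (n - 1) + j n + a' n + 1) = phase (j n + (a' n - a' (n - 1)) + (a' (n - 1) + a (n - 1) + 1))"
    by (rule arg_cong[where f = phase]) simp
  also have "\<dots> = phase (j n) * phase (a' n - a' (n - 1)) * phase (a' (n - 1) + a (n - 1) + 1)"
    by (simp only: phase_add)
  finally have p: "of_real (sign_int (a (n - 1) + j n + a' n + 1)) = \<dots>"
    unfolding phase_Ints[OF i] .
  show ?thesis
    unfolding step_factor_def step_term_def sixj_recouple_first[OF sp] of_real_mult p real_sqrt_mult by (simp add: mult_ac)
  qed
qed

lemma prod_step_factor_eq:
  assumes "1 \<le> u" "u \<le> v" "v \<le> N"
  shows "of_real (\<Prod>n\<in>{u+1..v}. step_factor n) = phase (\<Sum>n\<in>{u+1..v}. j n) * phase (a' v - a' u) * (\<Prod>n\<in>{u+1..v}. step_term n)"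
  using assms(2,3)
proof (induction v rule: dec_induct)
  case base then show ?case by (simp add: phase_0)
next
  case (step v)
  have e: "{u+1..Suc v} = insert (Suc v) {u+1..v}" using step.hyps by auto
  have p: "phase (a' (Suc v) - a' u) = phase (a' v - a' u) * phase (a' (Suc v) - a' v)"
    by (simp flip: phase_add)
  have f: "of_real (step_factor (Suc v)) = phase (j (Suc v)) * phase (a' (Suc v) - a' v) * step_term (Suc v)"
    using step_factor_eq[of "Suc v"] step assms(1) by simp
  have "of_real (\<Prod>n\<in>insert (Suc v) {u+1..v}. step_factor n)
    = of_real (\<Prod>n\<in>{u+1..v}. step_factor n) * complex_of_real (step_factor (Suc v))"
    by (simp del: of_real_prod)
  also have "\<dots> = phase (\<Sum>n\<in>{u+1..v}. j n) * phase (a' v - a' u) * (\<Prod>n\<in>{u+1..v}. step_term n)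
      * (phase (j (Suc v)) * phase (a' (Suc v) - a' v) * step_term (Suc v))"
    unfolding f using step by simp
  also have "\<dots> = phase (\<Sum>n\<in>insert (Suc v) {u+1..v}. j n) * phase (a' (Suc v) - a' u)
      * (\<Prod>n\<in>insert (Suc v) {u+1..v}. step_term n)"
    unfolding p by (simp add: phase_add)
  finally show ?case unfolding e .
qed

text \<open>Triad sums of the ket are added along the chain and the integers \<open>2 * a' v\<close>
  removed. This is the integrality that later allows the sign of a sum of spins to be
  reversed.\<close>

lemma sum_j_Ints:
  assumes "1 \<le> u" "u \<le> v" "v \<le> N"
  shows "a' v - a' u + (\<Sum>n\<in>{u+1..v}. j n) \<in> \<int>"
  using assms(2,3)
proof (induction v rule: dec_induct)
  case base then show ?case by simp
next
  case (step v)
  have e: "{u+1..Suc v} = insert (Suc v) {u+1..v}" using step.hyps by auto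
  have "a' v + j (Suc v) + a' (Suc v) \<in> \<int>" "2 * a' v \<in> \<int>"
    using triad_sum_Ints(2)[of "Suc v"] spin_double_Ints[OF spin_a'[of v]] step assms(1) by auto
  moreover have "a' v - a' u + (\<Sum>n\<in>{u+1..v}. j n) \<in> \<int>" using step by simp
  ultimately have "a' v - a' u + (\<Sum>n\<in>{u+1..v}. j n) + (a' v + j (Suc v) + a' (Suc v)) - 2 * a' v \<in> \<int>"
    by (intro Ints_diff Ints_add[of "a' v - a' u + (\<Sum>n\<in>{u+1..v}. j n)"]) assumption+
  then show ?case unfolding e by (simp add: algebra_simps)
qed

lemma target_factor_eq:
  "of_real target_factor = phase (a' (K - 1) + j K + a K)
    * of_real (red_elem (j K) * sixj (a K) (j K) (a (K - 1)) 1 (a' (K - 1)) (j K))"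
proof -
  have sp: "spin (a (K - 1))" "spin (a' (K - 1))" "spin (j K)" "spin (a K)"
    using idx spin_a[of "K - 1"] spin_a'[of "K - 1"] spin_a[of K] spin_j[of K] by auto
  show ?thesis
  proof (cases "sixj (a' (K - 1)) (j K) (a K) (j K) (a (K - 1)) 1 = 0")
  case True
  show ?thesis using True sixj_scalar(2)[OF sp] by (simp add: target_factor_def)
next
  case False
  have "a' (K - 1) + j K + a K \<in> \<int>"
    using sixj_nonzeroD(1)[OF False] by (simp add: triad_def)
  then show ?thesis
    unfolding target_factor_def sixj_scalar(2)[OF sp] by (simp add: phase_Ints mult_ac)
  qed
qed

lemma bracket_eq:
  "of_real (bracket_ij_jk - bracket_jk_ij)
    = of_real ((red_elem (j J))\<^sup>2 * (sqrt (2 * a J + 1) * sqrt (2 * a' J + 1)))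
    * (- of_real (sixj (a J) (j J) (a' (J - 1)) 1 (a (J - 1)) (j J)) * of_real (sixj (a' (J - 1)) (j J) (a' J) 1 (a J) (j J))
      - phase (a' (J - 1) + j J + a' J) * phase (a (J - 1) + j J + a J + 1)
        * of_real (sixj (a' J) (j J) (a' (J - 1)) 1 (a (J - 1)) (j J)) * of_real (sixj (a (J - 1)) (j J) (a' J) 1 (a J) (j J)))"
proof -
  have sp: "spin (a (J - 1))" "spin (a' (J - 1))" "spin (j J)" "spin (a J)" "spin (a' J)"
    using idx spin_a[of "J - 1"] spin_a'[of "J - 1"] spin_a[of J] spin_a'[of J] spin_j[of J] by auto
  have i: "a' (J - 1) + j J + a' J \<in> \<int>" "a (J - 1) + j J + a J + 1 \<in> \<int>"
    using triad_sum_Ints[of J] idx by auto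
  have e: "sixj (a' (J - 1)) (j J) (a J) (j J) (a (J - 1)) 1 = sixj (a J) (j J) (a' (J - 1)) 1 (a (J - 1)) (j J)"
    "sixj (a J) 1 (a' J) (j J) (a' (J - 1)) (j J) = sixj (a' (J - 1)) (j J) (a' J) 1 (a J) (j J)"
    "sixj (a (J - 1)) (j J) (a' J) (j J) (a' (J - 1)) 1 = sixj (a' J) (j J) (a' (J - 1)) 1 (a (J - 1)) (j J)"
    "sixj (a J) 1 (a' J) (j J) (a (J - 1)) (j J) = sixj (a (J - 1)) (j J) (a' J) 1 (a J) (j J)"
    using sixj_scalar(1)[OF sp(1,2,3,4)] sixj_recouple_last(1)[OF sp(2,3,4,5)]
      sixj_scalar(2)[OF sp(2,1,3,5)] sixj_recouple_last(1)[OF sp(1,3,4,5)] by simp_all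
  show ?thesis
    unfolding bracket_ij_jk_def bracket_jk_ij_def e phase_Ints[OF i(1)] phase_Ints[OF i(2)]
    by (simp add: algebra_simps)
qed

end

text \<open>The products in \<open>X_fac\<close> are the squared reduced matrix elements up to a
  factor \<open>16\<close>.\<close>

lemma X_fac_eq: "spin b \<Longrightarrow> spin c \<Longrightarrow> sqrt (X_fac b c) = 4 * (red_elem b * red_elem c)"
proof -
  assume "spin b" "spin c"
  then have nn: "0 \<le> b" "0 \<le> c" by (auto dest: spin_nonneg)
  have "X_fac b c = 4\<^sup>2 * ((b * (b + 1) * (2 * b + 1)) * (c * (c + 1) * (2 * c + 1)))"
    by (simp add: X_fac_def algebra_simps power2_eq_square)
  then show ?thesis by (simp add: red_elem_def real_sqrt_mult)
qed

theorem mainTheorem1: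
  fixes N I J K :: nat and j a a' :: "nat \<Rightarrow> real"
  assumes "N \<ge> 1"
    and "\<And>n. n \<in> {1..N} \<Longrightarrow> spin (j n)"
    and "I < J" and "J < K" and "K \<le> N" and "I > 1" and "J > I + 1"
    and "gauge_inv N j a" and "gauge_inv N j a'"
  shows "braket N j (basis_vec N j a) (q_hat j I J K (basis_vec N j a')) =
      1 / 4 * phase (j K + j I + a (I - 1) + a K) * phase (a I - a' I)
      * phase (\<Sum>n\<in>{I+1..J-1}. j n) * phase (- (\<Sum>p\<in>{J+1..K-1}. j p))
      * of_real (sqrt (X_fac (j I) (j J)) * sqrt (X_fac (j J) (j K))
          * sqrt ((2 * a I + 1) * (2 * a' I + 1)) * sqrt ((2 * a J + 1) * (2 * a' J + 1)))
      * of_real (sixj (a (I - 1)) (j I) (a I)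
                      1 (a' I) (j I))
      * (\<Prod>n\<in>{I+1..J-1}. of_real (sqrt ((2 * a' n + 1) * (2 * a n + 1)))
          * phase (a' (n - 1) + a (n - 1) + 1)
          * of_real (sixj (j n) (a' (n - 1)) (a' n)
                          1 (a n) (a (n - 1))))
      * (\<Prod>n\<in>{J+1..K-1}. of_real (sqrt ((2 * a' n + 1) * (2 * a n + 1)))
          * phase (a' (n - 1) + a (n - 1) + 1)
          * of_real (sixj (j n) (a' (n - 1)) (a' n)
                          1 (a n) (a (n - 1))))
      * of_real (sixj (a K) (j K) (a (K - 1))
                      1 (a' (K - 1)) (j K))
      * (phase (a' J + a' (J - 1))
          * of_real (sixj (a J) (j J) (a' (J - 1))
                          1 (a (J - 1)) (j J))
          * of_real (sixj (a' (J - 1)) (j J) (a' J)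
                          1 (a J) (j J))
         - phase (a J + a (J - 1))
          * of_real (sixj (a' J) (j J) (a' (J - 1))
                          1 (a (J - 1)) (j J))
          * of_real (sixj (a (J - 1)) (j J) (a' J)
                          1 (a J) (j J)))
      * (\<Prod>n\<in>{2..I-1}. of_bool (a n = a' n)) * (\<Prod>n\<in>{K..N}. of_bool (a n = a' n))"
proof -
  interpret recoupling_pair N I J K j a a'
    using assms by unfold_locales (auto simp: gauge_inv_def)
  have 0: "a N = 0" "a' N = 0" using assms by (auto simp: gauge_inv_def)
  have sp: "spin (j I)" "spin (j J)" "spin (j K)" using spin_j idx by auto
  let ?S1 = "\<Sum>n\<in>{I+1..J-1}. j n" and ?S2 = "\<Sum>p\<in>{J+1..K-1}. j p"
  let ?P1 = "\<Prod>n\<in>{I+1..J-1}. step_term n" and ?P2 = "\<Prod>n\<in>{J+1..K-1}. step_term n"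
  let ?PA = "phase (a (I - 1) + j I + a I + 1)" and ?D1 = "phase (a' (J - 1) - a' I)"
    and ?D2 = "phase (a' (K - 1) - a' J)" and ?PC = "phase (a' (K - 1) + j K + a K)"
  let ?F = "phase (j K + j I + a (I - 1) + a K) * phase (a I - a' I) * phase (- ?S2)"
  let ?PB1 = "phase (a' (J - 1) + j J + a' J)" and ?PB2 = "phase (a (J - 1) + j J + a J + 1)"
  \<comment> \<open>Half the difference of the exponents in \<open>ph1\<close>. It contains
    \<open>?S2\<close>, so the phase of this sum turns into that of its negative, while
    \<open>?S1\<close> keeps its sign.\<close>
  have k: "1 + (a' (K - 1) - a' J + ?S2) \<in> \<int>"
    using sum_j_Ints[of J "K - 1"] idx by simp
  have kJ: "a' (J - 1) + j J + a' J \<in> \<int>" using triad_sum_Ints(2)[of J] idx by auto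
  \<comment> \<open>The minus sign of the first bracket term is absorbed as
    \<open>phase 1\<close>.\<close>
  have ph1: "- (?PA * ?D1 * phase ?S2 * ?D2 * ?PC) = ?F * phase (a' J + a' (J - 1))"
  proof -
    have "- (?PA * ?D1 * phase ?S2 * ?D2 * ?PC) = ?PA * ?D1 * phase ?S2 * ?D2 * ?PC * phase 1"
      by (simp add: phase_1)
    also have "\<dots> = phase (a (I - 1) + j I + a I + 1 + (a' (J - 1) - a' I) + ?S2 + (a' (K - 1) - a' J)
        + (a' (K - 1) + j K + a K) + 1)"
      by (simp only: phase_add)
    also have "\<dots> = phase (j K + j I + a (I - 1) + a K + (a I - a' I) + (- ?S2) + (a' J + a' (J - 1)))"
      by (rule phase_eqI[OF k]) (simp add: algebra_simps)
    also have "\<dots> = ?F * phase (a' J + a' (J - 1))" by (simp only: phase_add)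
    finally show ?thesis .
  qed
  \<comment> \<open>The two additional signs of the opposite operator order add the ket's triad sum
    at \<open>J\<close> to half the difference.\<close>
  have ph2: "?PA * ?D1 * phase ?S2 * ?D2 * ?PC * (?PB1 * ?PB2) = ?F * phase (a J + a (J - 1))"
  proof -
    have "?PA * ?D1 * phase ?S2 * ?D2 * ?PC * (?PB1 * ?PB2)
      = phase (a (I - 1) + j I + a I + 1 + (a' (J - 1) - a' I) + ?S2 + (a' (K - 1) - a' J)
        + (a' (K - 1) + j K + a K) + ((a' (J - 1) + j J + a' J) + (a (J - 1) + j J + a J + 1)))"
      by (simp only: phase_add)
    also have "\<dots> = phase (j K + j I + a (I - 1) + a K + (a I - a' I) + (- ?S2) + (a J + a (J - 1)))"
      by (rule phase_eqI[OF Ints_add[OF k kJ]]) (simp add: algebra_simps)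
    also have "\<dots> = ?F * phase (a J + a (J - 1))" by (simp only: phase_add)
    finally show ?thesis .
  qed
  have st: "of_real (\<Prod>n\<in>{I+1..J-1}. step_factor n) = phase ?S1 * ?D1 * ?P1"
    "of_real (\<Prod>n\<in>{J+1..K-1}. step_factor n) = phase ?S2 * ?D2 * ?P2"
    using prod_step_factor_eq[of I "J - 1"] prod_step_factor_eq[of J "K - 1"] idx by auto
  let ?Y1 = "complex_of_real (sixj (a J) (j J) (a' (J - 1)) 1 (a (J - 1)) (j J))"
  let ?Y2 = "complex_of_real (sixj (a' (J - 1)) (j J) (a' J) 1 (a J) (j J))"
  let ?Y3 = "complex_of_real (sixj (a' J) (j J) (a' (J - 1)) 1 (a (J - 1)) (j J))"
  let ?Y4 = "complex_of_real (sixj (a (J - 1)) (j J) (a' J) 1 (a J) (j J))"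
  let ?bI = "of_bool (\<forall>k\<in>{2..I-1}. a k = a' k) :: complex" and ?bK = "of_bool (\<forall>k\<in>{K..N}. a k = a' k) :: complex"
  let ?C = "complex_of_real (red_elem (j I) * (sqrt (2 * a I + 1) * sqrt (2 * a' I + 1)) * sixj (a (I - 1)) (j I) (a I) 1 (a' I) (j I))"
  let ?R = "complex_of_real ((red_elem (j J))\<^sup>2 * (sqrt (2 * a J + 1) * sqrt (2 * a' J + 1)))"
  let ?Z = "complex_of_real (red_elem (j K) * sixj (a K) (j K) (a (K - 1)) 1 (a' (K - 1)) (j K))"
  have "braket N j (basis_vec N j a) (q_hat j I J K (basis_vec N j a'))
    = 4 * ((?bI * ?PA * ?C) * (phase ?S1 * ?D1 * ?P1) * (?R * (- ?Y1 * ?Y2 - ?PB1 * ?PB2 * ?Y3 * ?Y4))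
      * (phase ?S2 * ?D2 * ?P2) * (?PC * ?Z) * ?bK)"
    unfolding braket_q_hat[OF 0] of_real_mult[of 4] of_real_mult[of _ "of_bool _"] of_real_mult[of _ target_factor]
      of_real_mult[of _ "prod _ _"] of_real_mult[of _ "bracket_ij_jk - bracket_jk_ij"]
      source_factor_eq target_factor_eq bracket_eq st
    by simp
  also have "\<dots> = 4 * (?bI * ?C * phase ?S1 * ?P1 * ?R * ?P2 * ?Z * ?bK) *
      (- (?PA * ?D1 * phase ?S2 * ?D2 * ?PC) * (?Y1 * ?Y2) - ?PA * ?D1 * phase ?S2 * ?D2 * ?PC * (?PB1 * ?PB2) * (?Y3 * ?Y4))"
    by (simp add: algebra_simps)
  also have "\<dots> = 4 * (?bI * ?C * phase ?S1 * ?P1 * ?R * ?P2 * ?Z * ?bK) *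
      (?F * phase (a' J + a' (J - 1)) * (?Y1 * ?Y2) - ?F * phase (a J + a (J - 1)) * (?Y3 * ?Y4))"
    unfolding ph1 ph2 ..
  \<comment> \<open>The commutator's factor \<open>4\<close> is written as
    \<open>1 / 4 * 4 * 4\<close>: one \<open>4\<close> goes into each root of \<open>X_fac\<close>,
    and the squared reduced matrix element at \<open>J\<close> is shared between them.\<close>
  also have "\<dots> = 1 / 4 * phase (j K + j I + a (I - 1) + a K) * phase (a I - a' I) * phase ?S1 * phase (- ?S2)
      * of_real (4 * (red_elem (j I) * red_elem (j J)) * (4 * (red_elem (j J) * red_elem (j K)))
          * (sqrt (2 * a I + 1) * sqrt (2 * a' I + 1)) * (sqrt (2 * a J + 1) * sqrt (2 * a' J + 1)))
      * of_real (sixj (a (I - 1)) (j I) (a I) 1 (a' I) (j I)) * ?P1 * ?P2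
      * of_real (sixj (a K) (j K) (a (K - 1)) 1 (a' (K - 1)) (j K))
      * (phase (a' J + a' (J - 1)) * ?Y1 * ?Y2 - phase (a J + a (J - 1)) * ?Y3 * ?Y4) * ?bI * ?bK"
    by (simp add: power2_eq_square algebra_simps)
  finally show ?thesis
    unfolding X_fac_eq[OF sp(1,2)] X_fac_eq[OF sp(2,3)] prod_of_bool_eq[OF finite_atLeastAtMost]
      real_sqrt_mult[of "2 * a I + 1"] real_sqrt_mult[of "2 * a J + 1"] step_term_def .
qed

end
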